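(* Consider the multi-period inventory system with Markov-modulated demand and state-dependent base-stock policies described in the context, and suppose assumptions (A1)–(A4) there hold. Then the sample complexity required by stochastic policy gradient methods for achieving an $\epsilon$-optimal state-dependent base-stock policy is $\tilde{\mathcal O}(\epsilon^{-1}\mathrm{poly}(T))$; that is, an $\epsilon$-optimal policy can be obtained by stochastic policy gradient methods using a sample size that is $\tilde{\mathcal O}(\epsilon^{-1})$ in the accuracy and polynomial in the planning horizon $T$.
   Context: Inventory model with Markov-modulated demand: $[T]=\{1,\dots,T\}$. The world state $i_t$ follows an exogenous time-homogeneous Markov chain on a finite set $\mathcal I$ with transition probabilities $p(j|i)$ and $i_1\sim\nu$, where $\nu$ is a stationary distribution of the chain (so $i_t\sim\nu$ for all $t$). The initial inventory $x_1\in(-\infty,B]$ has CDF $\rho$. In world state $i_t$ the (nonnegative) demand $D_t$ has CDF $P_D(\cdot|i_t)$; demands are correlated across periods only through the Markov chain, and $i_{t+1}\sim p(\cdot|i_t)$ and $D_t\sim P_D(\cdot|i_t)$ are independent given $i_t$. Parameters: base-stock levels $\theta_{t,i}$; $\Theta_t=\{\theta_t\in\mathbb R^{|\mathcal I|}:\theta_{t,i}\in[0,B]\ \forall i\in\mathcal I\}$ with $B\ge0$, $\Theta=\Theta_1\times\dots\times\Theta_T$. Policy: order $(\theta_{t,i_t}-x_t)^+$, so the inventory after ordering is $x_t\vee\theta_{t,i_t}$ and $x_{t+1}=x_t\vee\theta_{t,i_t}-D_t$ (unmet demand is backlogged). Per-period cost $L_t(y|i)=\mathbb E_{D\sim P_D(\cdot|i)}[h_t(y-D)^++b_t(y-D)^-]$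 with $h_t,b_t\ge0$, where $z^+=\max\{z,0\}$, $z^-=\max\{-z,0\}$. Objective $l(\theta)=\mathbb E[\sum_{t=1}^TL_t(x_t\vee\theta_{t,i_t}|i_t)\mid x_1\sim\rho,\,i_1\sim\nu]$. The policy class with $\theta\in\Theta$ is assumed to contain an optimal policy. The policy with parameter $\theta$ is $\epsilon$-optimal if $l(\theta)-\min_{\Theta}l\le\epsilon$. Assumptions. (A1) $x_1$ is independent of the Markov chain and of the demands. (A2) The CDF $\rho$ of $x_1$ is $L_\rho$-Lipschitz continuous and $P_D(\cdot|i)$ is $L_D$-Lipschitz continuous for all $i\in\mathcal I$. (A3) There is a constant $\alpha>0$ with $\rho(0)\ge\alpha$ and $P_D(B|i)\le1-\alpha$ for all $i\in\mathcal I$. (A4) The probability density functions of the demands at each period are uniformly bounded below by $\mu_D>0$ on $[0,B]$. Stochastic policy gradient methods here are projected stochastic gradient descent on $l$ over $\Theta$: $\theta^{k+1}=\mathrm{Proj}_\Theta(\theta^k-\gamma\,\hat g_k)$ with stepsize $\gamma$ equal to the reciprocal of a Lipschitz constant of $\nabla l$, where $\hat g_k$ is a mini-batch average of i.i.d. fresh stochastic gradients of $l$ at $\theta^k$ that are unbiased with bounded variance; the guarantee for such a method is on the expected objective gap. Sample complexity is the number of samples needed to obtain an $\epsilon$-optimal solution. $\tilde{\mathcal O}(\cdot)$ denotes the order in $\epsilon^{-1}$, hiding logarithmic dependence on $\epsilon^{-1}$.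
   Formalization: The costs are assumed to satisfy h_t + b_t ≥ κ > 0 and h_t, b_t ≤ H in every period, with constants depending on κ and H; if h_t = b_t = 0 in an early period the objective can be flat then cubic, and the ε^{-1} rate fails. *)

theory Defs
  imports "HOL-Probability.Probability"
begin

section \<open>Inventory system with Markov-modulated demand\<close>

text \<open>Periods are numbered from 1. \<open>W t\<close> is the world state of period \<open>t\<close>, ranging over a
  finite type. The law of chain and demands is specified through all finite-dimensional
  distributions: given the path of the chain, the demands are independent and \<open>D t\<close> has law
  \<open>PD (W t)\<close>; in particular the next world state and the current demand are conditionally
  independent given the current world state. Finiteness of the mean demand is what makes the
  one-period costs finite.\<close>

locale markov_inventory = prob_space M
  for M :: "'w measure" +
  fixes X1 :: "'w \<Rightarrow> real"
    and W :: "nat \<Rightarrow> 'w \<Rightarrow> 's::finite"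
    and D :: "nat \<Rightarrow> 'w \<Rightarrow> real"
    and P :: "'s \<Rightarrow> 's pmf"
    and \<nu> :: "'s pmf"
    and PD :: "'s \<Rightarrow> real measure"
    and \<rho> :: "real \<Rightarrow> real"
    and B :: real
  assumes B_nonneg: "0 \<le> B"
    and stationary: "bind_pmf \<nu> P = \<nu>"
    and demand_law: "\<And>i. real_distribution (PD i)"
    and demand_nonneg: "\<And>i. AE d in PD i. 0 \<le> d"
    and demand_mean: "\<And>i. integrable (PD i) (\<lambda>d. d)"
    and X1_measurable: "X1 \<in> borel_measurable M"
    and X1_le: "AE \<omega> in M. X1 \<omega> \<le> B"
    and X1_cdf: "cdf (distr M borel X1) = \<rho>"
    and W_measurable: "\<And>t. 1 \<le> t \<Longrightarrow> W t \<in> measurable M (count_space UNIV)"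
    and D_measurable: "\<And>t. 1 \<le> t \<Longrightarrow> D t \<in> borel_measurable M"
    and joint_law: "\<And>n s A. 1 \<le> n \<Longrightarrow> (\<And>t. t \<in> {1..n} \<Longrightarrow> A t \<in> sets borel) \<Longrightarrow>
       measure M {\<omega> \<in> space M. \<forall>t\<in>{1..n}. W t \<omega> = s t \<and> D t \<omega> \<in> A t} =
         pmf \<nu> (s 1) * (\<Prod>t\<in>{1..<n}. pmf (P (s t)) (s (Suc t)))
           * (\<Prod>t\<in>{1..n}. measure (PD (s t)) (A t))"

text \<open>One-period cost \<open>L\<^sub>t(y|i)\<close> with holding cost \<open>h t\<close> and backlogging cost \<open>b t\<close>.\<close>

definition period_cost ::
  "('s \<Rightarrow> real measure) \<Rightarrow> (nat \<Rightarrow> real) \<Rightarrow> (nat \<Rightarrow> real) \<Rightarrow> nat \<Rightarrow> real \<Rightarrow> 's \<Rightarrow> real" where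
  "period_cost PD h b t y i =
     (\<integral>d. h t * max (y - d) 0 + b t * max (- (y - d)) 0 \<partial>PD i)"

text \<open>A policy \<open>\<pi>\<close> maps period, inventory level and world state to the inventory level after
  ordering. The clause for period 0 is a dummy.\<close>

type_synonym 's policy = "nat \<Rightarrow> real \<Rightarrow> 's \<Rightarrow> real"

fun inventory ::
  "('w \<Rightarrow> real) \<Rightarrow> (nat \<Rightarrow> 'w \<Rightarrow> 's) \<Rightarrow> (nat \<Rightarrow> 'w \<Rightarrow> real) \<Rightarrow> 's policy \<Rightarrow> nat \<Rightarrow> 'w \<Rightarrow> real"
where
  "inventory X1 W D \<pi> 0 \<omega> = X1 \<omega>"
| "inventory X1 W D \<pi> (Suc t) \<omega> =
     (if t = 0 then X1 \<omega> else \<pi> t (inventory X1 W D \<pi> t \<omega>) (W t \<omega>) - D t \<omega>)"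

definition realized_cost where
  "realized_cost X1 W D PD h b T \<pi> \<omega> =
     (\<Sum>t\<in>{1..T}. period_cost PD h b t (\<pi> t (inventory X1 W D \<pi> t \<omega>) (W t \<omega>)) (W t \<omega>))"

definition base_stock :: "(nat \<times> 's \<Rightarrow> real) \<Rightarrow> 's policy" where
  "base_stock \<theta> t x i = max x (\<theta> (t, i))"

definition objective ::
  "'w measure \<Rightarrow> ('w \<Rightarrow> real) \<Rightarrow> (nat \<Rightarrow> 'w \<Rightarrow> 's) \<Rightarrow> (nat \<Rightarrow> 'w \<Rightarrow> real) \<Rightarrow>
   ('s \<Rightarrow> real measure) \<Rightarrow> (nat \<Rightarrow> real) \<Rightarrow> (nat \<Rightarrow> real) \<Rightarrow> nat \<Rightarrow> (nat \<times> 's \<Rightarrow> real) \<Rightarrow> real"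
where
  "objective M X1 W D PD h b T \<theta> =
     (\<integral>\<omega>. realized_cost X1 W D PD h b T (base_stock \<theta>) \<omega> \<partial>M)"

text \<open>Points of Euclidean space with finite coordinate set \<open>J\<close> are extensional functions on \<open>J\<close>,
  measured by \<^const>\<open>L2_set\<close>; here a coordinate is a pair of a period and a world state.\<close>

definition coords :: "nat \<Rightarrow> (nat \<times> 's) set" where
  "coords T = {1..T} \<times> UNIV"

definition levels :: "nat \<Rightarrow> real \<Rightarrow> (nat \<times> 's \<Rightarrow> real) set" where
  "levels T B = coords T \<rightarrow>\<^sub>E {0..B}"

text \<open>Competing policies need not be of base-stock type and may have infinite cost, hence the
  extended nonnegative expectation.\<close>

definition admissible :: "'s policy \<Rightarrow> bool" where
  "admissible \<pi> \<longleftrightarrow>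
     (\<forall>t i. (\<lambda>x. \<pi> t x i) \<in> borel_measurable borel \<and> (\<forall>x. x \<le> \<pi> t x i))"

definition contains_optimal_policy where
  "contains_optimal_policy M X1 W D PD h b T B \<longleftrightarrow>
     (\<exists>\<theta>\<in>levels T B. \<forall>\<pi>. admissible \<pi> \<longrightarrow>
        ennreal (objective M X1 W D PD h b T \<theta>)
          \<le> (\<integral>\<^sup>+\<omega>. ennreal (realized_cost X1 W D PD h b T \<pi> \<omega>) \<partial>M))"


section \<open>Projected stochastic gradient descent\<close>

definition grad :: "'j set \<Rightarrow> (('j \<Rightarrow> real) \<Rightarrow> real) \<Rightarrow> ('j \<Rightarrow> real) \<Rightarrow> 'j \<Rightarrow> real" where
  "grad J f \<theta> = (\<lambda>j\<in>J. deriv (\<lambda>z. f (\<theta>(j := z))) (\<theta> j))"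

text \<open>\<open>S\<close> is a Lipschitz constant of the gradient of \<open>f\<close> on \<open>\<Theta>\<close>. Since \<^const>\<open>deriv\<close> is total,
  existence of the partial derivatives has to be required separately.\<close>

definition grad_lipschitz ::
  "'j set \<Rightarrow> ('j \<Rightarrow> real) set \<Rightarrow> (('j \<Rightarrow> real) \<Rightarrow> real) \<Rightarrow> real \<Rightarrow> bool" where
  "grad_lipschitz J \<Theta> f S \<longleftrightarrow> 0 < S \<and>
     (\<forall>\<theta>\<in>\<Theta>. \<forall>j\<in>J. (\<lambda>z. f (\<theta>(j := z))) differentiable (at (\<theta> j))) \<and>
     (\<forall>\<theta>\<in>\<Theta>. \<forall>\<eta>\<in>\<Theta>. L2_set (\<lambda>j. grad J f \<theta> j - grad J f \<eta> j) J
        \<le> S * L2_set (\<lambda>j. \<theta> j - \<eta> j) J)"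

text \<open>\<open>G \<theta> \<xi>\<close> with \<open>\<xi>\<close> drawn from \<open>N\<close> is an unbiased stochastic gradient of \<open>f\<close> at every
  \<open>\<theta> \<in> \<Theta>\<close>, with variance at most \<open>\<sigma>\<^sup>2\<close>.\<close>

definition stochastic_gradient ::
  "'j set \<Rightarrow> ('j \<Rightarrow> real) set \<Rightarrow> (('j \<Rightarrow> real) \<Rightarrow> real) \<Rightarrow> real \<Rightarrow>
   'n measure \<Rightarrow> (('j \<Rightarrow> real) \<Rightarrow> 'n \<Rightarrow> 'j \<Rightarrow> real) \<Rightarrow> bool" where
  "stochastic_gradient J \<Theta> f \<sigma> N G \<longleftrightarrow> prob_space N \<and>
     (\<lambda>(\<theta>, \<xi>). G \<theta> \<xi>) \<in> measurable (PiM J (\<lambda>_. borel) \<Otimes>\<^sub>M N) (PiM J (\<lambda>_. borel)) \<and>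
     (\<forall>\<theta>\<in>\<Theta>.
        (\<forall>j\<in>J. integrable N (\<lambda>\<xi>. G \<theta> \<xi> j) \<and> (\<integral>\<xi>. G \<theta> \<xi> j \<partial>N) = grad J f \<theta> j) \<and>
        integrable N (\<lambda>\<xi>. (L2_set (\<lambda>j. G \<theta> \<xi> j - grad J f \<theta> j) J)\<^sup>2) \<and>
        (\<integral>\<xi>. (L2_set (\<lambda>j. G \<theta> \<xi> j - grad J f \<theta> j) J)\<^sup>2 \<partial>N) \<le> \<sigma>\<^sup>2)"

definition proj :: "'j set \<Rightarrow> ('j \<Rightarrow> real) set \<Rightarrow> ('j \<Rightarrow> real) \<Rightarrow> 'j \<Rightarrow> real" where
  "proj J \<Theta> v = arg_min_on (\<lambda>w. L2_set (\<lambda>j. v j - w j) J) \<Theta>"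

text \<open>Iterates with stepsize \<open>\<gamma>\<close> and batch size \<open>m\<close>; \<open>x (k, r)\<close> is the \<open>r\<close>-th sample drawn in
  iteration \<open>k\<close>.\<close>

primrec psgd ::
  "'j set \<Rightarrow> ('j \<Rightarrow> real) set \<Rightarrow> (('j \<Rightarrow> real) \<Rightarrow> 'n \<Rightarrow> 'j \<Rightarrow> real) \<Rightarrow> real \<Rightarrow> nat \<Rightarrow>
   ('j \<Rightarrow> real) \<Rightarrow> (nat \<times> nat \<Rightarrow> 'n) \<Rightarrow> nat \<Rightarrow> 'j \<Rightarrow> real" where
  "psgd J \<Theta> G \<gamma> m \<theta>0 x 0 = \<theta>0"
| "psgd J \<Theta> G \<gamma> m \<theta>0 x (Suc k) =
     proj J \<Theta> (\<lambda>j\<in>J. psgd J \<Theta> G \<gamma> m \<theta>0 x k j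
       - \<gamma> * ((\<Sum>r<m. G (psgd J \<Theta> G \<gamma> m \<theta>0 x k) (x (k, r)) j) / real m))"

text \<open>\<open>K\<close> iterations with batch size \<open>m\<close> and stepsize \<open>1 / S\<close> give an expected objective gap of
  at most \<open>\<epsilon>\<close>, for every starting point and every stochastic gradient with variance bound
  \<open>\<sigma>\<^sup>2\<close>. The type argument is the type of the samples.\<close>

definition psgd_guarantee ::
  "'n itself \<Rightarrow> 'j set \<Rightarrow> ('j \<Rightarrow> real) set \<Rightarrow> (('j \<Rightarrow> real) \<Rightarrow> real) \<Rightarrow> real \<Rightarrow> real \<Rightarrow>
   real \<Rightarrow> nat \<Rightarrow> nat \<Rightarrow> bool" where
  "psgd_guarantee TYPE('n) J \<Theta> f \<sigma> \<epsilon> S K m \<longleftrightarrow>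
     (\<forall>(N :: 'n measure) G. \<forall>\<theta>0\<in>\<Theta>. stochastic_gradient J \<Theta> f \<sigma> N G \<longrightarrow>
        integrable (PiM UNIV (\<lambda>_. N)) (\<lambda>x. f (psgd J \<Theta> G (1 / S) m \<theta>0 x K)) \<and>
        (\<integral>x. f (psgd J \<Theta> G (1 / S) m \<theta>0 x K) \<partial>PiM UNIV (\<lambda>_. N)) - (INF \<theta>\<in>\<Theta>. f \<theta>) \<le> \<epsilon>)"

text \<open>The least number \<open>K * m\<close> of samples with this guarantee (\<open>\<infinity>\<close> if there is none).\<close>

definition sample_complexity ::
  "'n itself \<Rightarrow> 'j set \<Rightarrow> ('j \<Rightarrow> real) set \<Rightarrow> (('j \<Rightarrow> real) \<Rightarrow> real) \<Rightarrow> real \<Rightarrow> real \<Rightarrow> enat" where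
  "sample_complexity TYPE('n) J \<Theta> f \<sigma> \<epsilon> =
     Inf {enat (K * m) | K m S. 1 \<le> m \<and> grad_lipschitz J \<Theta> f S
            \<and> psgd_guarantee TYPE('n) J \<Theta> f \<sigma> \<epsilon> S K m}"

end

(* Given the current world state, the next world state and the demand are independent of the
   past, so costs satisfy a performance difference identity: the costs of two base-stock policies
   theta and eta differ by a sum over periods of differences of the cost-to-go Q of theta, at the
   inventory levels reached under eta. Comparing theta with a one-coordinate perturbation gives
   the partial derivative P(W t = i, x_t < theta) * Q'(theta), which is Lipschitz because demands
   have Lipschitz distribution functions, and whose first factor is at least alpha * nu i.

   Q' is almost strongly increasing: Q'(y) - Q'(x) is at least kappa * mu * (y - x) minus the sum
   of the stationarity residuals of the later periods. The residuals enter additively, without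
   amplification from period to period, and this is what keeps every constant polynomial in T.
   Together with the performance difference identity it bounds the optimality gap by the square
   of the projected gradient residual, and under such a gradient domination inequality projected
   stochastic gradient descent contracts linearly up to a term of the order of the mini-batch
   variance. *)

theory Submission
  imports Defs
begin

section \<open>The Markov property\<close>

text \<open>The objective need not be convex: the cost-to-go after the next ordering decision is
  flat below the next level, and its derivative jumps there by \<open>u\<close> at that level,
  downwards if the level is badly chosen. Convexity is replaced by a lower bound on the increments
  of \<open>u\<close> in which each downward jump is paid for by the residual of its level.

  Costs and thresholds have kinks, but demand and inventory have no atoms, so all derivatives exist.
  Quantitatively, a window of radius r has probability of order r, and this turns jumps of
  integrands into Lipschitz constants of integrals.

  A residual is an arbitrary nonnegative vector that bounds the gradient in the directions the box
  leaves open. The domination inequality thus accepts whatever certificate the algorithm produces.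
  World states outside the support of \<nu> give no lower bound on the reach probability; since
  \<nu> is stationary the chain never enters them, and only the smallest positive mass of \<nu>
  appears in the constants.\<close>

locale independent_inventory = markov_inventory +
  assumes X1_indep: "indep_set
               (sets (vimage_algebra (space M) X1 borel))
               (sets (vimage_algebra (space M) (\<lambda>\<omega>. \<lambda>t\<in>{1..}. (W t \<omega>, D t \<omega>))
                 (PiM {1..} (\<lambda>_. count_space UNIV \<Otimes>\<^sub>M borel))))"
begin

lemma prob_space_PD: "prob_space (PD i)"
  using demand_law[of i] by (simp add: real_distribution_def)

lemma sets_PD [measurable_cong, simp]: "sets (PD i) = sets borel"
  using demand_law[of i] by (simp add: real_distribution_def real_distribution_axioms_def)

lemma space_PD [simp]: "space (PD i) = UNIV"
  using sets_eq_imp_space_eq[OF sets_PD[of i]] by simp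

declare X1_measurable [measurable]

lemma measurable_W' [measurable]: "W (Suc t) \<in> measurable M (count_space UNIV)"
  using W_measurable[of "Suc t"] by simp

lemma measurable_D' [measurable]: "D (Suc t) \<in> borel_measurable M"
  using D_measurable[of "Suc t"] by simp

text \<open>Independence is formulated for the infinite sequence of world states and demands, so the
  event about the first n periods is presented as the preimage of a cylinder \<open>?C\<close>. The
  law of \<open>X1\<close> then enters as a factor in front of \<open>joint_law\<close>.\<close>

lemma joint_law_X1:
  assumes n: "1 \<le> n" and A0: "A0 \<in> sets borel" and A: "\<And>t. t \<in> {1..n} \<Longrightarrow> A t \<in> sets borel"
  shows "prob {\<omega> \<in> space M. X1 \<omega> \<in> A0 \<and> (\<forall>t\<in>{1..n}. W t \<omega> = s t \<and> D t \<omega> \<in> A t)} =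
    prob {\<omega> \<in> space M. X1 \<omega> \<in> A0} * (pmf \<nu> (s 1) * (\<Prod>t\<in>{1..<n}. pmf (P (s t)) (s (Suc t)))
           * (\<Prod>t\<in>{1..n}. measure (PD (s t)) (A t)))"
proof -
  let ?f = "\<lambda>\<omega>. \<lambda>t\<in>{1..}. (W t \<omega>, D t \<omega>)"
  let ?N = "PiM {1::nat..} (\<lambda>_. count_space (UNIV::'b set) \<Otimes>\<^sub>M (borel :: real measure))"
  let ?C = "{g \<in> space ?N. \<forall>t\<in>{1..n}. g t \<in> {s t} \<times> A t}"
  have C: "?C \<in> sets ?N"
  proof -
    have "{g \<in> space ?N. g t \<in> {s t} \<times> A t} \<in> sets ?N" if "t \<in> {1..n}" for t
    proof -
      have 1: "(\<lambda>g. g t) \<in> measurable ?N (count_space UNIV \<Otimes>\<^sub>M borel)"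
        by (rule measurable_component_singleton) (use that in simp)
      have 2: "{s t} \<times> A t \<in> sets (count_space UNIV \<Otimes>\<^sub>M borel)"
        using A[OF that] by (intro pair_measureI) auto
      show ?thesis by (rule measurable_sets_Collect[OF 1]) (use 2 in simp)
    qed
    then show ?thesis by (intro sets.sets_Collect_finite_All) auto
  qed
  have f_space: "?f \<omega> \<in> space ?N" for \<omega>
    unfolding space_PiM by (rule restrict_PiE[THEN iffD2]) (simp add: space_pair_measure Pi_iff)
  have 1: "{\<omega> \<in> space M. \<forall>t\<in>{1..n}. W t \<omega> = s t \<and> D t \<omega> \<in> A t} = ?f -` ?C \<inter> space M"
  proof -
    have f_at: "?f \<omega> t = (W t \<omega>, D t \<omega>)" if "t \<in> {1..n}" for \<omega> t using that by simp
    have "?f \<omega> \<in> ?C \<longleftrightarrow> (\<forall>t\<in>{1..n}. W t \<omega> = s t \<and> D t \<omega> \<in> A t)" for \<omega>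
    proof -
      have "?f \<omega> \<in> ?C \<longleftrightarrow> (\<forall>t\<in>{1..n}. ?f \<omega> t \<in> {s t} \<times> A t)"
        using f_space by (simp only: mem_Collect_eq simp_thms)
      also have "\<dots> \<longleftrightarrow> (\<forall>t\<in>{1..n}. W t \<omega> = s t \<and> D t \<omega> \<in> A t)"
        by (intro ball_cong refl) (simp only: f_at mem_Times_iff fst_conv snd_conv singleton_iff)
      finally show ?thesis .
    qed
    then show ?thesis by (simp only: vimage_def) blast
  qed
  have 2: "{\<omega> \<in> space M. X1 \<omega> \<in> A0} = X1 -` A0 \<inter> space M" by auto
  have "prob ((X1 -` A0 \<inter> space M) \<inter> (?f -` ?C \<inter> space M))
      = prob (X1 -` A0 \<inter> space M) * prob (?f -` ?C \<inter> space M)"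
    by (rule indep_setD[OF X1_indep in_vimage_algebra[OF A0] in_vimage_algebra[OF C]])
  moreover have "{\<omega> \<in> space M. X1 \<omega> \<in> A0 \<and> (\<forall>t\<in>{1..n}. W t \<omega> = s t \<and> D t \<omega> \<in> A t)}
     = (X1 -` A0 \<inter> space M) \<inter> (?f -` ?C \<inter> space M)"
    unfolding 1[symmetric] by auto
  ultimately show ?thesis
    unfolding 1[symmetric] 2[symmetric] using joint_law[OF n A, where s=s] by simp
qed

text \<open>The conditional law of the pair \<open>(W (Suc t), D t)\<close> given
  \<open>W t = i\<close>; it is a product because the two are conditionally independent.\<close>

definition kern :: "'b \<Rightarrow> ('b \<times> real) measure" where
  "kern i = measure_pmf (P i) \<Otimes>\<^sub>M PD i"

lemma sets_kern [measurable_cong, simp]: "sets (kern i) = sets (count_space UNIV \<Otimes>\<^sub>M borel)"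
  unfolding kern_def by (intro sets_pair_measure_cong) auto

lemma space_kern [simp]: "space (kern i) = UNIV"
  by (simp add: kern_def space_pair_measure)

lemma prob_space_kern: "prob_space (kern i)"
proof -
  interpret A: prob_space "PD i" by (rule prob_space_PD)
  interpret pair_prob_space "measure_pmf (P i)" "PD i" by unfold_locales
  show ?thesis unfolding kern_def by (rule prob_space_axioms)
qed

lemma emeasure_kern:
  assumes "E \<in> sets (count_space UNIV \<Otimes>\<^sub>M borel)"
  shows "emeasure (kern i) E = (\<Sum>j\<in>UNIV. ennreal (pmf (P i) j) * emeasure (PD i) (Pair j -` E))"
proof -
  interpret A: prob_space "PD i" by (rule prob_space_PD)
  have "emeasure (kern i) E = (\<integral>\<^sup>+j. emeasure (PD i) (Pair j -` E) \<partial>measure_pmf (P i))"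
    unfolding kern_def using assms
    by (intro A.emeasure_pair_measure_alt) (simp add: kern_def[symmetric])
  also have "\<dots> = (\<integral>\<^sup>+j. ennreal (pmf (P i) j) * emeasure (PD i) (Pair j -` E) \<partial>count_space UNIV)"
    by (rule nn_integral_measure_pmf)
  also have "\<dots> = (\<Sum>j\<in>UNIV. ennreal (pmf (P i) j) * emeasure (PD i) (Pair j -` E))"
    by (simp add: nn_integral_count_space_finite)
  finally show ?thesis .
qed

section \<open>Histories before a period and the one-step transition\<close>

definition history_rect where
  "history_rect t A0 w A = {\<omega> \<in> space M. X1 \<omega> \<in> A0 \<and> (\<forall>s\<in>{1..<t}. W s \<omega> = w s \<and> D s \<omega> \<in> A s)}"

definition history :: "nat \<Rightarrow> 'a set set" where
  "history t = {history_rect t A0 w A | A0 w A. A0 \<in> sets borel \<and> (\<forall>s. A s \<in> sets borel)}"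

lemma history_rect_sets:
  assumes "A0 \<in> sets borel" "\<And>s. A s \<in> sets borel"
  shows "history_rect t A0 w A \<in> sets M"
proof -
  have "{\<omega> \<in> space M. W s \<omega> = w s \<and> D s \<omega> \<in> A s} \<in> sets M" if s: "s \<in> {1..<t}" for s
  proof -
    have [measurable]: "W s \<in> measurable M (count_space UNIV)" "D s \<in> borel_measurable M" 
      using W_measurable[of s] D_measurable[of s] s by auto
    have [measurable]: "A s \<in> sets borel" by fact
    show ?thesis by measurable
  qed
  then have "{\<omega> \<in> space M. \<forall>s\<in>{1..<t}. W s \<omega> = w s \<and> D s \<omega> \<in> A s} \<in> sets M"
    by (intro sets.sets_Collect_finite_All) auto
  moreover have [measurable]: "A0 \<in> sets borel" by fact
  have "{\<omega> \<in> space M. X1 \<omega> \<in> A0} \<in> sets M" by measurable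
  ultimately have "{\<omega> \<in> space M. X1 \<omega> \<in> A0} \<inter> {\<omega> \<in> space M. \<forall>s\<in>{1..<t}. W s \<omega> = w s \<and> D s \<omega> \<in> A s} \<in> sets M"
    by blast
  then show ?thesis
    by (rule back_subst[of "\<lambda>X. X \<in> sets M"]) (auto simp: history_rect_def)
qed

lemma history_subset: "history t \<subseteq> Pow (space M)" "history t \<subseteq> sets M"
  using sets.sets_into_space history_rect_sets by (auto simp: history_def history_rect_def) 

text \<open>Rectangles whose paths agree before t intersect componentwise. If the paths differ the
  intersection is empty, which is again a rectangle, with \<open>A0 = {}\<close>.\<close>

lemma Int_stable_history: "Int_stable (history t)"
proof (rule Int_stableI)
  fix a b assume "a \<in> history t" "b \<in> history t"
  then obtain A0 w A A0' w' A' where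
    a: "a = history_rect t A0 w A" "A0 \<in> sets borel" "\<And>s. A s \<in> sets borel" and
    b: "b = history_rect t A0' w' A'" "A0' \<in> sets borel" "\<And>s. A' s \<in> sets borel"
    unfolding history_def by blast
  show "a \<inter> b \<in> history t"
  proof (cases "\<forall>s\<in>{1..<t}. w s = w' s")
    case True
    then have "a \<inter> b = history_rect t (A0 \<inter> A0') w (\<lambda>s. A s \<inter> A' s)"
      unfolding a(1) b(1) history_rect_def by auto
    then show ?thesis using a b unfolding history_def by blast
  next
    case False
    then have "a \<inter> b = history_rect t {} w A"
      unfolding a(1) b(1) history_rect_def by auto
    then show ?thesis using a unfolding history_def by blast
  qed
qed

text \<open>The history stops before the state of period t, so that state is conditioned on
  separately. Both probabilities are instances of \<open>joint_law_X1\<close>, with horizons t and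
  \<open>Suc t\<close>, and the products differ by one transition factor and one demand
  factor.\<close>

lemma history_step_rect:
  assumes t: "1 \<le> t" and G: "G \<in> history t" and E: "E \<in> sets borel"
  shows "prob (G \<inter> {\<omega> \<in> space M. W t \<omega> = i \<and> W (Suc t) \<omega> = j \<and> D t \<omega> \<in> E})
    = prob (G \<inter> {\<omega> \<in> space M. W t \<omega> = i}) * (pmf (P i) j * measure (PD i) E)"
proof -
  interpret PDi: prob_space "PD k" for k by (rule prob_space_PD)
  have PDU: "measure (PD k) UNIV = 1" for k
    using PDi.prob_space[of k] by simp
  obtain A0 w A where
    G: "G = history_rect t A0 w A" and A: "A0 \<in> sets borel" "\<And>s. A s \<in> sets borel"
    using G unfolding history_def by blast
  \<comment> \<open>One path serves both horizons. \<open>A1\<close> leaves the demand of period t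
    free; \<open>A2\<close> restricts it to \<open>E\<close> and leaves that of period
    \<open>Suc t\<close> free.\<close>
  define w1 where "w1 = (\<lambda>s. if s < t then w s else if s = t then i else j)"
  define A1 where "A1 = (\<lambda>s. if s < t then A s else UNIV)"
  define A2 where "A2 = (\<lambda>s. if s < t then A s else if s = t then E else UNIV)"
  have A1: "A1 s \<in> sets borel" and A2: "A2 s \<in> sets borel" for s
    using A E by (auto simp: A1_def A2_def)
  have "G \<inter> {\<omega> \<in> space M. W t \<omega> = i}
      = {\<omega> \<in> space M. X1 \<omega> \<in> A0 \<and> (\<forall>s\<in>{1..t}. W s \<omega> = w1 s \<and> D s \<omega> \<in> A1 s)}"
  proof -
    have *: "{1..t} = insert t {1..<t}" using t by auto
    show ?thesis unfolding * G history_rect_def w1_def A1_def by auto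
  qed
  then have e1: "prob (G \<inter> {\<omega> \<in> space M. W t \<omega> = i}) = prob {\<omega> \<in> space M. X1 \<omega> \<in> A0} *
       (pmf \<nu> (w1 1) * (\<Prod>s\<in>{1..<t}. pmf (P (w1 s)) (w1 (Suc s)))
           * (\<Prod>s\<in>{1..t}. measure (PD (w1 s)) (A1 s)))"
    using joint_law_X1[OF t A(1), of A1 w1] A1 by simp
  have "G \<inter> {\<omega> \<in> space M. W t \<omega> = i \<and> W (Suc t) \<omega> = j \<and> D t \<omega> \<in> E}
      = {\<omega> \<in> space M. X1 \<omega> \<in> A0 \<and> (\<forall>s\<in>{1..Suc t}. W s \<omega> = w1 s \<and> D s \<omega> \<in> A2 s)}"
  proof -
    have *: "{1..Suc t} = insert (Suc t) (insert t {1..<t})" using t by auto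
    show ?thesis unfolding * G history_rect_def w1_def A2_def by auto
  qed
  then have e2: "prob (G \<inter> {\<omega> \<in> space M. W t \<omega> = i \<and> W (Suc t) \<omega> = j \<and> D t \<omega> \<in> E})
     = prob {\<omega> \<in> space M. X1 \<omega> \<in> A0} *
       (pmf \<nu> (w1 1) * (\<Prod>s\<in>{1..<Suc t}. pmf (P (w1 s)) (w1 (Suc s)))
           * (\<Prod>s\<in>{1..Suc t}. measure (PD (w1 s)) (A2 s)))"
    using joint_law_X1[OF _ A(1), of "Suc t" A2 w1] A2 by simp
  have p1: "(\<Prod>s\<in>{1..<Suc t}. pmf (P (w1 s)) (w1 (Suc s)))
      = (\<Prod>s\<in>{1..<t}. pmf (P (w1 s)) (w1 (Suc s))) * pmf (P i) j"
    using t by (simp add: w1_def)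
  have *: "(\<Prod>s\<in>{1..t}. f s) = (\<Prod>s\<in>{1..<t}. f s) * f t" for f :: "nat \<Rightarrow> real"
    using t by (metis One_nat_def prod.last_plus mult.commute)
  have p2: "(\<Prod>s\<in>{1..Suc t}. measure (PD (w1 s)) (A2 s))
      = (\<Prod>s\<in>{1..<t}. measure (PD (w1 s)) (A s)) * measure (PD i) E"
  proof -
    have "(\<Prod>s\<in>{1..Suc t}. measure (PD (w1 s)) (A2 s))
       = (\<Prod>s\<in>{1..t}. measure (PD (w1 s)) (A2 s)) * measure (PD (w1 (Suc t))) (A2 (Suc t))"
      using t by simp
    also have "measure (PD (w1 (Suc t))) (A2 (Suc t)) = 1" by (simp add: A2_def PDU)
    finally show ?thesis
      unfolding * by (simp add: A2_def w1_def)
  qed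
  have p3: "(\<Prod>s\<in>{1..t}. measure (PD (w1 s)) (A1 s))
      = (\<Prod>s\<in>{1..<t}. measure (PD (w1 s)) (A s))"
    unfolding * by (simp add: A1_def w1_def PDU)
  show ?thesis 
    by (rule trans[OF e2], subst e1, unfold p1 p2 p3) (simp only: mult.assoc mult.commute mult.left_commute)
qed

text \<open>Both sides are finite measures in \<open>G\<close>, so equality extends from the
  intersection-stable generator by Dynkin's argument.\<close>

lemma history_step_sigma:
  assumes t: "1 \<le> t" and G: "G \<in> sigma_sets (space M) (history t)" and E: "E \<in> sets borel"
  shows "prob (G \<inter> {\<omega> \<in> space M. W t \<omega> = i \<and> W (Suc t) \<omega> = j \<and> D t \<omega> \<in> E})
    = prob (G \<inter> {\<omega> \<in> space M. W t \<omega> = i}) * (pmf (P i) j * measure (PD i) E)"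
proof -
  have sM: "sigma_sets (space M) (history t) \<subseteq> sets M"
    by (rule sets.sigma_sets_subset) (rule history_subset)
  have [measurable]: "W t \<in> measurable M (count_space UNIV)" "D t \<in> borel_measurable M" "E \<in> sets borel"
    using W_measurable[of t] D_measurable[of t] t E by auto
  let ?X = "{\<omega> \<in> space M. W t \<omega> = i \<and> W (Suc t) \<omega> = j \<and> D t \<omega> \<in> E}"
  let ?Y = "{\<omega> \<in> space M. W t \<omega> = i}"
  have X: "?X \<in> sets M" and Y: "?Y \<in> sets M" by measurable
  let ?c = "pmf (P i) j * measure (PD i) E"
  have sp: "prob ?X = prob ?Y * ?c"
  proof -
    \<comment> \<open>Complements require the identity for the whole space. A rectangle prescribes
      the path, so the space is split into the finitely many paths before t.\<close>
    define H where "H w = history_rect t UNIV w (\<lambda>_. UNIV)" for w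
    define I :: "(nat \<Rightarrow> 'b) set" where "I = PiE {1..<t} (\<lambda>_. UNIV)"
    have H1: "H w \<in> history t" for w
      unfolding H_def history_def by force
    note H = H1 subsetD[OF history_subset(2) H1]
    have I: "finite I" unfolding I_def by (intro finite_PiE) auto
    have split: "prob S = (\<Sum>w\<in>I. prob (H w \<inter> S))" if S: "S \<in> sets M" for S
    proof -
      have U: "S = (\<Union>w\<in>I. H w \<inter> S)"
      proof -
        have "\<exists>w\<in>I. \<omega> \<in> H w" if "\<omega> \<in> S" for \<omega>
          using that sets.sets_into_space[OF S]
          by (intro bexI[of _ "\<lambda>s\<in>{1..<t}. W s \<omega>"]) (auto simp: H_def I_def history_rect_def)
        then show ?thesis by auto
      qed
      have d: "disjoint_family_on (\<lambda>w. H w \<inter> S) I"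
        unfolding disjoint_family_on_def
      proof (intro ballI impI)
        fix v w assume vw: "v \<in> I" "w \<in> I" "v \<noteq> w"
        then obtain s where "s \<in> {1..<t}" "v s \<noteq> w s"
          unfolding I_def by (meson PiE_ext)
        then show "H v \<inter> S \<inter> (H w \<inter> S) = {}"
          by (auto simp: H_def history_rect_def)
      qed
      show ?thesis
        by (subst U, subst finite_measure_finite_Union[OF I _ d]) (use H S in auto)
    qed
    have "prob ?X = (\<Sum>w\<in>I. prob (H w \<inter> ?Y) * ?c)"
      unfolding split[OF X] using history_step_rect[OF t H(1) E] by (intro sum.cong) auto
    then show ?thesis unfolding split[OF Y] by (simp add: sum_distrib_right)
  qed
  show ?thesis
    using Int_stable_history history_subset(1) G
  proof (induction rule: sigma_sets_induct_disjoint)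
    case (basic A) then show ?case using history_step_rect[OF t _ E] by blast
  next
    case empty then show ?case by simp
  next
    case (compl A)
    then have A: "A \<in> sets M" using sM by blast
    have *: "prob ((space M - A) \<inter> Z) = prob Z - prob (A \<inter> Z)" if "Z \<in> sets M" for Z
    proof -
      have "(space M - A) \<inter> Z = Z - A \<inter> Z" using sets.sets_into_space[OF that] by auto
      then show ?thesis using A that by (simp add: finite_measure_Diff)
    qed
    show ?case unfolding *[OF X] *[OF Y] compl.IH sp by (simp add: algebra_simps)
  next
    case (union A)
    then have A: "range A \<subseteq> sets M" using sM by blast
    have *: "(\<lambda>k. prob (A k \<inter> Z)) sums prob (\<Union>(range A) \<inter> Z)" if "Z \<in> sets M" for Z
    proof -
      have "(\<lambda>k. prob (A k \<inter> Z)) sums prob (\<Union>k. A k \<inter> Z)"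
        using A that union(1) by (intro finite_measure_UNION) (auto simp: disjoint_family_on_def)
      then show ?thesis by (simp add: Int_commute)
    qed
    show ?case
      using *[OF X] sums_mult2[OF *[OF Y], of ?c] unfolding union.IH by (rule sums_unique2)
  qed
qed

text \<open>Events that do not prescribe the whole path are unions of rectangles over paths, and
  these unions are finite because there are finitely many world states.\<close>

lemma Union_history_rect:
  assumes "A0 \<in> sets borel" "\<And>s. A s \<in> sets borel" "J \<subseteq> {1..<t} \<rightarrow>\<^sub>E UNIV"
  shows "(\<Union>w\<in>J. history_rect t A0 w A) \<in> sigma_sets (space M) (history t)"
proof -
  interpret S: sigma_algebra "space M" "sigma_sets (space M) (history t)"
    by (rule sigma_algebra_sigma_sets) (rule history_subset)
  have "finite J"
    by (rule finite_subset[OF assms(3)]) (intro finite_PiE, auto)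
  moreover have "history_rect t A0 w A \<in> sigma_sets (space M) (history t)" for w
    using assms unfolding history_def by blast
  ultimately show ?thesis by (intro S.finite_UN) auto
qed

definition hist_alg :: "nat \<Rightarrow> 'a measure" where
  "hist_alg t = sigma (space M) (history t)"

lemma space_hist_alg [simp]: "space (hist_alg t) = space M"
  unfolding hist_alg_def by (rule space_measure_of) (rule history_subset)

lemma sets_hist_alg: "sets (hist_alg t) = sigma_sets (space M) (history t)"
  unfolding hist_alg_def by (rule sets_measure_of) (rule history_subset)

lemma measurable_X1_hist: "X1 \<in> borel_measurable (hist_alg t)"
proof (rule measurableI)
  fix A :: "real set" assume A: "A \<in> sets borel"
  have "X1 -` A \<inter> space M = (\<Union>w\<in>{1..<t} \<rightarrow>\<^sub>E UNIV. history_rect t A w (\<lambda>_. UNIV))" (is "_ = ?R")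
  proof (intro set_eqI iffI)
    fix \<omega> assume "\<omega> \<in> X1 -` A \<inter> space M"
    then show "\<omega> \<in> ?R"
      by (intro UN_I[of "\<lambda>s\<in>{1..<t}. W s \<omega>"]) (auto simp: history_rect_def)
  qed (auto simp: history_rect_def)
  then show "X1 -` A \<inter> space (hist_alg t) \<in> sets (hist_alg t)"
    unfolding sets_hist_alg using Union_history_rect[OF A, of "\<lambda>_. UNIV" "{1..<t} \<rightarrow>\<^sub>E UNIV"] by simp
qed simp

lemma measurable_D_hist:
  assumes s: "s \<in> {1..<t}"
  shows "D s \<in> borel_measurable (hist_alg t)"
proof (rule measurableI)
  fix A :: "real set" assume A: "A \<in> sets borel"
  let ?A = "(\<lambda>_. UNIV)(s := A)"
  have "D s -` A \<inter> space M = (\<Union>w\<in>{1..<t} \<rightarrow>\<^sub>E UNIV. history_rect t UNIV w ?A)" (is "_ = ?R")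
  proof (intro set_eqI iffI)
    fix \<omega> assume "\<omega> \<in> D s -` A \<inter> space M"
    then show "\<omega> \<in> ?R"
      by (intro UN_I[of "\<lambda>s\<in>{1..<t}. W s \<omega>"]) (auto simp: history_rect_def)
  next
    fix \<omega> assume "\<omega> \<in> ?R"
    then obtain w where w: "\<omega> \<in> history_rect t UNIV w ?A" by blast
    then have "D s \<omega> \<in> ?A s" using s unfolding history_rect_def by blast
    then show "\<omega> \<in> D s -` A \<inter> space M" using w by (simp add: history_rect_def)
  qed
  then show "D s -` A \<inter> space (hist_alg t) \<in> sets (hist_alg t)"
    unfolding sets_hist_alg using Union_history_rect[of UNIV ?A "{1..<t} \<rightarrow>\<^sub>E UNIV"] A by simp
qed simp

lemma measurable_W_hist:
  assumes s: "s \<in> {1..<t}"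
  shows "W s \<in> measurable (hist_alg t) (count_space UNIV)"
proof (rule measurableI)
  fix A :: "'b set"
  have "W s -` A \<inter> space M = (\<Union>w\<in>{w \<in> {1..<t} \<rightarrow>\<^sub>E UNIV. w s \<in> A}. history_rect t UNIV w (\<lambda>_. UNIV))" (is "_ = ?R")
  proof (intro set_eqI iffI)
    fix \<omega> assume "\<omega> \<in> W s -` A \<inter> space M"
    then show "\<omega> \<in> ?R"
      using s by (intro UN_I[of "\<lambda>s\<in>{1..<t}. W s \<omega>"]) (auto simp: history_rect_def)
  qed (use s in \<open>auto simp: history_rect_def\<close>)
  then show "W s -` A \<inter> space (hist_alg t) \<in> sets (hist_alg t)"
    unfolding sets_hist_alg
    using Union_history_rect[of UNIV "\<lambda>_. UNIV" "{w \<in> {1..<t} \<rightarrow>\<^sub>E UNIV. w s \<in> A}"] by simp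
qed simp

abbreviation inv_lvl :: "(nat \<times> 'b \<Rightarrow> real) \<Rightarrow> nat \<Rightarrow> 'a \<Rightarrow> real" where
  "inv_lvl \<theta> \<equiv> inventory X1 W D (base_stock \<theta>)"

lemma inv_lvl_1 [simp]: "inv_lvl \<theta> (Suc 0) \<omega> = X1 \<omega>" by simp

lemma inv_lvl_Suc: "1 \<le> t \<Longrightarrow> inv_lvl \<theta> (Suc t) \<omega> = max (inv_lvl \<theta> t \<omega>) (\<theta> (t, W t \<omega>)) - D t \<omega>"
  by (simp add: base_stock_def)

text \<open>The inventory before ordering in period t is determined by \<open>X1\<close> and by the
  states and demands of the periods before t; the state of period t enters only through the
  order.\<close>

lemma measurable_inv_lvl_hist:
  assumes "s \<le> t" "1 \<le> s"
  shows "inv_lvl \<theta> s \<in> borel_measurable (hist_alg t)"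
  using assms(2,1)
proof (induction s rule: dec_induct)
  case base then show ?case using measurable_X1_hist[of t] by simp
next
  case (step s)
  then have [measurable]: "inv_lvl \<theta> s \<in> borel_measurable (hist_alg t)"
    "W s \<in> measurable (hist_alg t) (count_space UNIV)" "D s \<in> borel_measurable (hist_alg t)"
    using measurable_W_hist[of s t] measurable_D_hist[of s t] by auto
  show ?case
    unfolding inv_lvl_Suc[OF step(1)] by measurable
qed

lemma hist_alg_sub: "sets (hist_alg t) \<subseteq> sets M"
  unfolding sets_hist_alg by (rule sets.sigma_sets_subset) (rule history_subset)

lemma measurable_inv_lvl: "1 \<le> t \<Longrightarrow> inv_lvl \<theta> t \<in> borel_measurable M"
  using measurable_inv_lvl_hist[of t t \<theta>] hist_alg_sub[of t]
  by (auto simp: measurable_def)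

lemma history_step_kern:
  assumes t: "1 \<le> t" and G: "G \<in> sets (hist_alg t)" and E: "E \<in> sets (count_space UNIV \<Otimes>\<^sub>M borel)"
  shows "emeasure M (G \<inter> {\<omega> \<in> space M. W t \<omega> = i \<and> (W (Suc t) \<omega>, D t \<omega>) \<in> E})
    = emeasure M (G \<inter> {\<omega> \<in> space M. W t \<omega> = i}) * emeasure (kern i) E"
proof -
  interpret PDi: prob_space "PD i" by (rule prob_space_PD)
  have GM: "G \<in> sets M" using G hist_alg_sub by blast
  define Ej where "Ej j = Pair j -` E" for j
  have Ej [measurable]: "Ej j \<in> sets borel" for j
    unfolding Ej_def by (rule sets_Pair1[OF E])
  have [measurable]: "W t \<in> measurable M (count_space UNIV)" "D t \<in> borel_measurable M"
    using W_measurable[of t] D_measurable[of t] t by auto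
  let ?X = "\<lambda>j. {\<omega> \<in> space M. W t \<omega> = i \<and> W (Suc t) \<omega> = j \<and> D t \<omega> \<in> Ej j}"
  have X: "?X j \<in> sets M" for j by measurable
  have U: "G \<inter> {\<omega> \<in> space M. W t \<omega> = i \<and> (W (Suc t) \<omega>, D t \<omega>) \<in> E} = (\<Union>j\<in>UNIV. G \<inter> ?X j)"
    unfolding Ej_def by auto
  have "prob (\<Union>j\<in>UNIV. G \<inter> ?X j) = (\<Sum>j\<in>UNIV. prob (G \<inter> ?X j))"
    using GM X by (intro finite_measure_finite_Union) (auto simp: disjoint_family_on_def)
  also have "\<dots> = prob (G \<inter> {\<omega> \<in> space M. W t \<omega> = i}) * (\<Sum>j\<in>UNIV. pmf (P i) j * measure (PD i) (Ej j))"
    using history_step_sigma[OF t G[unfolded sets_hist_alg] Ej] by (simp add: sum_distrib_left)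
  also have "ennreal \<dots> = emeasure M (G \<inter> {\<omega> \<in> space M. W t \<omega> = i}) * emeasure (kern i) E"
    unfolding emeasure_kern[OF E] Ej_def[symmetric]
    by (subst ennreal_mult)
      (simp_all add: emeasure_eq_measure PDi.emeasure_eq_measure sum_nonneg sum_ennreal[symmetric] ennreal_mult del: sum_ennreal)
  finally show ?thesis unfolding U by (simp add: emeasure_eq_measure)
qed

text \<open>Restricting to \<open>W t = i\<close> without normalising avoids dividing by the
  probability of a state that may never occur. Under the restricted measure the inventory and the
  next pair factorise.\<close>

lemma markov_distr:
  fixes i :: 'b
  assumes t: "1 \<le> t"
  defines "Mi \<equiv> density M (indicator {\<omega> \<in> space M. W t \<omega> = i})"
  shows "distr Mi borel (inv_lvl \<theta> t) \<Otimes>\<^sub>M kern i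
     = distr Mi (borel \<Otimes>\<^sub>M (count_space UNIV \<Otimes>\<^sub>M borel)) (\<lambda>\<omega>. (inv_lvl \<theta> t \<omega>, W (Suc t) \<omega>, D t \<omega>))"
    and "finite_measure Mi"
proof -
  have [measurable]: "W t \<in> measurable M (count_space UNIV)" "D t \<in> borel_measurable M"
      "inv_lvl \<theta> t \<in> borel_measurable M"
    using W_measurable[of t] D_measurable[of t] measurable_inv_lvl[of t] t by auto
  have I: "{\<omega> \<in> space M. W t \<omega> = i} \<in> sets M" by measurable
  have em: "emeasure Mi A = emeasure M (A \<inter> {\<omega> \<in> space M. W t \<omega> = i})" if "A \<in> sets M" for A
    unfolding Mi_def using emeasure_restricted[OF I that] by (simp add: Int_commute)
  have [measurable_cong]: "sets Mi = sets M" by (simp add: Mi_def)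
  have spMi [simp]: "space Mi = space M" by (simp add: Mi_def)
  show fin: "finite_measure Mi"
    by (rule finite_measureI) (use em[of "space M"] in auto)
  interpret Mi: finite_measure Mi by fact
  interpret K: prob_space "kern i" by (rule prob_space_kern)
  interpret Y: finite_measure "distr Mi borel (inv_lvl \<theta> t)"
    by (rule Mi.finite_measure_distr) measurable
  show "distr Mi borel (inv_lvl \<theta> t) \<Otimes>\<^sub>M kern i
     = distr Mi (borel \<Otimes>\<^sub>M (count_space UNIV \<Otimes>\<^sub>M borel)) (\<lambda>\<omega>. (inv_lvl \<theta> t \<omega>, W (Suc t) \<omega>, D t \<omega>))"
  proof (rule pair_measure_eqI)
    show "sets (distr Mi borel (inv_lvl \<theta> t) \<Otimes>\<^sub>M kern i) =
      sets (distr Mi (borel \<Otimes>\<^sub>M (count_space UNIV \<Otimes>\<^sub>M borel)) (\<lambda>\<omega>. (inv_lvl \<theta> t \<omega>, W (Suc t) \<omega>, D t \<omega>)))"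
      by (simp cong: sets_pair_measure_cong)
  next
    fix A E assume "A \<in> sets (distr Mi borel (inv_lvl \<theta> t))" and "E \<in> sets (kern i)"
    then have A [measurable]: "A \<in> sets borel" and E [measurable]: "E \<in> sets (count_space UNIV \<Otimes>\<^sub>M borel)" by auto
    let ?G = "inv_lvl \<theta> t -` A \<inter> space M"
    let ?Z = "(\<lambda>\<omega>. (inv_lvl \<theta> t \<omega>, W (Suc t) \<omega>, D t \<omega>)) -` (A \<times> E) \<inter> space M"
    have G: "?G \<in> sets (hist_alg t)"
      using measurable_sets[OF measurable_inv_lvl_hist[of t t \<theta>] A] t by simp
    have AE: "A \<times> E \<in> sets (borel \<Otimes>\<^sub>M (count_space UNIV \<Otimes>\<^sub>M borel))" by measurable
    have Zm: "(\<lambda>\<omega>. (inv_lvl \<theta> t \<omega>, W (Suc t) \<omega>, D t \<omega>)) \<in> measurable M (borel \<Otimes>\<^sub>M (count_space UNIV \<Otimes>\<^sub>M borel))"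
      by measurable
    have Z: "?Z \<in> sets M" by (rule measurable_sets[OF Zm AE])
    have "emeasure (distr Mi borel (inv_lvl \<theta> t)) A = emeasure M (?G \<inter> {\<omega> \<in> space M. W t \<omega> = i})"
      using em[of ?G] G hist_alg_sub by (subst emeasure_distr) auto
    moreover have "emeasure (distr Mi (borel \<Otimes>\<^sub>M (count_space UNIV \<Otimes>\<^sub>M borel)) (\<lambda>\<omega>. (inv_lvl \<theta> t \<omega>, W (Suc t) \<omega>, D t \<omega>))) (A \<times> E)
       = emeasure M (?Z \<inter> {\<omega> \<in> space M. W t \<omega> = i})"
      using em[OF Z] AE by (subst emeasure_distr) auto
    moreover have "?Z \<inter> {\<omega> \<in> space M. W t \<omega> = i} = ?G \<inter> {\<omega> \<in> space M. W t \<omega> = i \<and> (W (Suc t) \<omega>, D t \<omega>) \<in> E}"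
      by auto
    ultimately show "emeasure (distr Mi borel (inv_lvl \<theta> t)) A * emeasure (kern i) E =
       emeasure (distr Mi (borel \<Otimes>\<^sub>M (count_space UNIV \<Otimes>\<^sub>M borel)) (\<lambda>\<omega>. (inv_lvl \<theta> t \<omega>, W (Suc t) \<omega>, D t \<omega>))) (A \<times> E)"
      using history_step_kern[OF t G E, of i] by simp
  qed (unfold_locales)
qed

text \<open>The integrand may depend on the current state. As there are finitely many states, the
  expectation is split over the events \<open>W t = i\<close>, and Fubini is applied on each piece
  through \<open>markov_distr\<close>.\<close>

lemma markov_step:
  fixes F :: "'b \<Rightarrow> real \<Rightarrow> 'b \<times> real \<Rightarrow> real"
  assumes t: "1 \<le> t"
    and F: "\<And>i. (\<lambda>(x, z). F i x z) \<in> borel_measurable (borel \<Otimes>\<^sub>M (count_space UNIV \<Otimes>\<^sub>M borel))"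
    and int: "integrable M (\<lambda>\<omega>. F (W t \<omega>) (inv_lvl \<theta> t \<omega>) (W (Suc t) \<omega>, D t \<omega>))"
  shows "integrable M (\<lambda>\<omega>. \<integral>z. F (W t \<omega>) (inv_lvl \<theta> t \<omega>) z \<partial>kern (W t \<omega>))" (is ?int)
    and "(\<integral>\<omega>. F (W t \<omega>) (inv_lvl \<theta> t \<omega>) (W (Suc t) \<omega>, D t \<omega>) \<partial>M)
       = (\<integral>\<omega>. \<integral>z. F (W t \<omega>) (inv_lvl \<theta> t \<omega>) z \<partial>kern (W t \<omega>) \<partial>M)" (is ?eq)
proof -
  have [measurable]: "W t \<in> measurable M (count_space UNIV)" "D t \<in> borel_measurable M"
      "inv_lvl \<theta> t \<in> borel_measurable M"
    using W_measurable[of t] D_measurable[of t] measurable_inv_lvl[of t] t by auto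
  note F [measurable]
  define I where "I i = {\<omega> \<in> space M. W t \<omega> = i}" for i
  have I [measurable]: "I i \<in> sets M" for i unfolding I_def by measurable
  define Z where "Z \<omega> = (W (Suc t) \<omega>, D t \<omega>)" for \<omega>
  have Z [measurable]: "Z \<in> measurable M (count_space UNIV \<Otimes>\<^sub>M borel)" unfolding Z_def by measurable
  let ?J = "\<lambda>i x. \<integral>z. F i x z \<partial>kern i"
  have J [measurable]: "?J i \<in> borel_measurable borel" for i
  proof -
    interpret K: prob_space "kern i" by (rule prob_space_kern)
    show ?thesis by (rule K.borel_measurable_lebesgue_integral) measurable
  qed
  have step: "integrable M (\<lambda>\<omega>. indicator (I i) \<omega> * ?J i (inv_lvl \<theta> t \<omega>)) \<and>
    (\<integral>\<omega>. indicator (I i) \<omega> * F i (inv_lvl \<theta> t \<omega>) (Z \<omega>) \<partial>M)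
     = (\<integral>\<omega>. indicator (I i) \<omega> * ?J i (inv_lvl \<theta> t \<omega>) \<partial>M)" for i
  proof -
    let ?Mi = "density M (indicator (I i))"
    let ?Y = "distr ?Mi borel (inv_lvl \<theta> t)"
    have Mi: "?Mi = density M (\<lambda>\<omega>. ennreal (indicator (I i) \<omega>))"
      by (intro density_cong) (auto simp: ennreal_indicator)
    have eq: "?Y \<Otimes>\<^sub>M kern i = distr ?Mi (borel \<Otimes>\<^sub>M (count_space UNIV \<Otimes>\<^sub>M borel)) (\<lambda>\<omega>. (inv_lvl \<theta> t \<omega>, Z \<omega>))"
      and "finite_measure ?Mi"
      using markov_distr(1)[OF t, of i \<theta>] markov_distr(2)[OF t, of i] unfolding I_def Z_def by auto
    interpret Mi: finite_measure ?Mi by fact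
    interpret K: prob_space "kern i" by (rule prob_space_kern)
    interpret Y: finite_measure ?Y
      by (rule Mi.finite_measure_distr) measurable
    interpret YK: pair_sigma_finite ?Y "kern i" by unfold_locales
    have "integrable M (\<lambda>\<omega>. indicator (I i) \<omega> * F (W t \<omega>) (inv_lvl \<theta> t \<omega>) (Z \<omega>))"
      using integrable_real_mult_indicator[OF I int] unfolding Z_def by (simp add: mult.commute)
    also have "(\<lambda>\<omega>. indicator (I i) \<omega> * F (W t \<omega>) (inv_lvl \<theta> t \<omega>) (Z \<omega>)) = (\<lambda>\<omega>. indicator (I i) \<omega> * F i (inv_lvl \<theta> t \<omega>) (Z \<omega>))"
      by (auto simp: I_def indicator_def)
    finally have i1: "integrable ?Mi (\<lambda>\<omega>. F i (inv_lvl \<theta> t \<omega>) (Z \<omega>))"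
      unfolding Mi by (subst integrable_density) auto
    have i2: "integrable (?Y \<Otimes>\<^sub>M kern i) (\<lambda>(x, z). F i x z)"
      unfolding eq by (subst integrable_distr_eq) (use i1 in auto)
    have i3: "integrable ?Y (?J i)"
      using YK.integrable_fst'[OF i2] by simp
    then have i4: "integrable ?Mi (\<lambda>\<omega>. ?J i (inv_lvl \<theta> t \<omega>))"
      by (subst (asm) integrable_distr_eq) auto
    then have i5: "integrable M (\<lambda>\<omega>. indicator (I i) \<omega> * ?J i (inv_lvl \<theta> t \<omega>))"
      unfolding Mi by (subst (asm) integrable_density) auto
    have "(\<integral>\<omega>. indicator (I i) \<omega> * F i (inv_lvl \<theta> t \<omega>) (Z \<omega>) \<partial>M) = (\<integral>\<omega>. F i (inv_lvl \<theta> t \<omega>) (Z \<omega>) \<partial>?Mi)"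
      unfolding Mi by (subst integral_density) auto
    also have "\<dots> = (\<integral>p. (\<lambda>(x, z). F i x z) p \<partial>(?Y \<Otimes>\<^sub>M kern i))"
      unfolding eq by (subst integral_distr) auto
    also have "\<dots> = (\<integral>x. ?J i x \<partial>?Y)"
      using YK.integral_fst'[OF i2] by simp
    also have "\<dots> = (\<integral>\<omega>. ?J i (inv_lvl \<theta> t \<omega>) \<partial>?Mi)"
      by (subst integral_distr) auto
    also have "\<dots> = (\<integral>\<omega>. indicator (I i) \<omega> * ?J i (inv_lvl \<theta> t \<omega>) \<partial>M)"
      unfolding Mi by (subst integral_density) auto
    finally show ?thesis using i5 by blast
  qed
  have dec: "g (W t \<omega>) = (\<Sum>i\<in>UNIV. indicator (I i) \<omega> * g i)" if "\<omega> \<in> space M" for g :: "'b \<Rightarrow> real" and \<omega>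
    using that by (simp add: I_def indicator_def if_distrib[of "\<lambda>x. x * _"] sum.If_cases eq_commute)
  have inti: "integrable M (\<lambda>\<omega>. indicator (I i) \<omega> * F i (inv_lvl \<theta> t \<omega>) (Z \<omega>))" for i
  proof -
    have "integrable M (\<lambda>\<omega>. indicator (I i) \<omega> * F (W t \<omega>) (inv_lvl \<theta> t \<omega>) (Z \<omega>))"
      using integrable_real_mult_indicator[OF I int] unfolding Z_def by (simp add: mult.commute)
    also have "(\<lambda>\<omega>. indicator (I i) \<omega> * F (W t \<omega>) (inv_lvl \<theta> t \<omega>) (Z \<omega>)) = (\<lambda>\<omega>. indicator (I i) \<omega> * F i (inv_lvl \<theta> t \<omega>) (Z \<omega>))"
      by (auto simp: I_def indicator_def)
    finally show ?thesis .
  qed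
  have "integrable M (\<lambda>\<omega>. \<Sum>i\<in>UNIV. indicator (I i) \<omega> * ?J i (inv_lvl \<theta> t \<omega>))"
    using step by (intro Bochner_Integration.integrable_sum) auto
  then show ?int
    by (rule Bochner_Integration.integrable_cong[THEN iffD1, OF refl, rotated]) (rule dec[symmetric])
  have "(\<integral>\<omega>. F (W t \<omega>) (inv_lvl \<theta> t \<omega>) (Z \<omega>) \<partial>M) = (\<integral>\<omega>. (\<Sum>i\<in>UNIV. indicator (I i) \<omega> * F i (inv_lvl \<theta> t \<omega>) (Z \<omega>)) \<partial>M)"
    by (intro Bochner_Integration.integral_cong refl dec)
  also have "\<dots> = (\<Sum>i\<in>UNIV. \<integral>\<omega>. indicator (I i) \<omega> * F i (inv_lvl \<theta> t \<omega>) (Z \<omega>) \<partial>M)"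
    using inti by (intro Bochner_Integration.integral_sum) auto
  also have "\<dots> = (\<Sum>i\<in>UNIV. \<integral>\<omega>. indicator (I i) \<omega> * ?J i (inv_lvl \<theta> t \<omega>) \<partial>M)"
    using step by simp
  also have "\<dots> = (\<integral>\<omega>. (\<Sum>i\<in>UNIV. indicator (I i) \<omega> * ?J i (inv_lvl \<theta> t \<omega>)) \<partial>M)"
    using step by (intro Bochner_Integration.integral_sum[symmetric]) auto
  also have "\<dots> = (\<integral>\<omega>. ?J (W t \<omega>) (inv_lvl \<theta> t \<omega>) \<partial>M)"
    by (intro Bochner_Integration.integral_cong refl dec[symmetric])
  finally show ?eq unfolding Z_def .
qed

end

section \<open>The cost-to-go and its derivative\<close>

text \<open>The difference quotients are bounded by \<bar>K\<bar>, so dominated convergence applies.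
  Differentiability is asked for almost everywhere and only at the point considered, which admits
  kinks whose position depends on the outcome.\<close>

lemma has_derivative_integral_lipschitz:
  fixes F :: "real \<Rightarrow> 'a \<Rightarrow> real"
  assumes N: "finite_measure N"
    and int: "\<And>x. integrable N (F x)"
    and lip: "\<And>x y \<omega>. \<omega> \<in> space N \<Longrightarrow> \<bar>F x \<omega> - F y \<omega>\<bar> \<le> K * \<bar>x - y\<bar>"
    and F' [measurable]: "F' \<in> borel_measurable N"
    and deriv: "AE \<omega> in N. ((\<lambda>x. F x \<omega>) has_real_derivative F' \<omega>) (at x)"
  shows "((\<lambda>x. \<integral>\<omega>. F x \<omega> \<partial>N) has_real_derivative (\<integral>\<omega>. F' \<omega> \<partial>N)) (at x)"
  unfolding DERIV_def tendsto_at_iff_sequentially comp_def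
proof (intro allI impI)
  fix X :: "nat \<Rightarrow> real"
  assume nz: "\<forall>i. X i \<in> UNIV - {0}" and X0: "X \<longlonglongrightarrow> 0"
  interpret N: finite_measure N by fact
  have F [measurable]: "F x \<in> borel_measurable N" for x using int by auto
  have "(\<lambda>k. \<integral>\<omega>. (F (x + X k) \<omega> - F x \<omega>) / X k \<partial>N) \<longlonglongrightarrow> (\<integral>\<omega>. F' \<omega> \<partial>N)"
  proof (rule integral_dominated_convergence[where w = "\<lambda>_. \<bar>K\<bar>"])
    show "AE \<omega> in N. (\<lambda>k. (F (x + X k) \<omega> - F x \<omega>) / X k) \<longlonglongrightarrow> F' \<omega>"
      using deriv
    proof eventually_elim
      case (elim \<omega>)
      then show ?case
        unfolding DERIV_def tendsto_at_iff_sequentially comp_def using nz X0 by blast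
    qed
    show "AE \<omega> in N. norm ((F (x + X k) \<omega> - F x \<omega>) / X k) \<le> \<bar>K\<bar>" for k
    proof (rule AE_I2)
      fix \<omega> assume "\<omega> \<in> space N"
      then have "\<bar>F (x + X k) \<omega> - F x \<omega>\<bar> \<le> K * \<bar>X k\<bar>" using lip[of \<omega> "x + X k" x] by simp
      also have "\<dots> \<le> \<bar>K\<bar> * \<bar>X k\<bar>" by (intro mult_right_mono) auto
      finally show "norm ((F (x + X k) \<omega> - F x \<omega>) / X k) \<le> \<bar>K\<bar>"
        using nz by (simp add: divide_le_eq)
    qed
  qed (auto simp: N.integrable_const)
  then show "(\<lambda>k. ((\<integral>\<omega>. F (x + X k) \<omega> \<partial>N) - (\<integral>\<omega>. F x \<omega> \<partial>N)) / X k) \<longlonglongrightarrow> (\<integral>\<omega>. F' \<omega> \<partial>N)"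
    using int by simp
qed

text \<open>Differences of the distribution function measure half-open intervals. To catch the left
  end point the interval is extended by a small \<open>d\<close>, which costs at most
  \<open>L * d\<close>.\<close>

lemma lipschitz_cdf_interval:
  fixes m :: "real measure"
  assumes m: "real_distribution m" and lip: "L-lipschitz_on UNIV (cdf m)" and ab: "x \<le> y"
  shows "measure m {x..y} \<le> L * (y - x)"
proof (rule field_le_epsilon)
  interpret real_distribution m by fact
  have L: "0 \<le> L" using lip lipschitz_on_nonneg by blast
  fix e :: real assume e: "0 < e"
  define d where "d = e / (L + 1)"
  have d: "0 < d" "L * d \<le> e" using e L by (auto simp: d_def field_simps)
  have "measure m {x..y} \<le> measure m {x - d<..y}" using d by (intro finite_measure_mono) auto
  also have "\<dots> = cdf m y - cdf m (x - d)" using d ab by (subst cdf_diff_eq) auto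
  also have "\<dots> \<le> \<bar>cdf m y - cdf m (x - d)\<bar>" by simp
  also have "\<dots> \<le> L * \<bar>y - (x - d)\<bar>" using lipschitz_onD[OF lip, of y "x - d"] by (simp add: dist_real_def)
  also have "\<dots> = L * (y - x) + L * d" using ab d by (simp add: algebra_simps)
  finally show "measure m {x..y} \<le> L * (y - x) + e" using d by linarith
qed

text \<open>The cost bounds hold in all periods, so nothing derived from \<open>H\<close> and
  \<kappa> depends on a horizon. Costs given only up to a horizon are extended before the locale is
  used.\<close>

locale base_stock_model = independent_inventory +
  fixes h b :: "nat \<Rightarrow> real" and H \<kappa> L\<rho> LD \<alpha> \<mu>D :: real
  assumes h_nonneg: "\<And>t. 0 \<le> h t" and h_le: "\<And>t. h t \<le> H"
    and b_nonneg: "\<And>t. 0 \<le> b t" and b_le: "\<And>t. b t \<le> H"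
    and \<kappa>_pos: "0 < \<kappa>" and \<kappa>_le: "\<And>t. \<kappa> \<le> h t + b t"
    and \<rho>_lipschitz: "L\<rho>-lipschitz_on UNIV \<rho>"
    and PD_lipschitz: "\<And>i. LD-lipschitz_on UNIV (cdf (PD i))"
    and \<alpha>_pos: "0 < \<alpha>" and \<alpha>_le: "\<alpha> \<le> \<rho> 0" and cdf_B: "\<And>i. cdf (PD i) B \<le> 1 - \<alpha>"
    and \<mu>D_pos: "0 < \<mu>D"
    and PD_density: "\<And>i. \<exists>f\<in>borel_measurable borel. (\<forall>z. 0 \<le> f z) \<and>
             PD i = density lborel (\<lambda>z. ennreal (f z)) \<and> (\<forall>z\<in>{0..B}. \<mu>D \<le> f z)"
begin

lemma H_nonneg: "0 \<le> H" using h_nonneg[of 0] h_le[of 0] by linarith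
lemma LD_nonneg: "0 \<le> LD" using PD_lipschitz lipschitz_on_nonneg by blast

lemma measure_kern:
  assumes "E \<in> sets (count_space UNIV \<Otimes>\<^sub>M borel)"
  shows "measure (kern i) E = (\<Sum>j\<in>UNIV. pmf (P i) j * measure (PD i) (Pair j -` E))"
proof -
  interpret PDi: prob_space "PD i" by (rule prob_space_PD)
  interpret K: prob_space "kern i" by (rule prob_space_kern)
  have "ennreal (measure (kern i) E) = ennreal (\<Sum>j\<in>UNIV. pmf (P i) j * measure (PD i) (Pair j -` E))"
    using emeasure_kern[OF assms, of i]
    by (simp add: K.emeasure_eq_measure PDi.emeasure_eq_measure sum_nonneg sum_ennreal[symmetric] ennreal_mult del: sum_ennreal)
  then show ?thesis by (subst (asm) ennreal_inj) (auto intro!: sum_nonneg)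
qed

lemma sum_pmf_UNIV: "(\<Sum>j\<in>UNIV. pmf (P i) j) = 1"
  by (rule sum_pmf_eq_1) auto

lemma measurable_kern_shift:
  assumes "\<And>j. g j \<in> borel_measurable borel" and f: "f \<in> borel_measurable N"
    and a: "a \<in> measurable N (count_space UNIV)"
  shows "(\<lambda>\<omega>. g (a \<omega> :: 'b) (f \<omega>) :: real) \<in> borel_measurable N"
  using a by (rule measurable_compose_countable[rotated]) (rule measurable_compose[OF f assms(1)])

text \<open>The centre may depend on the next world state, because the threshold met in the next
  period does. For each fixed next state the set is an interval of length
  \<open>2 * r\<close>.\<close>

lemma anti_kern:
  assumes "0 \<le> r"
  shows "measure (kern i) {z. \<bar>snd z - c (fst z)\<bar> \<le> r} \<le> 2 * LD * r"
proof -
  have [measurable]: "(\<lambda>z. c (fst z)) \<in> borel_measurable (count_space UNIV \<Otimes>\<^sub>M (borel :: real measure))"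
    by (rule measurable_compose[OF measurable_fst]) simp
  have "{z \<in> space (count_space UNIV \<Otimes>\<^sub>M (borel :: real measure)). \<bar>snd z - c (fst z)\<bar> \<le> r} \<in> sets (count_space UNIV \<Otimes>\<^sub>M borel)"
    by measurable
  then have E: "{z. \<bar>snd z - c (fst z)\<bar> \<le> r} \<in> sets (count_space UNIV \<Otimes>\<^sub>M borel)"
    by (simp add: space_pair_measure)
  have "measure (PD i) (Pair j -` {z. \<bar>snd z - c (fst z)\<bar> \<le> r}) \<le> 2 * LD * r" for j
  proof -
    have "Pair j -` {z. \<bar>snd z - c (fst z)\<bar> \<le> r} = {c j - r .. c j + r}" by auto
    then show ?thesis
      using lipschitz_cdf_interval[OF demand_law PD_lipschitz, of "c j - r" "c j + r" i] assms by simp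
  qed
  then have "measure (kern i) {z. \<bar>snd z - c (fst z)\<bar> \<le> r} \<le> (\<Sum>j\<in>UNIV. pmf (P i) j * (2 * LD * r))"
    unfolding measure_kern[OF E] by (intro sum_mono mult_left_mono) auto
  also have "\<dots> = 2 * LD * r" by (simp add: sum_distrib_right[symmetric] sum_pmf_UNIV)
  finally show ?thesis .
qed

lemma integrable_kern_snd: "integrable (kern i) snd"
proof -
  interpret PDi: prob_space "PD i" by (rule prob_space_PD)
  interpret K: prob_space "kern i" by (rule prob_space_kern)
  have d: "integrable (PD i) (\<lambda>d. \<bar>d\<bar>)" using demand_mean by auto
  have "(\<integral>\<^sup>+z. ennreal \<bar>snd z\<bar> \<partial>kern i) = (\<integral>\<^sup>+j. \<integral>\<^sup>+d. ennreal \<bar>d\<bar> \<partial>PD i \<partial>measure_pmf (P i))"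
    unfolding kern_def by (subst PDi.nn_integral_fst[symmetric]) (auto simp: kern_def[symmetric])
  also have "\<dots> < \<infinity>"
    using d by (simp add: nn_integral_eq_integral)
  finally show ?thesis by (intro integrableI_bounded) auto
qed

text \<open>A Lipschitz function grows at most linearly in the demand, and the mean demand is
  finite.\<close>

lemma kern_lip_integrable:
  fixes g :: "'b \<Rightarrow> real \<Rightarrow> real"
  assumes lip: "\<And>j x x'. \<bar>g j x - g j x'\<bar> \<le> K * \<bar>x - x'\<bar>" and g: "\<And>j. g j \<in> borel_measurable borel"
  shows "integrable (kern i) (\<lambda>z. g (fst z) (y - snd z))"
proof (rule Bochner_Integration.integrable_bound)
  interpret K: prob_space "kern i" by (rule prob_space_kern)
  show gm [measurable]: "(\<lambda>z. g (fst z) (y - snd z)) \<in> borel_measurable (kern i)"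
    by (rule measurable_kern_shift[OF g]) measurable
  show "integrable (kern i) (\<lambda>z. (\<Sum>j\<in>UNIV. \<bar>g j y\<bar>) + K * \<bar>snd z\<bar>)"
    using integrable_kern_snd[of i] by auto
  show "AE z in kern i. norm (g (fst z) (y - snd z)) \<le> norm ((\<Sum>j\<in>UNIV. \<bar>g j y\<bar>) + K * \<bar>snd z\<bar>)"
  proof (rule AE_I2)
    fix z :: "'b \<times> real"
    have "\<bar>g (fst z) (y - snd z) - g (fst z) y\<bar> \<le> K * \<bar>snd z\<bar>" using lip[of "fst z" "y - snd z" y] by simp
    moreover have "\<bar>g (fst z) y\<bar> \<le> (\<Sum>j\<in>UNIV. \<bar>g j y\<bar>)"
      using member_le_sum[of "fst z" UNIV "\<lambda>j. \<bar>g j y\<bar>"] by simp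
    ultimately show "norm (g (fst z) (y - snd z)) \<le> norm ((\<Sum>j\<in>UNIV. \<bar>g j y\<bar>) + K * \<bar>snd z\<bar>)" by simp
  qed
qed

lemma kern_bounded_integrable:
  fixes g :: "'b \<Rightarrow> real \<Rightarrow> real"
  assumes g: "\<And>j. g j \<in> borel_measurable borel" and bd: "\<And>j x. \<bar>g j x\<bar> \<le> K"
  shows "integrable (kern i) (\<lambda>z. g (fst z) (y - snd z))"
proof -
  interpret K: prob_space "kern i" by (rule prob_space_kern)
  have [measurable]: "(\<lambda>z. g (fst z) (y - snd z)) \<in> borel_measurable (kern i)"
    by (rule measurable_kern_shift[OF g]) measurable
  show ?thesis by (rule K.integrable_const_bound[of _ K]) (use bd in auto)
qed

lemma kern_integral_bound:
  fixes K :: real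
  assumes f: "integrable (kern i) f" and "\<And>z. \<bar>f z\<bar> \<le> K"
  shows "\<bar>\<integral>z. f z \<partial>kern i\<bar> \<le> K"
proof -
  interpret K: prob_space "kern i" by (rule prob_space_kern)
  have "\<bar>\<integral>z. f z \<partial>kern i\<bar> \<le> (\<integral>z. \<bar>f z\<bar> \<partial>kern i)" using integral_norm_bound[of "kern i" f] by simp
  also have "\<dots> \<le> (\<integral>z. K \<partial>kern i)" using assms by (intro integral_mono) auto
  finally show ?thesis using K.prob_space by simp
qed

text \<open>For integrands that are small outside a window around a discontinuity: the jump of size
  \<open>A\<close> counts only with the probability of the window, which is linear in its
  radius.\<close>

lemma kern_integral_jump_bound:
  fixes K :: real
  assumes f: "integrable (kern i) f" and r: "0 \<le> r" and A: "0 \<le> A"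
    and bd: "\<And>z. \<bar>f z\<bar> \<le> K + A * indicator {z. \<bar>snd z - c (fst z)\<bar> \<le> r} z"
  shows "\<bar>\<integral>z. f z \<partial>kern i\<bar> \<le> K + A * (2 * LD * r)"
proof -
  interpret K: prob_space "kern i" by (rule prob_space_kern)
  have [measurable]: "(\<lambda>z. c (fst z)) \<in> borel_measurable (kern i)"
    by (rule measurable_compose[of fst _ "count_space UNIV"]) auto
  have "{z \<in> space (kern i). \<bar>snd z - c (fst z)\<bar> \<le> r} \<in> sets (kern i)"
    by measurable
  then have S [measurable]: "{z. \<bar>snd z - c (fst z)\<bar> \<le> r} \<in> sets (kern i)" by simp
  have "\<bar>\<integral>z. f z \<partial>kern i\<bar> \<le> (\<integral>z. \<bar>f z\<bar> \<partial>kern i)" using integral_norm_bound[of "kern i" f] by simp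
  also have "\<dots> \<le> (\<integral>z. K + A * indicator {z. \<bar>snd z - c (fst z)\<bar> \<le> r} z \<partial>kern i)"
  proof (rule integral_mono)
    show "integrable (kern i) (\<lambda>z. K + A * indicator {z. \<bar>snd z - c (fst z)\<bar> \<le> r} z)"
      by (intro Bochner_Integration.integrable_add integrable_mult_right integrable_real_indicator)
        (use S in \<open>simp_all add: K.emeasure_eq_measure\<close>)
  qed (use f bd in auto)
  also have "\<dots> = K + A * measure (kern i) {z. \<bar>snd z - c (fst z)\<bar> \<le> r}"
    by (subst Bochner_Integration.integral_add)
      (use S in \<open>auto intro!: integrable_real_indicator simp: K.emeasure_eq_measure K.prob_space[unfolded space_kern]\<close>)
  also have "\<dots> \<le> K + A * (2 * LD * r)" using anti_kern[OF r, of i c] A by (intro add_left_mono mult_left_mono) auto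
  finally show ?thesis .
qed

end

text \<open>If both arguments lie on the same side of their thresholds, only the values differ.
  Otherwise one crossing separates them and the first argument is within \<open>r\<close> of its
  threshold.\<close>

lemma jump_diff_bound:
  fixes a a' x x' \<theta> \<theta>' :: real
  assumes "\<bar>a\<bar> \<le> C" "\<bar>a'\<bar> \<le> C" "\<bar>a - a'\<bar> \<le> E" "\<bar>(x - \<theta>) - (x' - \<theta>')\<bar> \<le> r"
  shows "\<bar>(if \<theta> < x then a else 0) - (if \<theta>' < x' then a' else 0)\<bar>
    \<le> E + C * (if \<bar>x - \<theta>\<bar> \<le> r then 1 else 0)"
proof -
  have E: "0 \<le> E" and C: "0 \<le> C" using assms by linarith+
  have r: "\<bar>x - \<theta>\<bar> \<le> r" if "\<theta> < x" "\<not> \<theta>' < x'" using assms(4) that by linarith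
  have r': "\<bar>x - \<theta>\<bar> \<le> r" if "\<not> \<theta> < x" "\<theta>' < x'" using assms(4) that by linarith
  show ?thesis
    using assms(1-3) E C r r' by (cases "\<theta> < x"; cases "\<theta>' < x'") simp_all
qed

context base_stock_model begin

section \<open>Cost-to-go, marginal cost and their Lipschitz constants\<close>

definition cost :: "nat \<Rightarrow> real \<Rightarrow> real" where
  "cost t x = h t * max x 0 + b t * max (- x) 0"

definition cost' :: "nat \<Rightarrow> real \<Rightarrow> real" where
  "cost' t x = (if 0 < x then h t else - b t)"

text \<open>\<open>q \<theta> n t y i\<close> is the expected cost of the \<open>n\<close> periods from \<open>t\<close> on, when the inventory after
  ordering is \<open>y\<close> in world state \<open>i\<close> and the later periods follow \<open>\<theta>\<close>; \<open>u\<close> will be its derivative in \<open>y\<close>.\<close>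

primrec q :: "(nat \<times> 'b \<Rightarrow> real) \<Rightarrow> nat \<Rightarrow> nat \<Rightarrow> real \<Rightarrow> 'b \<Rightarrow> real" where
  "q \<theta> 0 = (\<lambda>t y i. 0)"
| "q \<theta> (Suc n) = (\<lambda>t y i. \<integral>z. cost t (y - snd z) +
      q \<theta> n (Suc t) (max (y - snd z) (\<theta> (Suc t, fst z))) (fst z) \<partial>kern i)"

primrec u :: "(nat \<times> 'b \<Rightarrow> real) \<Rightarrow> nat \<Rightarrow> nat \<Rightarrow> real \<Rightarrow> 'b \<Rightarrow> real" where
  "u \<theta> 0 = (\<lambda>t y i. 0)"
| "u \<theta> (Suc n) = (\<lambda>t y i. \<integral>z. cost' t (y - snd z) +
      (if \<theta> (Suc t, fst z) < y - snd z then u \<theta> n (Suc t) (y - snd z) (fst z) else 0) \<partial>kern i)"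

lemma cost_lipschitz: "\<bar>cost t x - cost t y\<bar> \<le> H * \<bar>x - y\<bar>"
proof -
  have *: "\<bar>cost t x - cost t y\<bar> \<le> H * (x - y)" if "y \<le> x" for x y
  proof -
    have "cost t x - cost t y = h t * (max x 0 - max y 0) - b t * (max (- y) 0 - max (- x) 0)"
      by (simp add: cost_def algebra_simps)
    moreover have "0 \<le> h t * (max x 0 - max y 0)" "h t * (max x 0 - max y 0) \<le> H * (max x 0 - max y 0)"
      "0 \<le> b t * (max (- y) 0 - max (- x) 0)" "b t * (max (- y) 0 - max (- x) 0) \<le> H * (max (- y) 0 - max (- x) 0)"
      using that h_nonneg b_nonneg h_le b_le by (auto intro!: mult_nonneg_nonneg mult_right_mono)
    moreover have "H * (max x 0 - max y 0) + H * (max (- y) 0 - max (- x) 0) = H * (x - y)"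
      by (auto simp: max_def algebra_simps)
    ultimately show ?thesis by linarith
  qed
  show ?thesis using *[of x y] *[of y x] by (cases "x \<le> y") (auto simp: abs_minus_commute abs_of_nonneg abs_of_nonpos)
qed

lemma cost'_bound: "\<bar>cost' t x\<bar> \<le> H"
  using h_nonneg[of t] b_nonneg[of t] h_le[of t] b_le[of t] by (simp add: cost'_def)

lemma measurable_cost [measurable]: "cost t \<in> borel_measurable borel"
  unfolding cost_def by measurable

lemma measurable_cost' [measurable]: "cost' t \<in> borel_measurable borel"
  unfolding cost'_def by measurable

lemma cost_deriv: "x \<noteq> 0 \<Longrightarrow> (cost t has_real_derivative cost' t x) (at x)"
proof -
  assume "x \<noteq> 0"
  then consider "0 < x" | "x < 0" by linarith
  then show ?thesis
  proof cases
    case 1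
    have "((\<lambda>x. h t * x) has_real_derivative cost' t x) (at x)"
      using 1 by (auto intro!: derivative_eq_intros simp: cost'_def)
    then show ?thesis
      by (rule has_field_derivative_transform_within_open[of _ _ _ "{0<..}"]) (use 1 in \<open>auto simp: cost_def\<close>)
  next
    case 2
    have "((\<lambda>x. b t * (- x)) has_real_derivative cost' t x) (at x)"
      using 2 by (auto intro!: derivative_eq_intros simp: cost'_def)
    then show ?thesis
      by (rule has_field_derivative_transform_within_open[of _ _ _ "{..<0}"]) (use 2 in \<open>auto simp: cost_def\<close>)
  qed
qed

lemma measurable_of_lipschitz:
  fixes f :: "real \<Rightarrow> real"
  assumes "\<And>x y. \<bar>f x - f y\<bar> \<le> K * \<bar>x - y\<bar>"
  shows "f \<in> borel_measurable borel"
proof -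
  have K: "\<bar>K\<bar>-lipschitz_on UNIV f"
  proof (rule lipschitz_onI)
    fix x y
    have "\<bar>f x - f y\<bar> \<le> K * \<bar>x - y\<bar>" by fact
    also have "\<dots> \<le> \<bar>K\<bar> * \<bar>x - y\<bar>" by (intro mult_right_mono) auto
    finally show "dist (f x) (f y) \<le> \<bar>K\<bar> * dist x y" by (simp add: dist_real_def)
  qed simp
  show ?thesis using lipschitz_on_continuous_on[OF K] by (rule borel_measurable_continuous_onI)
qed

lemma integrand_lipschitz:
  assumes "\<And>y y' i. \<bar>v y i - v y' i\<bar> \<le> real n * H * \<bar>y - y'\<bar>"
  shows "\<bar>(cost t x + v (max x (\<theta> (Suc t, j))) j) - (cost t x' + v (max x' (\<theta> (Suc t, j))) j)\<bar>
    \<le> real (Suc n) * H * \<bar>x - x'\<bar>"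
proof -
  have "\<bar>max x (\<theta> (Suc t, j)) - max x' (\<theta> (Suc t, j))\<bar> \<le> \<bar>x - x'\<bar>" by linarith
  then have "real n * H * \<bar>max x (\<theta> (Suc t, j)) - max x' (\<theta> (Suc t, j))\<bar> \<le> real n * H * \<bar>x - x'\<bar>"
    by (rule mult_left_mono) (simp add: H_nonneg)
  then have "\<bar>v (max x (\<theta> (Suc t, j))) j - v (max x' (\<theta> (Suc t, j))) j\<bar> \<le> real n * H * \<bar>x - x'\<bar>"
    by (rule order_trans[OF assms])
  then show ?thesis using cost_lipschitz[of t x x'] by (simp add: algebra_simps) linarith
qed

text \<open>Ordering up to a level and subtracting a demand are nonexpansive in the inventory, so
  each remaining period adds just one cost slope \<open>H\<close>.\<close>

lemma q_lipschitz: "\<bar>q \<theta> n t y i - q \<theta> n t y' i\<bar> \<le> real n * H * \<bar>y - y'\<bar>"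
proof (induction n arbitrary: t y y' i)
  case (Suc n)
  let ?g = "\<lambda>j x. cost t x + q \<theta> n (Suc t) (max x (\<theta> (Suc t, j))) j"
  have lip: "\<bar>?g j x - ?g j x'\<bar> \<le> real (Suc n) * H * \<bar>x - x'\<bar>" for j x x'
    by (rule integrand_lipschitz[where v = "q \<theta> n (Suc t)", OF Suc.IH])
  have meas: "?g j \<in> borel_measurable borel" for j
    by (rule measurable_of_lipschitz[OF lip])
  have int: "integrable (kern i) (\<lambda>z. ?g (fst z) (y - snd z))" for y
    by (rule kern_lip_integrable[OF lip meas])
  have "q \<theta> (Suc n) t y i - q \<theta> (Suc n) t y' i = (\<integral>z. ?g (fst z) (y - snd z) - ?g (fst z) (y' - snd z) \<partial>kern i)"
    using Bochner_Integration.integral_diff[OF int[of y] int[of y']] by simp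
  also have "\<bar>\<dots>\<bar> \<le> real (Suc n) * H * \<bar>y - y'\<bar>"
  proof (rule kern_integral_bound)
    fix z :: "'b \<times> real"
    show "\<bar>?g (fst z) (y - snd z) - ?g (fst z) (y' - snd z)\<bar> \<le> real (Suc n) * H * \<bar>y - y'\<bar>"
      using lip[of "y - snd z" "fst z" "y' - snd z"] by simp
  qed (use Bochner_Integration.integrable_diff[OF int[of y] int[of y']] in simp)
  finally show ?case .
qed simp

lemma measurable_q [measurable]: "(\<lambda>y. q \<theta> n t y i) \<in> borel_measurable borel"
  by (rule measurable_of_lipschitz) (rule q_lipschitz)

lemma q_integrand_lipschitz:
  "\<bar>(cost t x + q \<theta> n (Suc t) (max x (\<theta> (Suc t, j))) j) -
       (cost t x' + q \<theta> n (Suc t) (max x' (\<theta> (Suc t, j))) j)\<bar> \<le> real (Suc n) * H * \<bar>x - x'\<bar>"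
  by (rule integrand_lipschitz[where v = "q \<theta> n (Suc t)", OF q_lipschitz])

lemma integrable_q:
  "integrable (kern i) (\<lambda>z. cost t (y - snd z) + q \<theta> n (Suc t) (max (y - snd z) (\<theta> (Suc t, fst z))) (fst z))"
  by (rule kern_lip_integrable[where g = "\<lambda>j x. cost t x + q \<theta> n (Suc t) (max x (\<theta> (Suc t, j))) j",
        OF q_integrand_lipschitz measurable_of_lipschitz[OF q_integrand_lipschitz]])

abbreviation jump :: "(nat \<times> 'b \<Rightarrow> real) \<Rightarrow> nat \<Rightarrow> nat \<Rightarrow> 'b \<Rightarrow> real \<Rightarrow> real" where
  "jump \<theta> n t j x \<equiv> (if \<theta> (t, j) < x then u \<theta> n t x j else 0)"

text \<open>Quadratic in the number of periods: the jump of the marginal cost at a level can be as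
  large as the marginal cost itself, of order \<open>n * H\<close>, and such jumps are summed over
  the remaining periods.\<close>

definition LU :: "nat \<Rightarrow> real" where "LU n = 4 * (real n)\<^sup>2 * H * LD"

text \<open>The two claims share one induction because the Lipschitz step needs the size of
  \<open>u\<close> at the next level as the height of the jump.\<close>

lemma u_bound_lipschitz:
  "\<bar>u \<theta> n t y i\<bar> \<le> real n * H \<and> \<bar>u \<theta> n t y i - u \<theta> n t y' i\<bar> \<le> LU n * \<bar>y - y'\<bar>"
proof (induction n arbitrary: t y y' i)
  case 0 then show ?case by (simp add: LU_def)
next
  case (Suc n)
  have u_bound_IH: "\<bar>u \<theta> n t y i\<bar> \<le> real n * H"
    and u_lip_IH: "\<bar>u \<theta> n t y i - u \<theta> n t y' i\<bar> \<le> LU n * \<bar>y - y'\<bar>" for t y i y'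
    using Suc.IH[of t y i y'] by auto
  let ?g = "\<lambda>j x. cost' t x + jump \<theta> n (Suc t) j x"
  have [measurable]: "(\<lambda>y. u \<theta> n (Suc t) y j) \<in> borel_measurable borel" for j
    by (rule measurable_of_lipschitz[of _ "LU n"]) (use Suc.IH in blast)
  have bd: "\<bar>?g j x\<bar> \<le> real (Suc n) * H" for j x
  proof -
    have "\<bar>jump \<theta> n (Suc t) j x\<bar> \<le> real n * H" using Suc.IH[of "Suc t" x j] H_nonneg by auto
    moreover have "real (Suc n) * H = H + real n * H" by (simp add: algebra_simps)
    ultimately show ?thesis using cost'_bound[of t x] by linarith
  qed
  have int: "integrable (kern i) (\<lambda>z. ?g (fst z) (y - snd z))" for y
    by (rule kern_bounded_integrable[OF _ bd]) measurable
  have "\<bar>u \<theta> (Suc n) t y i\<bar> \<le> real (Suc n) * H"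
    using kern_integral_bound[OF int[of y] bd] by simp
  moreover
  let ?\<delta> = "\<bar>y - y'\<bar>"
  let ?f1 = "\<lambda>z. cost' t (y - snd z) - cost' t (y' - snd z)"
  let ?f2 = "\<lambda>z. jump \<theta> n (Suc t) (fst z) (y - snd z) - jump \<theta> n (Suc t) (fst z) (y' - snd z)"
  have i1: "integrable (kern i) (\<lambda>z. cost' t (y - snd z))" for y
    by (rule kern_bounded_integrable[OF _ cost'_bound]) measurable
  have i2: "integrable (kern i) (\<lambda>z. jump \<theta> n (Suc t) (fst z) (y - snd z))" for y
    by (rule kern_bounded_integrable[of _ "real n * H"]) (measurable, use Suc.IH H_nonneg in auto)
  have "\<bar>\<integral>z. ?f1 z \<partial>kern i\<bar> \<le> 0 + (2 * H) * (2 * LD * ?\<delta>)"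
  proof (rule kern_integral_jump_bound[where c = "\<lambda>_. y"])
    fix z :: "'b \<times> real"
    show "\<bar>?f1 z\<bar> \<le> 0 + (2 * H) * indicator {z. \<bar>snd z - y\<bar> \<le> ?\<delta>} z"
      using h_nonneg[of t] b_nonneg[of t] h_le[of t] b_le[of t]
      by (auto simp: cost'_def indicator_def)
  qed (use i1 H_nonneg in auto)
  moreover have "\<bar>\<integral>z. ?f2 z \<partial>kern i\<bar> \<le> LU n * ?\<delta> + (real n * H) * (2 * LD * ?\<delta>)"
  proof (rule kern_integral_jump_bound[where c = "\<lambda>j. y - \<theta> (Suc t, j)"])
    fix z :: "'b \<times> real"
    have e: "indicator {z. \<bar>snd z - (y - \<theta> (Suc t, fst z))\<bar> \<le> ?\<delta>} z
        = (if \<bar>y - snd z - \<theta> (Suc t, fst z)\<bar> \<le> ?\<delta> then 1 else (0::real))"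
      by (auto simp: indicator_def)
    show "\<bar>?f2 z\<bar> \<le> LU n * ?\<delta> + (real n * H) * indicator {z. \<bar>snd z - (y - \<theta> (Suc t, fst z))\<bar> \<le> ?\<delta>} z"
      unfolding e
    proof (rule jump_diff_bound[OF u_bound_IH u_bound_IH])
      show "\<bar>u \<theta> n (Suc t) (y - snd z) (fst z) - u \<theta> n (Suc t) (y' - snd z) (fst z)\<bar> \<le> LU n * ?\<delta>"
        using u_lip_IH[of "Suc t" "y - snd z" "fst z" "y' - snd z"] by simp
    qed simp
  qed (use i2 H_nonneg in auto)
  moreover have "u \<theta> (Suc n) t y i - u \<theta> (Suc n) t y' i = (\<integral>z. ?f1 z \<partial>kern i) + (\<integral>z. ?f2 z \<partial>kern i)"
    using i1 i2 by simp
  \<comment> \<open>\<open>LU\<close> grows by \<open>8 * n + 4\<close> multiples of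
    \<open>H * LD\<close>. The kink of the period cost uses 4 and the threshold
    \<open>2 * n\<close>; the remaining \<open>6 * n\<close> is slack.\<close>
  moreover have "LU (Suc n) * ?\<delta> = 2 * H * (2 * LD * ?\<delta>) + (LU n * ?\<delta> + (real n * H) * (2 * LD * ?\<delta>)) + 6 * (real n * H * LD * ?\<delta>)"
    by (simp add: LU_def power2_eq_square algebra_simps)
  moreover have "0 \<le> 6 * (real n * H * LD * ?\<delta>)" using H_nonneg LD_nonneg by simp
  ultimately show ?case by linarith
qed

lemma u_bound: "\<bar>u \<theta> n t y i\<bar> \<le> real n * H" using u_bound_lipschitz by blast
lemma u_lipschitz: "\<bar>u \<theta> n t y i - u \<theta> n t y' i\<bar> \<le> LU n * \<bar>y - y'\<bar>" using u_bound_lipschitz by blast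

lemma measurable_u [measurable]: "(\<lambda>y. u \<theta> n t y i) \<in> borel_measurable borel"
  by (rule measurable_of_lipschitz) (rule u_lipschitz)

lemma integrable_cost': "integrable (kern i) (\<lambda>z. cost' t (y - snd z))"
  by (rule kern_bounded_integrable[OF _ cost'_bound]) measurable

lemma integrable_jump: "integrable (kern i) (\<lambda>z. jump \<theta> n t (fst z) (y - snd z))"
  by (rule kern_bounded_integrable[of _ "real n * H"]) (measurable, use u_bound H_nonneg in auto)

lemma u_Suc_split:
  "u \<theta> (Suc n) t y i = (\<integral>z. cost' t (y - snd z) \<partial>kern i) + (\<integral>z. jump \<theta> n (Suc t) (fst z) (y - snd z) \<partial>kern i)"
  using integrable_cost' integrable_jump by simp

text \<open>The window bound at radius 0.\<close>

lemma AE_kern_neq: "AE z in kern i. snd z \<noteq> c (fst z)"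
proof -
  interpret K: prob_space "kern i" by (rule prob_space_kern)
  have [measurable]: "(\<lambda>z. c (fst z)) \<in> borel_measurable (kern i)"
    by (rule measurable_compose[of fst _ "count_space UNIV"]) auto
  have "{z \<in> space (kern i). \<bar>snd z - c (fst z)\<bar> \<le> 0} \<in> sets (kern i)" by measurable
  moreover have "measure (kern i) {z. \<bar>snd z - c (fst z)\<bar> \<le> 0} = 0"
    using anti_kern[of 0 i c] measure_nonneg[of "kern i" "{z. \<bar>snd z - c (fst z)\<bar> \<le> 0}"] by (simp only: mult_zero_right order_antisym)
  ultimately show ?thesis
    by (intro AE_I[where N = "{z. \<bar>snd z - c (fst z)\<bar> \<le> 0}"]) (auto simp: K.emeasure_eq_measure)
qed

lemma max_compose_deriv:
  fixes f :: "real \<Rightarrow> real"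
  assumes "x \<noteq> \<theta>" and "(f has_real_derivative d) (at x)"
  shows "((\<lambda>x. f (max x \<theta>)) has_real_derivative (if \<theta> < x then d else 0)) (at x)"
proof (cases "\<theta> < x")
  case True
  have "((\<lambda>x. f (max x \<theta>)) has_real_derivative d) (at x)"
    by (rule has_field_derivative_transform_within_open[OF assms(2), of "{\<theta><..}"]) (use True in auto)
  then show ?thesis using True by simp
next
  case False
  then have x: "x < \<theta>" using assms by simp
  have "((\<lambda>x. f (max x \<theta>)) has_real_derivative 0) (at x)"
    by (rule has_field_derivative_transform_within_open[OF DERIV_const[of "f \<theta>"], of "{..<\<theta>}"]) (use x in auto)
  then show ?thesis using x by simp
qed

text \<open>The integrand has kinks where the demand equals \<open>y\<close> and where the remaining
  stock hits the next level; both are null events, so differentiation under the integral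
  applies.\<close>

lemma q_deriv: "((\<lambda>y. q \<theta> n t y i) has_real_derivative u \<theta> n t y i) (at y)"
proof (induction n arbitrary: t y i)
  case (Suc n)
  interpret K: prob_space "kern i" by (rule prob_space_kern)
  show ?case
    unfolding q.simps u.simps
  proof (rule has_derivative_integral_lipschitz)
    show "finite_measure (kern i)" by unfold_locales
    show "integrable (kern i) (\<lambda>z. cost t (y - snd z) + q \<theta> n (Suc t) (max (y - snd z) (\<theta> (Suc t, fst z))) (fst z))" for y
      by (rule integrable_q)
    show "\<bar>(cost t (x - snd z) + q \<theta> n (Suc t) (max (x - snd z) (\<theta> (Suc t, fst z))) (fst z)) -
        (cost t (y - snd z) + q \<theta> n (Suc t) (max (y - snd z) (\<theta> (Suc t, fst z))) (fst z))\<bar> \<le> (real (Suc n) * H) * \<bar>x - y\<bar>" for x y z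
      using q_integrand_lipschitz[of t "x - snd z" \<theta> n "fst z" "y - snd z"] by simp
    show "(\<lambda>z. cost' t (y - snd z) + jump \<theta> n (Suc t) (fst z) (y - snd z)) \<in> borel_measurable (kern i)"
      using integrable_cost' integrable_jump by (intro borel_measurable_add) blast+
    show "AE z in kern i. ((\<lambda>y. cost t (y - snd z) + q \<theta> n (Suc t) (max (y - snd z) (\<theta> (Suc t, fst z))) (fst z))
       has_real_derivative cost' t (y - snd z) + jump \<theta> n (Suc t) (fst z) (y - snd z)) (at y)"
      using AE_kern_neq[of "\<lambda>_. y" i] AE_kern_neq[of "\<lambda>j. y - \<theta> (Suc t, j)" i]
    proof eventually_elim
      case (elim z)
      have "((\<lambda>x. cost t x + q \<theta> n (Suc t) (max x (\<theta> (Suc t, fst z))) (fst z))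
         has_real_derivative cost' t (y - snd z) + jump \<theta> n (Suc t) (fst z) (y - snd z)) (at (y - snd z))"
      proof (rule DERIV_add)
        show "(cost t has_real_derivative cost' t (y - snd z)) (at (y - snd z))"
          by (rule cost_deriv) (use elim in simp)
        show "((\<lambda>x. q \<theta> n (Suc t) (max x (\<theta> (Suc t, fst z))) (fst z)) has_real_derivative
            jump \<theta> n (Suc t) (fst z) (y - snd z)) (at (y - snd z))"
          by (rule max_compose_deriv[where f = "\<lambda>x. q \<theta> n (Suc t) x (fst z)", OF _ Suc.IH])
            (use elim in linarith)
      qed
      then have *: "((\<lambda>x. cost t x + q \<theta> n (Suc t) (max x (\<theta> (Suc t, fst z))) (fst z))
         has_real_derivative cost' t (y - snd z) + jump \<theta> n (Suc t) (fst z) (y - snd z)) (at (y + - snd z))"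
        by simp
      show ?case using *[unfolded DERIV_shift] by simp
    qed
  qed
qed simp

lemma indicator_shift:
  fixes y r :: real and \<theta> :: "nat \<times> 'b \<Rightarrow> real"
  shows
  "indicator {z. \<bar>snd z - (y - \<theta> (t, fst z))\<bar> \<le> r} z
     = (if \<bar>y - snd z - \<theta> (t, fst z)\<bar> \<le> r then 1 else (0::real))"
  by (auto simp: indicator_def)

text \<open>Moving all levels by at most \<delta> changes the thresholded integrand only by the
  inherited difference, except in a window of radius \<delta>. The step from \<open>n\<close> to
  \<open>Suc n\<close> needs \<open>2 * n\<close> new multiples, and the squares provide
  \<open>2 * n + 1\<close>.\<close>

lemma u_param_lipschitz:
  assumes \<delta>: "\<And>p. \<bar>\<theta> p - \<eta> p\<bar> \<le> \<delta>"
  shows "\<bar>u \<theta> n t y i - u \<eta> n t y i\<bar> \<le> (real n)\<^sup>2 * (H * LD * \<delta>)"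
proof (induction n arbitrary: t y i)
  case (Suc n)
  have \<delta>0: "0 \<le> \<delta>" using \<delta>[of undefined] by linarith
  let ?f = "\<lambda>z. jump \<theta> n (Suc t) (fst z) (y - snd z) - jump \<eta> n (Suc t) (fst z) (y - snd z)"
  have "\<bar>\<integral>z. ?f z \<partial>kern i\<bar> \<le> (real n)\<^sup>2 * (H * LD * \<delta>) + (real n * H) * (2 * LD * \<delta>)"
  proof (rule kern_integral_jump_bound[where c = "\<lambda>j. y - \<theta> (Suc t, j)"])
    fix z :: "'b \<times> real"
    show "\<bar>?f z\<bar> \<le> (real n)\<^sup>2 * (H * LD * \<delta>) + (real n * H) * indicator {z. \<bar>snd z - (y - \<theta> (Suc t, fst z))\<bar> \<le> \<delta>} z"
      unfolding indicator_shift
      by (rule jump_diff_bound[OF u_bound u_bound Suc.IH]) (use \<delta>[of "(Suc t, fst z)"] in linarith)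
  qed (use integrable_jump H_nonneg \<delta>0 in auto)
  moreover have "u \<theta> (Suc n) t y i - u \<eta> (Suc n) t y i = (\<integral>z. ?f z \<partial>kern i)"
    unfolding u_Suc_split using integrable_jump by simp
  moreover have "(real n)\<^sup>2 * (H * LD * \<delta>) + (real n * H) * (2 * LD * \<delta>) \<le> (real (Suc n))\<^sup>2 * (H * LD * \<delta>)"
    using H_nonneg LD_nonneg \<delta>0 by (simp add: power2_eq_square algebra_simps)
  ultimately show ?case by linarith
qed simp

section \<open>Almost strong monotonicity of the marginal cost\<close>

lemma AE_kern: "AE z in kern i. fst z \<in> set_pmf (P i) \<and> 0 \<le> snd z"
proof -
  interpret PDi: prob_space "PD i" by (rule prob_space_PD)
  interpret pair_sigma_finite "measure_pmf (P i)" "PD i" by unfold_locales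
  show ?thesis
    unfolding kern_def
  proof (rule AE_pair_measure)
    have "{z \<in> space (kern i). fst z \<in> set_pmf (P i) \<and> 0 \<le> snd z} \<in> sets (kern i)"
      by measurable
    then show "{z \<in> space (measure_pmf (P i) \<Otimes>\<^sub>M PD i). fst z \<in> set_pmf (P i) \<and> 0 \<le> snd z}
        \<in> sets (measure_pmf (P i) \<Otimes>\<^sub>M PD i)" by (simp add: kern_def)
    show "AE j in measure_pmf (P i). AE d in PD i. fst (j, d) \<in> set_pmf (P i) \<and> 0 \<le> snd (j, d)"
      using AE_pmfI[of "P i" "\<lambda>j. j \<in> set_pmf (P i)"] demand_nonneg[of i]
      by (auto elim!: eventually_mono)
  qed
qed

text \<open>Residual bounds are available only for states charged by \<nu>; closedness of the
  support under the chain makes them available along all later periods.\<close>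

lemma set_pmf_stationary: "i \<in> set_pmf \<nu> \<Longrightarrow> j \<in> set_pmf (P i) \<Longrightarrow> j \<in> set_pmf \<nu>"
  using arg_cong[OF stationary, of set_pmf] by (auto simp: set_bind_pmf)

lemma measure_kern_snd:
  assumes "E \<in> sets borel"
  shows "measure (kern i) {z. snd z \<in> E} = measure (PD i) E"
proof -
  have "{z \<in> space (kern i). snd z \<in> E} \<in> sets (kern i)" using assms by measurable
  then have "{z :: 'b \<times> real. snd z \<in> E} \<in> sets (count_space UNIV \<Otimes>\<^sub>M borel)" by simp
  from measure_kern[OF this] show ?thesis
    by (simp add: vimage_def sum_distrib_right[symmetric] sum_pmf_UNIV)
qed

lemma PD_interval_ge:
  assumes "0 \<le> x" "x \<le> y" "y \<le> B"
  shows "\<mu>D * (y - x) \<le> measure (PD i) {x..<y}"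
proof -
  interpret PDi: prob_space "PD i" by (rule prob_space_PD)
  obtain f where f [measurable]: "f \<in> borel_measurable borel" and f0: "\<And>z. 0 \<le> f z"
    and PD: "PD i = density lborel (\<lambda>z. ennreal (f z))" and fl: "\<And>z. z \<in> {0..B} \<Longrightarrow> \<mu>D \<le> f z"
    using PD_density[of i] by blast
  have "ennreal (\<mu>D * (y - x)) = (\<integral>\<^sup>+z. ennreal \<mu>D * indicator {x..<y} z \<partial>lborel)"
    using assms \<mu>D_pos by (simp add: nn_integral_cmult_indicator ennreal_mult)
  also have "\<dots> \<le> (\<integral>\<^sup>+z. ennreal (f z) * indicator {x..<y} z \<partial>lborel)"
    using assms fl by (intro nn_integral_mono) (auto simp: indicator_def ennreal_leI)
  also have "\<dots> = emeasure (PD i) {x..<y}"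
    unfolding PD by (subst emeasure_density) auto
  also have "\<dots> = ennreal (measure (PD i) {x..<y})" by (rule PDi.emeasure_eq_measure)
  finally show ?thesis by (simp add: ennreal_le_iff)
qed

text \<open>The two slopes differ by exactly \<open>h t + b t\<close> on demands in
  \<open>{x..<y}\<close>, half-open because \<open>cost'\<close> takes the value
  \<open>- b t\<close> at 0. The density bound holds on \<open>{0..B}\<close> only, so for negative
  \<open>x\<close> just monotonicity is claimed.\<close>

lemma cost'_kern_mono:
  assumes "x < y" "y \<le> B"
  shows "(\<integral>z. cost' t (y - snd z) \<partial>kern i) - (\<integral>z. cost' t (x - snd z) \<partial>kern i)
    \<ge> (if 0 \<le> x then \<kappa> * \<mu>D * (y - x) else 0)"
proof -
  interpret K: prob_space "kern i" by (rule prob_space_kern)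
  let ?S = "{z. snd z \<in> {x..<y}} :: ('b \<times> real) set"
  have "(\<integral>z. cost' t (y - snd z) \<partial>kern i) - (\<integral>z. cost' t (x - snd z) \<partial>kern i)
     = (\<integral>z. cost' t (y - snd z) - cost' t (x - snd z) \<partial>kern i)"
    using integrable_cost' by simp
  also have "\<dots> = (\<integral>z. (h t + b t) * indicator ?S z \<partial>kern i)"
    using assms by (intro Bochner_Integration.integral_cong) (auto simp: cost'_def indicator_def)
  also have "\<dots> = (h t + b t) * measure (PD i) {x..<y}"
    using measure_kern_snd[of "{x..<y}" i] by simp
  finally have *: "(\<integral>z. cost' t (y - snd z) \<partial>kern i) - (\<integral>z. cost' t (x - snd z) \<partial>kern i)
    = (h t + b t) * measure (PD i) {x..<y}" .
  show ?thesis
  proof (cases "0 \<le> x")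
    case True
    have "\<kappa> * (\<mu>D * (y - x)) \<le> (h t + b t) * measure (PD i) {x..<y}"
      using PD_interval_ge[OF True, of y i] assms \<kappa>_le[of t] \<kappa>_pos \<mu>D_pos
      by (intro mult_mono) auto
    then show ?thesis using True unfolding * by (simp add: mult.assoc)
  next
    case False
    then show ?thesis unfolding * using h_nonneg[of t] b_nonneg[of t] by simp
  qed
qed

text \<open>The strong growth is supplied by the current period cost alone; later periods only have
  to lose little. Beyond the next level the thresholded derivative inherits the estimate for fewer
  periods, below it is 0, and at the level it drops by at most the residual. Between
  \<open>x\<close> and \<open>y\<close> this level is crossed at most once, so its residual is added
  once.\<close>

lemma u_almost_strongly_mono:
  assumes G0: "\<And>s. 0 \<le> G s"
    and G: "\<And>s j. j \<in> set_pmf \<nu> \<Longrightarrow> s \<in> {t<..<t+n} \<Longrightarrow> \<theta> (s, j) < B \<Longrightarrow> - G s \<le> u \<theta> (t + n - s) s (\<theta> (s, j)) j"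
    and i: "i \<in> set_pmf \<nu>" and xy: "x < y" "y \<le> B"
  shows "u \<theta> n t y i - u \<theta> n t x i \<ge>
    (if 0 < n \<and> 0 \<le> x then \<kappa> * \<mu>D * (y - x) else 0) - (\<Sum>s\<in>{t<..<t+n}. G s)"
  using G i xy
proof (induction n arbitrary: t x y i)
  case (Suc n)
  interpret K: prob_space "kern i" by (rule prob_space_kern)
  let ?\<Sigma> = "\<Sum>s\<in>{t<..<t + Suc n}. G s"
  have S0: "0 \<le> ?\<Sigma>" using G0 by (intro sum_nonneg) auto
  have jump: "- ?\<Sigma> \<le> jump \<theta> n (Suc t) (fst z) (y - snd z) - jump \<theta> n (Suc t) (fst z) (x - snd z)"
    if z: "fst z \<in> set_pmf (P i)" "0 \<le> snd z" for z
  proof (cases "n = 0")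
    case True then show ?thesis using S0 by simp
  next
    case False
    let ?j = "fst z" and ?y = "y - snd z" and ?x = "x - snd z" and ?th = "\<theta> (Suc t, fst z)"
    let ?R = "\<Sum>s\<in>{Suc t<..<Suc t + n}. G s"
    have "{t<..<t + Suc n} = insert (Suc t) {Suc t<..<Suc t + n}" using False by auto
    then have \<Sigma>: "?\<Sigma> = G (Suc t) + ?R" by simp
    have j: "?j \<in> set_pmf \<nu>" using set_pmf_stationary[OF Suc.prems(2) z(1)] .
    have G1: "- G (Suc t) \<le> u \<theta> n (Suc t) ?th ?j" if "?th < B"
      using Suc.prems(1)[OF j, of "Suc t"] that False by simp
    have IH: "- ?R \<le> u \<theta> n (Suc t) y' ?j - u \<theta> n (Suc t) x' ?j" if "x' < y'" "y' \<le> B" for x' y'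
    proof -
      have "(if 0 < n \<and> 0 \<le> x' then \<kappa> * \<mu>D * (y' - x') else 0) - ?R \<le> u \<theta> n (Suc t) y' ?j - u \<theta> n (Suc t) x' ?j"
        by (rule Suc.IH[OF _ j that]) (use Suc.prems(1) in auto)
      moreover have "0 \<le> (if 0 < n \<and> 0 \<le> x' then \<kappa> * \<mu>D * (y' - x') else 0)"
        using that \<kappa>_pos \<mu>D_pos by simp
      ultimately show ?thesis by linarith
    qed
    \<comment> \<open>Nonnegative demand keeps the stock below \<open>B\<close>, where the induction
      hypothesis applies.\<close>
    have yB: "?y \<le> B" "?x < ?y" using z Suc.prems by auto
    have G0': "0 \<le> G (Suc t)" by (rule G0)
    consider "?th < ?x" | "?x \<le> ?th" "?th < ?y" | "?y \<le> ?th" by linarith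
    then show ?thesis
    proof cases
      case 1
      then show ?thesis using IH[OF yB(2,1)] G0' yB unfolding \<Sigma> by simp
    next
      \<comment> \<open>The level lies between the two stocks: \<open>u\<close> at \<open>?y\<close>
        is compared with \<open>u\<close> at the level, and the latter with 0 through its residual.
        The level is below \<open>?y\<close>, hence below \<open>B\<close>, so \<open>G1\<close> is
        available.\<close>
      case 2
      then show ?thesis using IH[OF 2(2) yB(1)] G1 yB unfolding \<Sigma> by simp
    next
      case 3
      then show ?thesis using S0 yB by simp
    qed
  qed
  have "- ?\<Sigma> = (\<integral>z. - ?\<Sigma> \<partial>kern i)" using K.prob_space by simp
  also have "\<dots> \<le> (\<integral>z. jump \<theta> n (Suc t) (fst z) (y - snd z) - jump \<theta> n (Suc t) (fst z) (x - snd z) \<partial>kern i)"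
  proof (rule integral_mono_AE)
    show "AE z in kern i. - ?\<Sigma> \<le> jump \<theta> n (Suc t) (fst z) (y - snd z) - jump \<theta> n (Suc t) (fst z) (x - snd z)"
      using AE_kern[of i] by eventually_elim (rule jump, auto)
  qed (use integrable_jump in auto)
  also have "\<dots> = (\<integral>z. jump \<theta> n (Suc t) (fst z) (y - snd z) \<partial>kern i) - (\<integral>z. jump \<theta> n (Suc t) (fst z) (x - snd z) \<partial>kern i)"
    using integrable_jump by simp
  finally show ?case
    using cost'_kern_mono[OF Suc.prems(3,4), of i t] unfolding u_Suc_split by simp
qed simp

declare inventory.simps(2) [simp del] q.simps(2) [simp del] u.simps(2) [simp del]

lemma measurable_level: "1 \<le> t \<Longrightarrow> (\<lambda>\<omega>. \<theta> (t, W t \<omega>) :: real) \<in> borel_measurable M"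
  by (rule measurable_compose[OF W_measurable]) simp_all

abbreviation post :: "(nat \<times> 'b \<Rightarrow> real) \<Rightarrow> nat \<Rightarrow> 'a \<Rightarrow> real" where
  "post \<theta> t \<omega> \<equiv> max (inv_lvl \<theta> t \<omega>) (\<theta> (t, W t \<omega>))"

lemma measurable_post: "1 \<le> t \<Longrightarrow> post \<theta> t \<in> borel_measurable M"
  by (intro borel_measurable_max measurable_inv_lvl measurable_level)

subsection \<open>Performance difference\<close>

text \<open>Transfers facts about the demand laws to the random variable \<open>D t\<close>. The
  factorisation is used with the inventory of an arbitrary policy, here the zero levels, which is
  then integrated out.\<close>

lemma nn_integral_demand:
  assumes t: "1 \<le> t" and f [measurable]: "f \<in> borel_measurable borel"
  shows "(\<integral>\<^sup>+\<omega>. f (D t \<omega>) \<partial>M) = (\<Sum>i\<in>UNIV. emeasure M {\<omega> \<in> space M. W t \<omega> = i} * (\<integral>\<^sup>+z. f (snd z) \<partial>kern i))"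
proof -
  have [measurable]: "W t \<in> measurable M (count_space UNIV)" "D t \<in> borel_measurable M"
      "inv_lvl (\<lambda>_. 0) t \<in> borel_measurable M"
    using W_measurable[of t] D_measurable[of t] measurable_inv_lvl[of t] t by auto
  define I where "I i = {\<omega> \<in> space M. W t \<omega> = i}" for i
  have I [measurable]: "I i \<in> sets M" for i unfolding I_def by measurable
  have "(\<integral>\<^sup>+\<omega>. f (D t \<omega>) \<partial>M) = (\<integral>\<^sup>+\<omega>. (\<Sum>i\<in>UNIV. indicator (I i) \<omega> * f (D t \<omega>)) \<partial>M)"
  proof (rule nn_integral_cong)
    fix \<omega> assume "\<omega> \<in> space M"
    then have "(\<Sum>i\<in>UNIV. indicator (I i) \<omega> * f (D t \<omega>)) = (\<Sum>i\<in>UNIV. if i = W t \<omega> then f (D t \<omega>) else 0)"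
      by (intro sum.cong) (auto simp: I_def)
    then show "f (D t \<omega>) = (\<Sum>i\<in>UNIV. indicator (I i) \<omega> * f (D t \<omega>))" by simp
  qed
  also have "\<dots> = (\<Sum>i\<in>UNIV. \<integral>\<^sup>+\<omega>. indicator (I i) \<omega> * f (D t \<omega>) \<partial>M)"
    by (rule nn_integral_sum) measurable
  also have "\<dots> = (\<Sum>i\<in>UNIV. emeasure M (I i) * (\<integral>\<^sup>+z. f (snd z) \<partial>kern i))"
  proof (rule sum.cong[OF refl])
    fix i
    let ?Mi = "density M (indicator (I i))"
    let ?Y = "distr ?Mi borel (inv_lvl (\<lambda>_. 0) t)"
    have eq: "?Y \<Otimes>\<^sub>M kern i = distr ?Mi (borel \<Otimes>\<^sub>M (count_space UNIV \<Otimes>\<^sub>M borel)) (\<lambda>\<omega>. (inv_lvl (\<lambda>_. 0) t \<omega>, W (Suc t) \<omega>, D t \<omega>))"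
      using markov_distr(1)[OF t, of i "\<lambda>_. 0"] unfolding I_def .
    interpret K: prob_space "kern i" by (rule prob_space_kern)
    have "(\<integral>\<^sup>+\<omega>. indicator (I i) \<omega> * f (D t \<omega>) \<partial>M) = (\<integral>\<^sup>+\<omega>. f (D t \<omega>) \<partial>?Mi)"
      by (subst nn_integral_density) auto
    also have "\<dots> = (\<integral>\<^sup>+p. f (snd (snd p)) \<partial>(?Y \<Otimes>\<^sub>M kern i))"
      unfolding eq by (subst nn_integral_distr) auto
    also have "\<dots> = (\<integral>\<^sup>+x. \<integral>\<^sup>+z. f (snd z) \<partial>kern i \<partial>?Y)"
      by (subst K.nn_integral_fst[symmetric]) auto
    also have "\<dots> = (\<integral>\<^sup>+z. f (snd z) \<partial>kern i) * emeasure ?Mi (space M)"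
      by (simp add: emeasure_distr)
    also have "emeasure ?Mi (space M) = emeasure M (I i)"
      using emeasure_restricted[OF I, of "space M" i] sets.sets_into_space[OF I[of i]]
      by (simp add: Int_absorb2)
    finally show "(\<integral>\<^sup>+\<omega>. indicator (I i) \<omega> * f (D t \<omega>) \<partial>M) = emeasure M (I i) * (\<integral>\<^sup>+z. f (snd z) \<partial>kern i)"
      by (simp add: mult.commute)
  qed
  finally show ?thesis unfolding I_def .
qed

lemma integrable_demand:
  assumes t: "1 \<le> t" shows "integrable M (D t)"
proof (rule integrableI_bounded)
  show "D t \<in> borel_measurable M" by (rule D_measurable[OF t])
  have fin: "(\<integral>\<^sup>+z. ennreal (norm (snd z)) \<partial>kern i) < \<infinity>" for i
    using integrable_kern_snd[of i] by (simp add: integrable_iff_bounded)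
  have "(\<integral>\<^sup>+\<omega>. ennreal (norm (D t \<omega>)) \<partial>M)
     = (\<Sum>i\<in>UNIV. emeasure M {\<omega> \<in> space M. W t \<omega> = i} * (\<integral>\<^sup>+z. ennreal (norm (snd z)) \<partial>kern i))"
    by (rule nn_integral_demand[OF t]) measurable
  also have "\<dots> < \<infinity>"
    using fin by (auto simp: ennreal_mult_less_top emeasure_eq_measure)
  finally show "(\<integral>\<^sup>+\<omega>. ennreal (norm (D t \<omega>)) \<partial>M) < \<infinity>" .
qed

lemma AE_demand_nonneg:
  assumes t: "1 \<le> t" shows "AE \<omega> in M. 0 \<le> D t \<omega>"
proof -
  have [measurable]: "D t \<in> borel_measurable M" by (rule D_measurable[OF t])
  have z: "(\<integral>\<^sup>+z. indicator {..<0} (snd z) \<partial>kern i) = (0::ennreal)" for i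
  proof -
    have "AE z in kern i. indicator {..<0} (snd z) = (0::ennreal)"
      using AE_kern[of i] by eventually_elim (auto simp: indicator_def)
    then show ?thesis by (subst nn_integral_0_iff_AE) auto
  qed
  have "(\<integral>\<^sup>+\<omega>. indicator {..<0} (D t \<omega>) \<partial>M) = (0::ennreal)"
    by (subst nn_integral_demand[OF t]) (auto simp: z)
  then have "AE \<omega> in M. indicator {..<0} (D t \<omega>) = (0::ennreal)"
    by (subst (asm) nn_integral_0_iff_AE) auto
  then show ?thesis by eventually_elim (auto simp: indicator_def split: if_splits)
qed

lemma AE_inv_lvl_le:
  assumes "B \<le> K" and \<theta>: "\<And>s i. s \<in> {1..T} \<Longrightarrow> \<theta> (s, i) \<le> K" and t: "1 \<le> t" "t \<le> Suc T"
  shows "AE \<omega> in M. inv_lvl \<theta> t \<omega> \<le> K"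
  using t
proof (induction t rule: dec_induct)
  case base
  show ?case using X1_le by eventually_elim (use \<open>B \<le> K\<close> in simp)
next
  case (step t)
  then have "AE \<omega> in M. inv_lvl \<theta> t \<omega> \<le> K" by simp
  then show ?case using AE_demand_nonneg[OF step(1)]
  proof eventually_elim
    case (elim \<omega>)
    moreover have "\<theta> (t, W t \<omega>) \<le> K" using \<theta>[of t] step by simp
    ultimately show ?case unfolding inv_lvl_Suc[OF step(1)] by linarith
  qed
qed

text \<open>Two-sided bounds on arbitrary levels rather than membership in the box: a partial
  derivative moves one level out of \<open>{0..B}\<close>, and the objective must stay integrable
  there.\<close>

definition bounded_levels :: "nat \<Rightarrow> real \<Rightarrow> (nat \<times> 'b \<Rightarrow> real) \<Rightarrow> bool" where
  "bounded_levels T K \<theta> \<longleftrightarrow> B \<le> K \<and> (\<forall>t\<in>{1..T}. \<forall>i. \<bar>\<theta> (t, i)\<bar> \<le> K)"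

text \<open>The inventory before ordering is unbounded below because of backlogs, but the order
  raises it at least to a level.\<close>

lemma AE_max_level_bounded:
  assumes "bounded_levels T K \<theta>" "bounded_levels T K \<eta>" and t: "t \<in> {1..T}"
  shows "AE \<omega> in M. \<bar>max (inv_lvl \<eta> t \<omega>) (\<theta> (t, W t \<omega>))\<bar> \<le> K"
proof -
  have "AE \<omega> in M. inv_lvl \<eta> t \<omega> \<le> K"
    by (rule AE_inv_lvl_le[of K T]) (use assms in \<open>auto simp: bounded_levels_def abs_le_iff\<close>)
  then show ?thesis
  proof eventually_elim
    case (elim \<omega>)
    moreover have "\<bar>\<theta> (t, W t \<omega>)\<bar> \<le> K" using assms by (auto simp: bounded_levels_def)
    ultimately show ?case by linarith
  qed
qed

lemma measurable_q_comp:
  assumes "1 \<le> t" "Y \<in> borel_measurable M"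
  shows "(\<lambda>\<omega>. q \<theta> n t (Y \<omega>) (W t \<omega>)) \<in> borel_measurable M"
  by (rule measurable_kern_shift[where g = "\<lambda>j x. q \<theta> n t x j", OF measurable_q assms(2) W_measurable[OF assms(1)]])

lemma integrable_q_comp:
  assumes t: "1 \<le> t" and Y: "Y \<in> borel_measurable M" and bd: "AE \<omega> in M. \<bar>Y \<omega>\<bar> \<le> K"
  shows "integrable M (\<lambda>\<omega>. q \<theta> n t (Y \<omega>) (W t \<omega>))"
proof (rule integrable_const_bound)
  show "AE \<omega> in M. norm (q \<theta> n t (Y \<omega>) (W t \<omega>)) \<le> (\<Sum>i\<in>UNIV. \<bar>q \<theta> n t 0 i\<bar>) + real n * H * K"
    using bd
  proof eventually_elim
    case (elim \<omega>)
    have "\<bar>q \<theta> n t (Y \<omega>) (W t \<omega>) - q \<theta> n t 0 (W t \<omega>)\<bar> \<le> real n * H * \<bar>Y \<omega>\<bar>"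
      using q_lipschitz[of \<theta> n t "Y \<omega>" "W t \<omega>" 0] by simp
    also have "\<dots> \<le> real n * H * K" using elim H_nonneg by (intro mult_left_mono) auto
    finally have "\<bar>q \<theta> n t (Y \<omega>) (W t \<omega>) - q \<theta> n t 0 (W t \<omega>)\<bar> \<le> real n * H * K" .
    moreover have "\<bar>q \<theta> n t 0 (W t \<omega>)\<bar> \<le> (\<Sum>i\<in>UNIV. \<bar>q \<theta> n t 0 i\<bar>)"
      using member_le_sum[of "W t \<omega>" UNIV "\<lambda>i. \<bar>q \<theta> n t 0 i\<bar>"] by simp
    ultimately show ?case by simp
  qed
qed (rule measurable_q_comp[OF t Y])

text \<open>The next inventory is the stock after ordering minus the demand, so
  \<open>cost t\<close> evaluated there is the realised cost of period t.\<close>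

definition stage_cost :: "(nat \<times> 'b \<Rightarrow> real) \<Rightarrow> nat \<Rightarrow> real" where
  "stage_cost \<theta> t = (\<integral>\<omega>. cost t (inv_lvl \<theta> (Suc t) \<omega>) \<partial>M)"

text \<open>The Bellman recursion with two policies: the cost-to-go is that of \<theta>, while the
  inventory has moved under \<eta>. The Markov property applies because \<open>q\<close> is the
  kernel integral of next inventory cost plus next cost-to-go.\<close>

lemma value_step:
  assumes K: "bounded_levels T K \<eta>" and t: "t \<in> {1..T}"
  shows "integrable M (\<lambda>\<omega>. q \<theta> (Suc n) t (post \<eta> t \<omega>) (W t \<omega>))"
    and "integrable M (\<lambda>\<omega>. q \<theta> n (Suc t) (max (inv_lvl \<eta> (Suc t) \<omega>) (\<theta> (Suc t, W (Suc t) \<omega>))) (W (Suc t) \<omega>))"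
    and "(\<integral>\<omega>. q \<theta> (Suc n) t (post \<eta> t \<omega>) (W t \<omega>) \<partial>M) = stage_cost \<eta> t +
      (\<integral>\<omega>. q \<theta> n (Suc t) (max (inv_lvl \<eta> (Suc t) \<omega>) (\<theta> (Suc t, W (Suc t) \<omega>))) (W (Suc t) \<omega>) \<partial>M)"
proof -
  have t1: "1 \<le> t" using t by simp
  have [measurable]: "D t \<in> borel_measurable M" "post \<eta> t \<in> borel_measurable M"
      "inv_lvl \<eta> (Suc t) \<in> borel_measurable M"
    using measurable_post[OF t1] D_measurable[OF t1] measurable_inv_lvl[of "Suc t"] by auto
  have bd: "AE \<omega> in M. \<bar>post \<eta> t \<omega>\<bar> \<le> K" by (rule AE_max_level_bounded[OF K K t])
  have ip: "integrable M (post \<eta> t)" by (rule integrable_const_bound[of _ K]) (use bd in auto)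
  have iD: "integrable M (D t)" by (rule integrable_demand[OF t1])
  have inv: "inv_lvl \<eta> (Suc t) \<omega> = post \<eta> t \<omega> - D t \<omega>" for \<omega> by (rule inv_lvl_Suc[OF t1])
  have ii: "integrable M (inv_lvl \<eta> (Suc t))"
    unfolding inv[abs_def] using ip iD by (rule Bochner_Integration.integrable_diff)
  let ?g = "\<lambda>j x. cost t x + q \<theta> n (Suc t) (max x (\<theta> (Suc t, j))) j"
  have g_lip: "\<bar>?g j x - ?g j x'\<bar> \<le> real (Suc n) * H * \<bar>x - x'\<bar>" for j x x'
    by (rule q_integrand_lipschitz)
  have g_meas: "?g j \<in> borel_measurable borel" for j
    by (rule measurable_of_lipschitz[OF g_lip])
  have lin: "integrable M (\<lambda>\<omega>. g (W (Suc t) \<omega>) (inv_lvl \<eta> (Suc t) \<omega>))"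
    if lip: "\<And>j x x'. \<bar>g j x - g j x'\<bar> \<le> L * \<bar>x - x'\<bar>" for g :: "'b \<Rightarrow> real \<Rightarrow> real" and L
  proof (rule Bochner_Integration.integrable_bound)
    show "integrable M (\<lambda>\<omega>. (\<Sum>j\<in>UNIV. \<bar>g j 0\<bar>) + L * \<bar>inv_lvl \<eta> (Suc t) \<omega>\<bar>)"
      using ii by auto
    show "(\<lambda>\<omega>. g (W (Suc t) \<omega>) (inv_lvl \<eta> (Suc t) \<omega>)) \<in> borel_measurable M"
      by (rule measurable_kern_shift[OF measurable_of_lipschitz[OF lip]]) measurable
    show "AE \<omega> in M. norm (g (W (Suc t) \<omega>) (inv_lvl \<eta> (Suc t) \<omega>)) \<le> norm ((\<Sum>j\<in>UNIV. \<bar>g j 0\<bar>) + L * \<bar>inv_lvl \<eta> (Suc t) \<omega>\<bar>)"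
    proof (rule AE_I2)
      fix \<omega>
      have "\<bar>g (W (Suc t) \<omega>) (inv_lvl \<eta> (Suc t) \<omega>) - g (W (Suc t) \<omega>) 0\<bar> \<le> L * \<bar>inv_lvl \<eta> (Suc t) \<omega>\<bar>"
        using lip[of "W (Suc t) \<omega>" "inv_lvl \<eta> (Suc t) \<omega>" 0] by simp
      moreover have "\<bar>g (W (Suc t) \<omega>) 0\<bar> \<le> (\<Sum>j\<in>UNIV. \<bar>g j 0\<bar>)"
        using member_le_sum[of "W (Suc t) \<omega>" UNIV "\<lambda>j. \<bar>g j 0\<bar>"] by simp
      ultimately show "norm (g (W (Suc t) \<omega>) (inv_lvl \<eta> (Suc t) \<omega>)) \<le> norm ((\<Sum>j\<in>UNIV. \<bar>g j 0\<bar>) + L * \<bar>inv_lvl \<eta> (Suc t) \<omega>\<bar>)"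
        by simp
    qed
  qed
  have i1: "integrable M (\<lambda>\<omega>. ?g (W (Suc t) \<omega>) (inv_lvl \<eta> (Suc t) \<omega>))"
    by (rule lin[OF g_lip])
  have i2: "integrable M (\<lambda>\<omega>. cost t (inv_lvl \<eta> (Suc t) \<omega>))"
    by (rule lin[of "\<lambda>_. cost t", OF cost_lipschitz])
  show i3: "integrable M (\<lambda>\<omega>. q \<theta> n (Suc t) (max (inv_lvl \<eta> (Suc t) \<omega>) (\<theta> (Suc t, W (Suc t) \<omega>))) (W (Suc t) \<omega>))"
    using Bochner_Integration.integrable_diff[OF i1 i2] by simp
  define F where "F i x z = ?g (fst z) (max x (\<eta> (t, i)) - snd z)" for i :: 'b and x :: real and z :: "'b \<times> real"
  have F: "(\<lambda>(x, z). F i x z) \<in> borel_measurable (borel \<Otimes>\<^sub>M (count_space UNIV \<Otimes>\<^sub>M borel))" for i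
    unfolding F_def split_beta
    by (rule measurable_kern_shift[where g = ?g, OF g_meas]) measurable
  have F1: "F (W t \<omega>) (inv_lvl \<eta> t \<omega>) (W (Suc t) \<omega>, D t \<omega>) = ?g (W (Suc t) \<omega>) (inv_lvl \<eta> (Suc t) \<omega>)" for \<omega>
    unfolding F_def inv by simp
  have F2: "(\<integral>z. F (W t \<omega>) (inv_lvl \<eta> t \<omega>) z \<partial>kern (W t \<omega>)) = q \<theta> (Suc n) t (post \<eta> t \<omega>) (W t \<omega>)" for \<omega>
    unfolding F_def by (simp add: q.simps(2))
  note ms = markov_step[OF t1, of F \<eta>, OF F, unfolded F1 F2, OF i1]
  show "integrable M (\<lambda>\<omega>. q \<theta> (Suc n) t (post \<eta> t \<omega>) (W t \<omega>))" by (rule ms(1))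
  have "(\<integral>\<omega>. q \<theta> (Suc n) t (post \<eta> t \<omega>) (W t \<omega>) \<partial>M) = (\<integral>\<omega>. ?g (W (Suc t) \<omega>) (inv_lvl \<eta> (Suc t) \<omega>) \<partial>M)"
    by (rule ms(2)[symmetric])
  also have "\<dots> = stage_cost \<eta> t +
      (\<integral>\<omega>. q \<theta> n (Suc t) (max (inv_lvl \<eta> (Suc t) \<omega>) (\<theta> (Suc t, W (Suc t) \<omega>))) (W (Suc t) \<omega>) \<partial>M)"
    unfolding stage_cost_def by (rule Bochner_Integration.integral_add[OF i2 i3])
  finally show "(\<integral>\<omega>. q \<theta> (Suc n) t (post \<eta> t \<omega>) (W t \<omega>) \<partial>M) = stage_cost \<eta> t +
      (\<integral>\<omega>. q \<theta> n (Suc t) (max (inv_lvl \<eta> (Suc t) \<omega>) (\<theta> (Suc t, W (Suc t) \<omega>))) (W (Suc t) \<omega>) \<partial>M)" .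
qed

abbreviation obj :: "nat \<Rightarrow> (nat \<times> 'b \<Rightarrow> real) \<Rightarrow> real" where
  "obj T \<equiv> objective M X1 W D PD h b T"

lemma kern_integral_snd:
  assumes [measurable]: "f \<in> borel_measurable borel"
  shows "(\<integral>z. f (snd z) \<partial>kern i) = (\<integral>d. f d \<partial>PD i :: real)"
proof -
  have "distr (kern i) (PD i) snd = PD i"
  proof (rule measure_eqI)
    fix A assume "A \<in> sets (distr (kern i) (PD i) snd)"
    then have A: "A \<in> sets borel" by simp
    interpret PDi: prob_space "PD i" by (rule prob_space_PD)
    interpret K: prob_space "kern i" by (rule prob_space_kern)
    have "emeasure (distr (kern i) (PD i) snd) A = emeasure (kern i) (snd -` A \<inter> space (kern i))"
      by (rule emeasure_distr) (use A in auto)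
    also have "\<dots> = emeasure (PD i) A"
      using measure_kern_snd[OF A, of i]
      by (simp add: vimage_def K.emeasure_eq_measure PDi.emeasure_eq_measure)
    finally show "emeasure (distr (kern i) (PD i) snd) A = emeasure (PD i) A" .
  qed simp
  then have "(\<integral>d. f d \<partial>PD i) = (\<integral>d. f d \<partial>distr (kern i) (PD i) snd)" by simp
  also have "\<dots> = (\<integral>z. f (snd z) \<partial>kern i)" by (rule integral_distr) auto
  finally show ?thesis by simp
qed

text \<open>With one period left no later level is consulted, so \<theta> is arbitrary.\<close>

lemma period_cost_eq: "period_cost PD h b t y i = q \<theta> (Suc 0) t y i"
proof -
  have [measurable]: "(\<lambda>d. cost t (y - d)) \<in> borel_measurable borel" by measurable
  show ?thesis
    using kern_integral_snd[of "\<lambda>d. cost t (y - d)" i] by (simp add: period_cost_def cost_def q.simps(2))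
qed

lemma obj_eq_sum:
  assumes K: "bounded_levels T K \<theta>"
  shows "obj T \<theta> = (\<Sum>t\<in>{1..T}. stage_cost \<theta> t)"
proof -
  have *: "realized_cost X1 W D PD h b T (base_stock \<theta>) \<omega> = (\<Sum>t\<in>{1..T}. q \<theta> (Suc 0) t (post \<theta> t \<omega>) (W t \<omega>))" for \<omega>
    unfolding realized_cost_def period_cost_eq[of _ _ _ \<theta>] by (simp add: base_stock_def)
  show ?thesis
    unfolding objective_def *
    using value_step(1)[OF K, of _ \<theta> 0] value_step(3)[OF K, of _ \<theta> 0]
    by (subst Bochner_Integration.integral_sum) auto
qed

text \<open>The loss from ordering by \<theta> instead of \<eta> in period t alone, starting at the
  inventory reached under \<eta> and continuing with \<theta>.\<close>

definition gap_term :: "(nat \<times> 'b \<Rightarrow> real) \<Rightarrow> (nat \<times> 'b \<Rightarrow> real) \<Rightarrow> nat \<Rightarrow> nat \<Rightarrow> real" where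
  "gap_term \<theta> \<eta> n t = (\<integral>\<omega>. q \<theta> n t (max (inv_lvl \<eta> t \<omega>) (\<theta> (t, W t \<omega>))) (W t \<omega>)
      - q \<theta> n t (post \<eta> t \<omega>) (W t \<omega>) \<partial>M)"

lemma integrable_q_max:
  assumes "bounded_levels T K \<theta>'" "bounded_levels T K \<eta>" "t \<in> {1..T}"
  shows "integrable M (\<lambda>\<omega>. q \<theta> n t (max (inv_lvl \<eta> t \<omega>) (\<theta>' (t, W t \<omega>))) (W t \<omega>))"
  using assms AE_max_level_bounded[OF assms]
  by (intro integrable_q_comp borel_measurable_max measurable_inv_lvl measurable_level) auto

text \<open>In each period the order of \<theta> is exchanged for that of \<eta>, at the price of
  one gap term; \<open>value_step\<close> then advances to the next period along \<eta>.\<close>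

lemma telescope:
  assumes K: "bounded_levels T K \<theta>" "bounded_levels T K \<eta>" and "1 \<le> t" "t + n = Suc T"
  shows "(\<integral>\<omega>. q \<theta> n t (max (inv_lvl \<eta> t \<omega>) (\<theta> (t, W t \<omega>))) (W t \<omega>) \<partial>M)
    = (\<Sum>s\<in>{t..<t+n}. stage_cost \<eta> s) + (\<Sum>s\<in>{t..<t+n}. gap_term \<theta> \<eta> (Suc T - s) s)"
  using assms(3,4)
proof (induction n arbitrary: t)
  case (Suc n)
  then have t: "t \<in> {1..T}" by simp
  have split: "(\<Sum>s\<in>{t..<t+Suc n}. f s) = f t + (\<Sum>s\<in>{Suc t..<Suc t+n}. f s)" for f :: "nat \<Rightarrow> real"
    by (simp add: sum.atLeast_Suc_lessThan)
  have "(\<integral>\<omega>. q \<theta> (Suc n) t (max (inv_lvl \<eta> t \<omega>) (\<theta> (t, W t \<omega>))) (W t \<omega>) \<partial>M)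
     = gap_term \<theta> \<eta> (Suc n) t + (\<integral>\<omega>. q \<theta> (Suc n) t (post \<eta> t \<omega>) (W t \<omega>) \<partial>M)"
    unfolding gap_term_def using integrable_q_max[OF K t] integrable_q_max[OF K(2) K(2) t]
    by (subst Bochner_Integration.integral_diff) auto
  moreover have "(\<integral>\<omega>. q \<theta> (Suc n) t (post \<eta> t \<omega>) (W t \<omega>) \<partial>M) = stage_cost \<eta> t +
    ((\<Sum>s\<in>{Suc t..<Suc t+n}. stage_cost \<eta> s) + (\<Sum>s\<in>{Suc t..<Suc t+n}. gap_term \<theta> \<eta> (Suc T - s) s))"
    unfolding value_step(3)[OF K(2) t] using Suc.IH[of "Suc t"] Suc.prems by simp
  moreover have "Suc T - t = Suc n" using Suc.prems by simp
  ultimately show ?case unfolding split by simp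
qed simp

text \<open>In period 1 the inventory is \<open>X1\<close> under both policies, so the telescopes
  along \<theta> and along \<eta> start from the same value, and along \<theta> all gap terms
  vanish.\<close>

lemma performance_difference:
  assumes K: "bounded_levels T K \<theta>" "bounded_levels T K \<eta>"
  shows "obj T \<theta> - obj T \<eta> = (\<Sum>s\<in>{1..T}. gap_term \<theta> \<eta> (Suc T - s) s)"
proof -
  have *: "{1..<1+T} = {1..T}" by auto
  have "gap_term \<theta> \<theta> n s = 0" for n s by (simp add: gap_term_def)
  then show ?thesis
    using telescope[OF K, of 1 T] telescope[OF K(1,1), of 1 T] obj_eq_sum[OF K(1)] obj_eq_sum[OF K(2)]
    unfolding * by simp
qed

end

text \<open>Integrating the slope bound shows that a move of width \<open>w\<close> gains at most
  \<open>(G + d) * w - m / 2 * w^2\<close>, and the maximum of this quadratic is the right-hand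
  side. A sign condition at \<open>c\<close> is assumed only if the box leaves room to move in that
  direction.\<close>

lemma threshold_gap_bound:
  fixes f f' :: "real \<Rightarrow> real"
  assumes deriv: "\<And>z. (f has_real_derivative f' z) (at z)"
    and mono: "\<And>x y. 0 \<le> x \<Longrightarrow> x < y \<Longrightarrow> y \<le> B \<Longrightarrow> m * (y - x) - d \<le> f' y - f' x"
    and m: "0 < m" and d: "0 \<le> d"
    and c: "0 \<le> c" "c \<le> B" and e: "0 \<le> e" "e \<le> B" and x: "x \<le> B"
    and lower: "c < B \<Longrightarrow> - G \<le> f' c" and upper: "0 < c \<Longrightarrow> f' c \<le> G"
  shows "f (max x c) - f (max x e) \<le> (G + d)\<^sup>2 / (2 * m)"
proof -
  have amgm: "(G + d) * w - m / 2 * w\<^sup>2 \<le> (G + d)\<^sup>2 / (2 * m)" for w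
  proof -
    have "0 \<le> (G + d - m * w)\<^sup>2 / (2 * m)" using m by simp
    also have "\<dots> = (G + d)\<^sup>2 / (2 * m) - ((G + d) * w - m / 2 * w\<^sup>2)"
      using m by (simp add: power2_eq_square field_simps)
    finally show ?thesis by simp
  qed
  let ?a = "max x c" and ?b = "max x e"
  consider "?a = ?b" | "?a < ?b" | "?b < ?a" by linarith
  then show ?thesis
  proof cases
    case 1
    then show ?thesis using m by simp
  next
    case 2
    then have ab: "c \<le> ?a" "?b = e" "c < B" using c e by linarith+
    \<comment> \<open>Monotonicity of this function is the integrated form of the slope bound
      \<open>m * (z - c) - d - G\<close> on \<open>f'\<close>.\<close>
    let ?\<phi> = "\<lambda>z. f z + (G + d) * z - m / 2 * (z - c)\<^sup>2"
    have "?\<phi> ?a \<le> ?\<phi> ?b"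
    proof (rule DERIV_nonneg_imp_nondecreasing[where f = ?\<phi>])
      show "?a \<le> ?b" using 2 by simp
      fix z assume z: "?a \<le> z" "z \<le> ?b"
      have "m * (z - c) - d - G \<le> f' z"
      proof (cases "z = c")
        case True then show ?thesis using lower ab d by simp
      next
        case False
        then have "m * (z - c) - d \<le> f' z - f' c" using z ab c e by (intro mono) auto
        then show ?thesis using lower ab by linarith
      qed
      moreover have "(?\<phi> has_real_derivative f' z + (G + d) - m * (z - c)) (at z)"
        by (auto intro!: derivative_eq_intros deriv simp: field_simps)
      ultimately show "\<exists>y. (?\<phi> has_real_derivative y) (at z) \<and> 0 \<le> y"
        by (intro exI[of _ "f' z + (G + d) - m * (z - c)"]) auto
    qed
    then have "f ?a - f ?b \<le> (G + d) * (?b - ?a) - m / 2 * ((?b - c)\<^sup>2 - (?a - c)\<^sup>2)"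
      by (simp add: algebra_simps)
    \<comment> \<open>The move may start above \<open>c\<close>, at the current inventory. The
      curvature collected from there on is still at least that of a move of the same width starting
      at \<open>c\<close>.\<close>
    also have "\<dots> \<le> (G + d) * (?b - ?a) - m / 2 * (?b - ?a)\<^sup>2"
    proof -
      have "0 \<le> 2 * ((?a - c) * (?b - ?a))" using 2 ab by (intro mult_nonneg_nonneg) auto
      then have "(?b - ?a)\<^sup>2 \<le> (?b - c)\<^sup>2 - (?a - c)\<^sup>2"
        by (simp add: power2_eq_square algebra_simps)
      then show ?thesis using m by (intro diff_left_mono mult_left_mono) auto
    qed
    also have "\<dots> \<le> (G + d)\<^sup>2 / (2 * m)" by (rule amgm)
    finally show ?thesis .
  next
    case 3
    \<comment> \<open>Moving down is possible only if the level \<open>c\<close> is active, so the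
      start is \<open>c\<close> itself and the upper residual applies.\<close>
    then have ab: "?a = c" "0 \<le> ?b" "0 < c" using c e by linarith+
    let ?\<psi> = "\<lambda>z. f z - (G + d) * z - m / 2 * (c - z)\<^sup>2"
    have "?\<psi> ?a \<le> ?\<psi> ?b"
    proof (rule DERIV_nonpos_imp_nonincreasing[where f = ?\<psi>])
      show "?b \<le> ?a" using 3 by simp
      fix z assume z: "?b \<le> z" "z \<le> ?a"
      have "f' z \<le> G + d - m * (c - z)"
      proof (cases "z = c")
        case True then show ?thesis using upper ab d by simp
      next
        case False
        then have "m * (c - z) - d \<le> f' c - f' z" using z ab c e by (intro mono) auto
        then show ?thesis using upper ab by linarith
      qed
      moreover have "(?\<psi> has_real_derivative f' z - (G + d) + m * (c - z)) (at z)"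
        by (auto intro!: derivative_eq_intros deriv simp: field_simps)
      ultimately show "\<exists>y. (?\<psi> has_real_derivative y) (at z) \<and> y \<le> 0"
        by (intro exI[of _ "f' z - (G + d) + m * (c - z)"]) auto
    qed
    then have "f ?a - f ?b \<le> (G + d) * (?a - ?b) - m / 2 * (?a - ?b)\<^sup>2"
      using ab(1) by (simp add: algebra_simps)
    also have "\<dots> \<le> (G + d)\<^sup>2 / (2 * m)" by (rule amgm)
    finally show ?thesis .
  qed
qed

context base_stock_model begin

section \<open>Anti-concentration of the inventory and reach probabilities\<close>

definition LX :: real where "LX = max L\<rho> LD"

lemma LX_ge: "LD \<le> LX" "L\<rho> \<le> LX" "0 \<le> LX"
  using LD_nonneg by (auto simp: LX_def)

lemma sets_step:
  assumes "Measurable.pred (borel \<Otimes>\<^sub>M (count_space UNIV \<Otimes>\<^sub>M borel)) (\<lambda>p. Q (fst p) (snd p))"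
  shows "{(x :: real, z :: 'b \<times> real). Q x z} \<in> sets (borel \<Otimes>\<^sub>M (count_space UNIV \<Otimes>\<^sub>M borel))"
  using assms by (simp add: pred_def space_pair_measure split_beta')

lemma prob_step:
  assumes t: "1 \<le> t" and Q: "\<And>i. {(x, z). Q i x z} \<in> sets (borel \<Otimes>\<^sub>M (count_space UNIV \<Otimes>\<^sub>M borel))"
  shows "integrable M (\<lambda>\<omega>. measure (kern (W t \<omega>)) {z. Q (W t \<omega>) (inv_lvl \<theta> t \<omega>) z})"
    and "prob {\<omega> \<in> space M. Q (W t \<omega>) (inv_lvl \<theta> t \<omega>) (W (Suc t) \<omega>, D t \<omega>)}
     = (\<integral>\<omega>. measure (kern (W t \<omega>)) {z. Q (W t \<omega>) (inv_lvl \<theta> t \<omega>) z} \<partial>M)"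
proof -
  let ?N = "borel \<Otimes>\<^sub>M (count_space UNIV \<Otimes>\<^sub>M borel) :: (real \<times> 'b \<times> real) measure"
  define F :: "'b \<Rightarrow> real \<Rightarrow> 'b \<times> real \<Rightarrow> real" where "F i x z = indicator {(x, z). Q i x z} (x, z)" for i x z
  have F: "(\<lambda>(x, z). F i x z) \<in> borel_measurable ?N" for i
    using borel_measurable_indicator[OF Q[of i], where 'b = real] by (simp add: F_def split_beta')
  have [measurable]: "W t \<in> measurable M (count_space UNIV)" "D t \<in> borel_measurable M"
      "inv_lvl \<theta> t \<in> borel_measurable M"
    using W_measurable[of t] D_measurable[of t] measurable_inv_lvl[of t] t by auto
  have FM: "(\<lambda>\<omega>. F (W t \<omega>) (inv_lvl \<theta> t \<omega>) (W (Suc t) \<omega>, D t \<omega>)) \<in> borel_measurable M"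
  proof (rule measurable_compose_countable[where f = "\<lambda>i \<omega>. F i (inv_lvl \<theta> t \<omega>) (W (Suc t) \<omega>, D t \<omega>)" and g = "W t"])
    fix i
    have "(\<lambda>\<omega>. (inv_lvl \<theta> t \<omega>, W (Suc t) \<omega>, D t \<omega>)) \<in> measurable M ?N" by measurable
    from measurable_compose[OF this F[of i]]
    show "(\<lambda>\<omega>. F i (inv_lvl \<theta> t \<omega>) (W (Suc t) \<omega>, D t \<omega>)) \<in> borel_measurable M" by simp
  qed measurable
  have int: "integrable M (\<lambda>\<omega>. F (W t \<omega>) (inv_lvl \<theta> t \<omega>) (W (Suc t) \<omega>, D t \<omega>))"
    by (rule integrable_const_bound[of _ 1]) (use FM in \<open>auto simp: F_def indicator_def\<close>)
  note ms = markov_step[OF t, of F \<theta>, OF F int]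
  have inner: "(\<integral>z. F i x z \<partial>kern i) = measure (kern i) {z. Q i x z}" for i x
  proof -
    have "{z. Q i x z} = Pair x -` {(x, z). Q i x z}" by auto
    then have S: "{z. Q i x z} \<in> sets (kern i)" using sets_Pair1[OF Q[of i], of x] by simp
    have "(\<integral>z. F i x z \<partial>kern i) = (\<integral>z. indicator {z. Q i x z} z \<partial>kern i)"
      by (intro Bochner_Integration.integral_cong) (auto simp: F_def indicator_def)
    then show ?thesis using S by simp
  qed
  show "integrable M (\<lambda>\<omega>. measure (kern (W t \<omega>)) {z. Q (W t \<omega>) (inv_lvl \<theta> t \<omega>) z})"
    using ms(1) unfolding inner .
  have "(\<integral>\<omega>. F (W t \<omega>) (inv_lvl \<theta> t \<omega>) (W (Suc t) \<omega>, D t \<omega>) \<partial>M)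
      = (\<integral>\<omega>. indicator {\<omega> \<in> space M. Q (W t \<omega>) (inv_lvl \<theta> t \<omega>) (W (Suc t) \<omega>, D t \<omega>)} \<omega> \<partial>M)"
    by (intro Bochner_Integration.integral_cong) (auto simp: F_def indicator_def)
  also have "\<dots> = prob {\<omega> \<in> space M. Q (W t \<omega>) (inv_lvl \<theta> t \<omega>) (W (Suc t) \<omega>, D t \<omega>)}"
  proof -
    have "{\<omega> \<in> space M. F (W t \<omega>) (inv_lvl \<theta> t \<omega>) (W (Suc t) \<omega>, D t \<omega>) = 1} \<in> sets M"
      using FM by measurable
    also have "{\<omega> \<in> space M. F (W t \<omega>) (inv_lvl \<theta> t \<omega>) (W (Suc t) \<omega>, D t \<omega>) = 1}
       = {\<omega> \<in> space M. Q (W t \<omega>) (inv_lvl \<theta> t \<omega>) (W (Suc t) \<omega>, D t \<omega>)}"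
      by (auto simp: F_def indicator_def)
    finally show ?thesis by simp
  qed
  finally show "prob {\<omega> \<in> space M. Q (W t \<omega>) (inv_lvl \<theta> t \<omega>) (W (Suc t) \<omega>, D t \<omega>)}
     = (\<integral>\<omega>. measure (kern (W t \<omega>)) {z. Q (W t \<omega>) (inv_lvl \<theta> t \<omega>) z} \<partial>M)"
    using ms(2) unfolding inner by simp
qed

lemma sets_inv_near: "1 \<le> t \<Longrightarrow> {\<omega> \<in> space M. \<bar>inv_lvl \<theta> t \<omega> - c\<bar> \<le> r} \<in> sets M"
proof -
  assume "1 \<le> t"
  then have [measurable]: "inv_lvl \<theta> t \<in> borel_measurable M" by (rule measurable_inv_lvl)
  show ?thesis by measurable
qed

text \<open>Initially this is the Lipschitz bound on \<rho>. Later the last demand is subtracted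
  from a stock fixed by the past and the current state, so the demand bound applies conditionally,
  with a constant that does not grow with t.\<close>

lemma inv_lvl_anti_concentrated:
  assumes t: "1 \<le> t" and r: "0 \<le> r"
  shows "prob {\<omega> \<in> space M. \<bar>inv_lvl \<theta> t \<omega> - c\<bar> \<le> r} \<le> 2 * LX * r"
proof (cases "t = 1")
  case True
  interpret X: real_distribution "distr M borel X1"
    by (rule real_distribution_distr) measurable
  have "prob {\<omega> \<in> space M. \<bar>inv_lvl \<theta> t \<omega> - c\<bar> \<le> r} = measure (distr M borel X1) {c - r..c + r}"
    using True by (subst measure_distr) (auto intro!: arg_cong[of _ _ prob])
  also have "\<dots> \<le> L\<rho> * ((c + r) - (c - r))"
    by (rule lipschitz_cdf_interval[OF X.real_distribution_axioms]) (use \<rho>_lipschitz X1_cdf r in auto)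
  also have "\<dots> = L\<rho> * (2 * r)" by simp
  also have "\<dots> \<le> LX * (2 * r)" using LX_ge r by (intro mult_right_mono) auto
  finally show ?thesis by (simp add: mult_ac)
next
  case False
  then obtain s where s: "t = Suc s" "1 \<le> s" using t by (cases t) auto
  let ?Q = "\<lambda>i x z. \<bar>max x (\<theta> (s, i)) - snd z - c\<bar> \<le> r"
  have Q: "{(x, z :: 'b \<times> real). ?Q i x z} \<in> sets (borel \<Otimes>\<^sub>M (count_space UNIV \<Otimes>\<^sub>M borel))" for i
    by (rule sets_step) measurable
  have "prob {\<omega> \<in> space M. \<bar>inv_lvl \<theta> t \<omega> - c\<bar> \<le> r}
     = (\<integral>\<omega>. measure (kern (W s \<omega>)) {z. ?Q (W s \<omega>) (inv_lvl \<theta> s \<omega>) z} \<partial>M)"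
    using prob_step(2)[OF s(2), of ?Q \<theta>, OF Q] unfolding s(1) inv_lvl_Suc[OF s(2)] by simp
  also have "\<dots> \<le> (\<integral>\<omega>. 2 * LD * r \<partial>M)"
  proof (rule integral_mono)
    fix \<omega>
    have "{z :: 'b \<times> real. ?Q (W s \<omega>) (inv_lvl \<theta> s \<omega>) z}
        = {z. \<bar>snd z - (post \<theta> s \<omega> - c)\<bar> \<le> r}" by auto
    then show "measure (kern (W s \<omega>)) {z. ?Q (W s \<omega>) (inv_lvl \<theta> s \<omega>) z} \<le> 2 * LD * r"
      using anti_kern[OF r, of "W s \<omega>" "\<lambda>_. post \<theta> s \<omega> - c"] by simp
  qed (use prob_step(1)[OF s(2), of ?Q \<theta>, OF Q] in auto)
  also have "\<dots> \<le> 2 * LX * r" using LX_ge r by (simp add: prob_space mult_right_mono)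
  finally show ?thesis .
qed

lemma AE_inv_lvl_neq:
  assumes t: "1 \<le> t" shows "AE \<omega> in M. inv_lvl \<theta> t \<omega> \<noteq> c"
proof (rule AE_I[where N = "{\<omega> \<in> space M. \<bar>inv_lvl \<theta> t \<omega> - c\<bar> \<le> 0}"])
  have "prob {\<omega> \<in> space M. \<bar>inv_lvl \<theta> t \<omega> - c\<bar> \<le> 0} \<le> 0"
    using inv_lvl_anti_concentrated[OF t, of 0 \<theta> c] by simp
  then show "emeasure M {\<omega> \<in> space M. \<bar>inv_lvl \<theta> t \<omega> - c\<bar> \<le> 0} = 0"
    by (simp only: emeasure_eq_measure ennreal_eq_0_iff)
  show "{\<omega> \<in> space M. \<bar>inv_lvl \<theta> t \<omega> - c\<bar> \<le> 0} \<in> sets M" by (rule sets_inv_near[OF t])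
qed auto

text \<open>Pathwise, with common demands: the maximum is nonexpansive and the demand cancels, so
  perturbations of the levels do not accumulate.\<close>

lemma inv_lvl_param_lipschitz:
  assumes "1 \<le> t" and \<delta>: "\<And>p. \<bar>\<theta> p - \<eta> p\<bar> \<le> \<delta>"
  shows "\<bar>inv_lvl \<theta> t \<omega> - inv_lvl \<eta> t \<omega>\<bar> \<le> \<delta>"
  using assms(1)
proof (induction t rule: dec_induct)
  case base then show ?case using \<delta>[of undefined] by simp
next
  case (step t)
  show ?case unfolding inv_lvl_Suc[OF step(1)] using step(3) \<delta>[of "(t, W t \<omega>)"] by linarith
qed

lemma W_law: "1 \<le> t \<Longrightarrow> prob {\<omega> \<in> space M. W t \<omega> = i} = pmf \<nu> i"
proof (induction t arbitrary: i rule: dec_induct)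
  case base
  have "measure (PD i) UNIV = 1" using prob_space.prob_space[OF prob_space_PD[of i]] by simp
  then show ?case using joint_law[of 1 "\<lambda>_. UNIV" "\<lambda>_. i"] by simp
next
  case (step t)
  have [measurable]: "W t \<in> measurable M (count_space UNIV)" using W_measurable[OF step(1)] .
  have Q: "{(x :: real, z :: 'b \<times> real). fst z = i} \<in> sets (borel \<Otimes>\<^sub>M (count_space UNIV \<Otimes>\<^sub>M borel))"
    by (rule sets_step) measurable
  have k: "measure (kern k) {z. fst z = i} = pmf (P k) i" for k
  proof -
    have "{z \<in> space (kern k). fst z = i} \<in> sets (kern k)" by measurable
    then have "{z :: 'b \<times> real. fst z = i} \<in> sets (count_space UNIV \<Otimes>\<^sub>M borel)" by simp
    from measure_kern[OF this, of k]
    have "measure (kern k) {z. fst z = i} = (\<Sum>j\<in>UNIV. pmf (P k) j * (if j = i then 1 else 0))"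
      using prob_space.prob_space[OF prob_space_PD[of k]] by (auto simp: vimage_def intro!: sum.cong)
    then show ?thesis by (simp add: if_distrib[of "\<lambda>x. _ * x"] cong: if_cong)
  qed
  have "prob {\<omega> \<in> space M. W (Suc t) \<omega> = i} = (\<integral>\<omega>. pmf (P (W t \<omega>)) i \<partial>M)"
    using prob_step(2)[OF step(1), of "\<lambda>_ _ z. fst z = i" "\<lambda>_. 0", OF Q] by (simp add: k)
  also have "\<dots> = (\<integral>\<omega>. (\<Sum>k\<in>UNIV. pmf (P k) i * indicator {\<omega> \<in> space M. W t \<omega> = k} \<omega>) \<partial>M)"
    by (intro Bochner_Integration.integral_cong refl) (simp add: indicator_def if_distrib[of "\<lambda>x. _ * x"] sum.If_cases eq_commute)
  also have "\<dots> = (\<Sum>k\<in>UNIV. pmf (P k) i * pmf \<nu> k)"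
    by (subst Bochner_Integration.integral_sum) (auto simp: step.IH emeasure_eq_measure)
  also have "\<dots> = pmf (bind_pmf \<nu> P) i"
    unfolding pmf_bind by (subst integral_measure_pmf_real[of UNIV]) auto
  finally show ?case by (simp add: stationary)
qed

lemma AE_W_support: "1 \<le> t \<Longrightarrow> AE \<omega> in M. W t \<omega> \<in> set_pmf \<nu>"
proof -
  assume t: "1 \<le> t"
  have [measurable]: "W t \<in> measurable M (count_space UNIV)" using W_measurable[OF t] .
  have "AE \<omega> in M. W t \<omega> \<noteq> i" if "i \<notin> set_pmf \<nu>" for i
    by (rule AE_I[where N = "{\<omega> \<in> space M. W t \<omega> = i}"])
      (use W_law[OF t, of i] that in \<open>auto simp: emeasure_eq_measure set_pmf_iff\<close>)
  then have "AE \<omega> in M. \<forall>i\<in>- set_pmf \<nu>. W t \<omega> \<noteq> i"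
    by (intro AE_finite_allI) auto
  then show ?thesis by eventually_elim auto
qed

definition reach :: "(nat \<times> 'b \<Rightarrow> real) \<Rightarrow> nat \<Rightarrow> 'b \<Rightarrow> real" where
  "reach \<theta> t i = prob {\<omega> \<in> space M. W t \<omega> = i \<and> inv_lvl \<theta> t \<omega> < \<theta> (t, i)}"

text \<open>Levels are nonnegative, so it is enough that the inventory is negative. In period 1 this
  follows from \<rho> at 0 and independence of \<open>X1\<close>; later the preceding demand exceeds
  \<open>B\<close>, hence the stock, with probability at least \<alpha>.\<close>

lemma reach_ge:
  assumes t: "t \<in> {1..T}" and \<theta>: "\<And>s i. s \<in> {1..T} \<Longrightarrow> 0 \<le> \<theta> (s, i) \<and> \<theta> (s, i) \<le> B"
  shows "\<alpha> * pmf \<nu> i \<le> reach \<theta> t i"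
proof -
  have t1: "1 \<le> t" using t by simp
  have [measurable]: "W t \<in> measurable M (count_space UNIV)" "inv_lvl \<theta> t \<in> borel_measurable M"
    using W_measurable[OF t1] measurable_inv_lvl[OF t1] by auto
  have "\<alpha> * pmf \<nu> i \<le> prob {\<omega> \<in> space M. W t \<omega> = i \<and> inv_lvl \<theta> t \<omega> < 0}"
  proof (cases "t = 1")
    case True
    have PU: "measure (PD i) UNIV = 1" using prob_space.prob_space[OF prob_space_PD[of i]] by simp
    have "\<rho> 0 = prob {\<omega> \<in> space M. X1 \<omega> \<le> 0}"
      unfolding X1_cdf[symmetric] cdf_def by (subst measure_distr) (auto intro!: arg_cong[of _ _ prob])
    \<comment> \<open>The distribution function gives the weak inequality; the initial inventory has
      no atom at 0.\<close>
    also have "\<dots> = prob {\<omega> \<in> space M. X1 \<omega> < 0}"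
    proof (rule finite_measure_eq_AE)
      have "AE \<omega> in M. X1 \<omega> \<noteq> 0" using AE_inv_lvl_neq[of 1 \<theta> 0] by simp
      then show "AE \<omega> in M. (\<omega> \<in> {\<omega> \<in> space M. X1 \<omega> \<le> 0}) = (\<omega> \<in> {\<omega> \<in> space M. X1 \<omega> < 0})"
        by eventually_elim auto
    qed measurable
    finally have "\<alpha> \<le> prob {\<omega> \<in> space M. X1 \<omega> < 0}" using \<alpha>_le by simp
    then have "\<alpha> * pmf \<nu> i \<le> prob {\<omega> \<in> space M. X1 \<omega> < 0} * pmf \<nu> i" by (intro mult_right_mono) auto
    also have "\<dots> = prob {\<omega> \<in> space M. W t \<omega> = i \<and> inv_lvl \<theta> t \<omega> < 0}"
      using joint_law_X1[of 1 "{..<0}" "\<lambda>_. UNIV" "\<lambda>_. i"] True PU by (simp add: conj_commute)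
    finally show ?thesis .
  next
    case False
    then obtain s where s: "t = Suc s" "1 \<le> s" using t by (cases t) auto
    let ?Q = "\<lambda>k x z. fst z = i \<and> max x (\<theta> (s, k)) - snd z < 0"
    have Q: "{(x, z :: 'b \<times> real). ?Q k x z} \<in> sets (borel \<Otimes>\<^sub>M (count_space UNIV \<Otimes>\<^sub>M borel))" for k
    by (rule sets_step) measurable
    have Q': "{(x :: real, z :: 'b \<times> real). fst z = i} \<in> sets (borel \<Otimes>\<^sub>M (count_space UNIV \<Otimes>\<^sub>M borel))"
    by (rule sets_step) measurable
    \<comment> \<open>Demand and next state are independent under the kernel, so the factor \<alpha>
      is obtained separately for each next state.\<close>
    have k: "\<alpha> * measure (kern k) {z. fst z = i} \<le> measure (kern k) {z. ?Q k x z}" if "max x (\<theta> (s, k)) \<le> B" for k x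
    proof -
      interpret PDk: real_distribution "PD k" by (rule demand_law)
      let ?y = "max x (\<theta> (s, k))"
      have S1: "{z :: 'b \<times> real. fst z = i} \<in> sets (count_space UNIV \<Otimes>\<^sub>M borel)"
        using sets_Pair1[OF Q', of 0] by (simp add: vimage_def)
      have S2: "{z :: 'b \<times> real. ?Q k x z} \<in> sets (count_space UNIV \<Otimes>\<^sub>M borel)"
        using sets_Pair1[OF Q[of k], of x] by (simp add: vimage_def)
      have "\<alpha> \<le> 1 - cdf (PD k) B" using cdf_B[of k] by simp
      also have "\<dots> \<le> 1 - cdf (PD k) ?y" using that PDk.cdf_nondecreasing by simp
      also have "\<dots> = measure (PD k) (UNIV - {..?y})"
        using PDk.prob_compl[of "{..?y}"] by (simp add: cdf_def)
      also have "UNIV - {..?y} = {d. ?y < d}" by auto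
      finally have al: "\<alpha> \<le> measure (PD k) {d. ?y < d}" .
      have "\<alpha> * measure (kern k) {z. fst z = i} = (\<Sum>j\<in>UNIV. pmf (P k) j * (\<alpha> * measure (PD k) {d. j = i}))"
        unfolding measure_kern[OF S1] by (simp add: sum_distrib_left vimage_def mult_ac)
      also have "\<dots> \<le> (\<Sum>j\<in>UNIV. pmf (P k) j * measure (PD k) {d. j = i \<and> ?y < d})"
        using al PDk.prob_space by (intro sum_mono mult_left_mono) auto
      also have "\<dots> = measure (kern k) {z. ?Q k x z}"
        unfolding measure_kern[OF S2] by (simp add: vimage_def)
      finally show ?thesis .
    qed
    have "\<alpha> * pmf \<nu> i = \<alpha> * prob {\<omega> \<in> space M. W (Suc s) \<omega> = i}" using W_law[of "Suc s" i] by simp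
    also have "prob {\<omega> \<in> space M. W (Suc s) \<omega> = i} = (\<integral>\<omega>. measure (kern (W s \<omega>)) {z. fst z = i} \<partial>M)"
      using prob_step(2)[OF s(2), of "\<lambda>_ _ z. fst z = i" "\<theta>", OF Q'] by simp
    also have "\<alpha> * \<dots> = (\<integral>\<omega>. \<alpha> * measure (kern (W s \<omega>)) {z. fst z = i} \<partial>M)" by simp
    also have "\<dots> \<le> (\<integral>\<omega>. measure (kern (W s \<omega>)) {z. ?Q (W s \<omega>) (inv_lvl \<theta> s \<omega>) z} \<partial>M)"
    proof (rule integral_mono_AE)
      show "integrable M (\<lambda>\<omega>. \<alpha> * measure (kern (W s \<omega>)) {z. fst z = i})"
        using prob_step(1)[OF s(2), of "\<lambda>_ _ z. fst z = i" "\<theta>", OF Q'] by (rule integrable_mult_right)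
      show "integrable M (\<lambda>\<omega>. measure (kern (W s \<omega>)) {z. ?Q (W s \<omega>) (inv_lvl \<theta> s \<omega>) z})"
        by (rule prob_step(1)[OF s(2), of ?Q \<theta>, OF Q])
      have "AE \<omega> in M. inv_lvl \<theta> s \<omega> \<le> B"
        by (rule AE_inv_lvl_le[of B T]) (use \<theta> t s in auto)
      then show "AE \<omega> in M. \<alpha> * measure (kern (W s \<omega>)) {z. fst z = i} \<le> measure (kern (W s \<omega>)) {z. ?Q (W s \<omega>) (inv_lvl \<theta> s \<omega>) z}"
      proof eventually_elim
        case (elim \<omega>)
        show ?case by (rule k) (use elim \<theta>[of s "W s \<omega>"] t s in auto)
      qed
    qed
    also have "\<dots> = prob {\<omega> \<in> space M. ?Q (W s \<omega>) (inv_lvl \<theta> s \<omega>) (W (Suc s) \<omega>, D s \<omega>)}"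
      by (rule prob_step(2)[OF s(2), of ?Q \<theta>, OF Q, symmetric])
    also have "\<dots> = prob {\<omega> \<in> space M. W t \<omega> = i \<and> inv_lvl \<theta> t \<omega> < 0}"
      unfolding s(1) inv_lvl_Suc[OF s(2)] by simp
    finally show ?thesis .
  qed
  also have "\<dots> \<le> reach \<theta> t i"
    unfolding reach_def by (rule finite_measure_mono) (use \<theta>[OF t, of i] in auto)
  finally show ?thesis .
qed

lemma reach_bounds: "0 \<le> reach \<theta> t i" "reach \<theta> t i \<le> 1"
  by (simp_all add: reach_def)

text \<open>The two events can differ only if the inventory is within \<open>2 * \<delta>\<close> of
  the level: one \<delta> from the inventory, one from the level. The window bound at this radius
  gives the factor 4.\<close>

lemma reach_param_lipschitz:
  assumes t: "1 \<le> t" and \<delta>: "\<And>p. \<bar>\<theta> p - \<eta> p\<bar> \<le> \<delta>"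
  shows "\<bar>reach \<theta> t i - reach \<eta> t i\<bar> \<le> 4 * LX * \<delta>"
proof -
  have \<delta>0: "0 \<le> \<delta>" using \<delta>[of undefined] by linarith
  have [measurable]: "W t \<in> measurable M (count_space UNIV)" "inv_lvl \<theta> t \<in> borel_measurable M" "inv_lvl \<eta> t \<in> borel_measurable M"
    using W_measurable[OF t] measurable_inv_lvl[OF t] by auto
  let ?S = "{\<omega> \<in> space M. \<bar>inv_lvl \<theta> t \<omega> - \<theta> (t, i)\<bar> \<le> 2 * \<delta>}"
  let ?A = "{\<omega> \<in> space M. W t \<omega> = i \<and> inv_lvl \<theta> t \<omega> < \<theta> (t, i)}"
  let ?A' = "{\<omega> \<in> space M. W t \<omega> = i \<and> inv_lvl \<eta> t \<omega> < \<eta> (t, i)}"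
  have near: "\<bar>inv_lvl \<theta> t \<omega> - inv_lvl \<eta> t \<omega>\<bar> \<le> \<delta>" for \<omega>
    by (rule inv_lvl_param_lipschitz[OF t \<delta>])
  have S: "prob ?S \<le> 4 * LX * \<delta>"
    using inv_lvl_anti_concentrated[OF t, of "2 * \<delta>" \<theta> "\<theta> (t, i)"] \<delta>0 by simp
  have sub1: "\<omega> \<in> ?A' \<union> ?S" if "\<omega> \<in> ?A" for \<omega>
    using that near[of \<omega>] \<delta>[of "(t, i)"] by (cases "inv_lvl \<eta> t \<omega> < \<eta> (t, i)") auto
  have sub2: "\<omega> \<in> ?A \<union> ?S" if "\<omega> \<in> ?A'" for \<omega>
    using that near[of \<omega>] \<delta>[of "(t, i)"] by (cases "inv_lvl \<theta> t \<omega> < \<theta> (t, i)") auto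
  have "prob ?A \<le> prob (?A' \<union> ?S)" by (rule finite_measure_mono) (use sub1 in blast, measurable)
  also have "\<dots> \<le> prob ?A' + prob ?S" by (rule measure_Un_le) measurable
  finally have 1: "reach \<theta> t i \<le> reach \<eta> t i + 4 * LX * \<delta>" using S unfolding reach_def by linarith
  have "prob ?A' \<le> prob (?A \<union> ?S)" by (rule finite_measure_mono) (use sub2 in blast, measurable)
  also have "\<dots> \<le> prob ?A + prob ?S" by (rule measure_Un_le) measurable
  finally have "reach \<eta> t i \<le> reach \<theta> t i + 4 * LX * \<delta>" using S unfolding reach_def by linarith
  with 1 show ?thesis by linarith
qed

section \<open>Partial derivatives of the objective\<close>

definition partial :: "nat \<Rightarrow> (nat \<times> 'b \<Rightarrow> real) \<Rightarrow> nat \<times> 'b \<Rightarrow> real" where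
  "partial T \<theta> p = reach \<theta> (fst p) (snd p) * u \<theta> (Suc T - fst p) (fst p) (\<theta> p) (snd p)"

lemma LU_mono: "m \<le> n \<Longrightarrow> LU m \<le> LU n"
  using H_nonneg LD_nonneg by (auto simp: LU_def intro!: mult_right_mono mult_left_mono power_mono)

lemma partial_bound:
  assumes "fst p \<in> {1..T}" shows "\<bar>partial T \<theta> p\<bar> \<le> real T * H"
proof -
  have "\<bar>partial T \<theta> p\<bar> \<le> 1 * \<bar>u \<theta> (Suc T - fst p) (fst p) (\<theta> p) (snd p)\<bar>"
    unfolding partial_def abs_mult using reach_bounds by (intro mult_right_mono) auto
  also have "\<dots> \<le> real (Suc T - fst p) * H" using u_bound by simp
  also have "\<dots> \<le> real T * H" using assms H_nonneg by (intro mult_right_mono) auto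
  finally show ?thesis .
qed

text \<open>The 9 is 4 for the change of the reach probability plus 5 for the change of the marginal
  cost, of which 4 come from its argument and 1 from the later levels.\<close>

definition Lg :: "nat \<Rightarrow> real" where "Lg T = 9 * H * LX * (real T)\<^sup>2"

lemma partial_lipschitz:
  assumes p: "fst p \<in> {1..T}" and \<delta>: "\<And>p. \<bar>\<theta> p - \<eta> p\<bar> \<le> \<delta>"
  shows "\<bar>partial T \<theta> p - partial T \<eta> p\<bar> \<le> Lg T * \<delta>"
proof -
  obtain t i where ti: "p = (t, i)" by (cases p)
  define n where "n = Suc T - t"
  have t: "1 \<le> t" and n: "n \<le> T" using p unfolding ti n_def by auto
  have \<delta>0: "0 \<le> \<delta>" using \<delta>[of undefined] by linarith
  have T1: "1 \<le> real T" using p by simp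
  let ?u = "u \<theta> n t (\<theta> p) i" and ?v = "u \<eta> n t (\<eta> p) i"
  have u: "\<bar>?u\<bar> \<le> real T * H"
    using u_bound[of \<theta> n t "\<theta> p" i] n H_nonneg mult_right_mono[of "real n" "real T" H] by simp
  have "\<bar>?u - u \<theta> n t (\<eta> p) i\<bar> \<le> LU n * \<bar>\<theta> p - \<eta> p\<bar>" by (rule u_lipschitz)
  also have "\<dots> \<le> LU T * \<delta>"
    using LU_mono[OF n] \<delta>[of p] \<delta>0 H_nonneg LD_nonneg by (intro mult_mono) (auto simp: LU_def)
  finally have 1: "\<bar>?u - u \<theta> n t (\<eta> p) i\<bar> \<le> LU T * \<delta>" .
  have "\<bar>u \<theta> n t (\<eta> p) i - ?v\<bar> \<le> (real n)\<^sup>2 * (H * LD * \<delta>)" by (rule u_param_lipschitz[OF \<delta>])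
  also have "\<dots> \<le> (real T)\<^sup>2 * (H * LD * \<delta>)"
    using n \<delta>0 H_nonneg LD_nonneg by (intro mult_right_mono power_mono) auto
  finally have "\<bar>?u - ?v\<bar> \<le> LU T * \<delta> + (real T)\<^sup>2 * (H * LD * \<delta>)" using 1 by linarith
  also have "\<dots> = (5 * H * (real T)\<^sup>2 * \<delta>) * LD" by (simp add: LU_def algebra_simps)
  also have "\<dots> \<le> (5 * H * (real T)\<^sup>2 * \<delta>) * LX"
    using LX_ge H_nonneg \<delta>0 by (intro mult_left_mono) auto
  finally have uv: "\<bar>?u - ?v\<bar> \<le> 5 * H * (real T)\<^sup>2 * \<delta> * LX" .
  have "\<bar>reach \<theta> t i - reach \<eta> t i\<bar> * \<bar>?u\<bar> \<le> (4 * LX * \<delta>) * (real T * H)"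
    using reach_param_lipschitz[of t \<theta> \<eta> \<delta> i, OF t \<delta>] u LX_ge \<delta>0 by (intro mult_mono) auto
  also have "\<dots> = (4 * LX * \<delta> * H) * real T" by simp
  also have "\<dots> \<le> (4 * LX * \<delta> * H) * (real T)\<^sup>2"
    using T1 LX_ge \<delta>0 H_nonneg by (intro mult_left_mono) (auto simp: power2_eq_square)
  finally have A: "\<bar>reach \<theta> t i - reach \<eta> t i\<bar> * \<bar>?u\<bar> \<le> (4 * LX * \<delta> * H) * (real T)\<^sup>2" .
  have "reach \<eta> t i * \<bar>?u - ?v\<bar> \<le> 1 * (5 * H * (real T)\<^sup>2 * \<delta> * LX)"
    using reach_bounds uv by (intro mult_mono) auto
  moreover have "partial T \<theta> p - partial T \<eta> p = (reach \<theta> t i - reach \<eta> t i) * ?u + reach \<eta> t i * (?u - ?v)"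
    unfolding partial_def ti n_def by (simp add: algebra_simps)
  moreover have "\<bar>(reach \<theta> t i - reach \<eta> t i) * ?u + reach \<eta> t i * (?u - ?v)\<bar>
     \<le> \<bar>reach \<theta> t i - reach \<eta> t i\<bar> * \<bar>?u\<bar> + reach \<eta> t i * \<bar>?u - ?v\<bar>"
    using reach_bounds(1)[of \<eta> t i] by (metis abs_mult abs_of_nonneg abs_triangle_ineq)
  ultimately show ?thesis using A unfolding Lg_def by (simp add: algebra_simps)
qed

lemma inv_lvl_cong:
  assumes "1 \<le> t" "\<And>s i. s < t \<Longrightarrow> \<theta> (s, i) = \<eta> (s, i)"
  shows "inv_lvl \<theta> t \<omega> = inv_lvl \<eta> t \<omega>"
  using assms
proof (induction t rule: dec_induct)
  case (step t)
  then show ?case by (simp add: inv_lvl_Suc[OF step(1)])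
qed simp

lemma exists_bounded_levels: "\<exists>K. bounded_levels T K \<theta>"
proof -
  let ?K = "\<bar>B\<bar> + (\<Sum>p\<in>{1..T} \<times> UNIV. \<bar>\<theta> p\<bar>)"
  have "\<bar>\<theta> (t, i)\<bar> \<le> ?K" if "t \<in> {1..T}" for t i
    using member_le_sum[of "(t, i)" "{1..T} \<times> UNIV" "\<lambda>p. \<bar>\<theta> p\<bar>"] that by simp
  moreover have "B \<le> ?K" by (simp add: sum_nonneg add_increasing2)
  ultimately show ?thesis unfolding bounded_levels_def by blast
qed

lemma bounded_levels_mono: "bounded_levels T K \<theta> \<Longrightarrow> K \<le> K' \<Longrightarrow> bounded_levels T K' \<theta>"
  unfolding bounded_levels_def by (meson order_trans)

text \<open>Changing a single level \<open>\<theta> (t, i)\<close> does not affect the inventory before ordering in periods up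
  to \<open>t\<close>, and the cost-to-go of the unperturbed policy has the same levels as the perturbed one in all
  other periods. So only one term of the performance difference survives.\<close>

lemma obj_partial_derivative:
  assumes p: "fst p \<in> {1..T}"
  shows "((\<lambda>z. obj T (\<theta>(p := z))) has_real_derivative partial T \<theta> p) (at (\<theta> p))"
proof -
  obtain t i where ti: "p = (t, i)" by (cases p)
  define n where "n = Suc T - t"
  have t: "1 \<le> t" "t \<in> {1..T}" using p unfolding ti by auto
  have Wt [measurable]: "W t \<in> measurable M (count_space UNIV)" "inv_lvl \<theta> t \<in> borel_measurable M"
    using W_measurable[OF t(1)] measurable_inv_lvl[OF t(1)] by auto
  define I where "I = {\<omega> \<in> space M. W t \<omega> = i}"
  have I [measurable]: "I \<in> sets M" unfolding I_def by measurable
  define F where "F z \<omega> = indicator I \<omega> * q \<theta> n t (max (inv_lvl \<theta> t \<omega>) z) i" for z \<omega>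
  have inv: "inv_lvl (\<theta>(p := z)) t \<omega> = inv_lvl \<theta> t \<omega>" for z \<omega>
    by (rule inv_lvl_cong[OF t(1)]) (auto simp: ti)
  have F_alt: "F z \<omega> = q \<theta> n t (max (inv_lvl \<theta> t \<omega>) ((\<theta>(p := z)) (t, W t \<omega>))) (W t \<omega>) * indicator I \<omega>" for z \<omega>
    by (auto simp: F_def I_def indicator_def ti)
  have FI: "integrable M (F z)" for z
  proof -
    obtain K1 where K1: "bounded_levels T K1 \<theta>" using exists_bounded_levels by blast
    obtain K2 where K2: "bounded_levels T K2 (\<theta>(p := z))" using exists_bounded_levels by blast
    have "integrable M (\<lambda>\<omega>. q \<theta> n t (max (inv_lvl \<theta> t \<omega>) ((\<theta>(p := z)) (t, W t \<omega>))) (W t \<omega>))"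
      by (rule integrable_q_max[OF bounded_levels_mono[OF K2, of "max K1 K2"] bounded_levels_mono[OF K1, of "max K1 K2"] t(2)]) auto
    from integrable_real_mult_indicator[OF I this] show ?thesis unfolding F_alt[abs_def] by simp
  qed
  have obj: "obj T (\<theta>(p := z)) = obj T \<theta> - (\<integral>\<omega>. F (\<theta> p) \<omega> \<partial>M) + (\<integral>\<omega>. F z \<omega> \<partial>M)" for z
  proof -
    let ?\<eta> = "\<theta>(p := z)"
    obtain K1 where K1: "bounded_levels T K1 \<theta>" using exists_bounded_levels by blast
    obtain K2 where K2: "bounded_levels T K2 ?\<eta>" using exists_bounded_levels by blast
    have "obj T \<theta> - obj T ?\<eta> = (\<Sum>s\<in>{1..T}. gap_term \<theta> ?\<eta> (Suc T - s) s)"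
      by (rule performance_difference[OF bounded_levels_mono[OF K1, of "max K1 K2"] bounded_levels_mono[OF K2, of "max K1 K2"]]) auto
    also have "\<dots> = (\<Sum>s\<in>{1..T}. if s = t then gap_term \<theta> ?\<eta> n t else 0)"
      by (intro sum.cong) (auto simp: gap_term_def ti n_def)
    also have "\<dots> = gap_term \<theta> ?\<eta> n t" using t by simp
    also have "\<dots> = (\<integral>\<omega>. F (\<theta> p) \<omega> - F z \<omega> \<partial>M)"
      unfolding gap_term_def inv
      by (intro Bochner_Integration.integral_cong) (auto simp: F_def I_def indicator_def ti)
    also have "\<dots> = (\<integral>\<omega>. F (\<theta> p) \<omega> \<partial>M) - (\<integral>\<omega>. F z \<omega> \<partial>M)"
      using FI by (intro Bochner_Integration.integral_diff)
    finally show ?thesis by simp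
  qed
  let ?F' = "\<lambda>\<omega>. indicator {\<omega> \<in> space M. W t \<omega> = i \<and> inv_lvl \<theta> t \<omega> < \<theta> p} \<omega> * u \<theta> n t (\<theta> p) i"
  have "((\<lambda>z. \<integral>\<omega>. F z \<omega> \<partial>M) has_real_derivative (\<integral>\<omega>. ?F' \<omega> \<partial>M)) (at (\<theta> p))"
  proof (rule has_derivative_integral_lipschitz)
    show "finite_measure M" by unfold_locales
    show "integrable M (F z)" for z by (rule FI)
    show "\<bar>F x \<omega> - F y \<omega>\<bar> \<le> (real n * H) * \<bar>x - y\<bar>" for x y \<omega>
    proof -
      have "\<bar>q \<theta> n t (max (inv_lvl \<theta> t \<omega>) x) i - q \<theta> n t (max (inv_lvl \<theta> t \<omega>) y) i\<bar>
          \<le> real n * H * \<bar>max (inv_lvl \<theta> t \<omega>) x - max (inv_lvl \<theta> t \<omega>) y\<bar>" by (rule q_lipschitz)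
      also have "\<dots> \<le> real n * H * \<bar>x - y\<bar>" using H_nonneg by (intro mult_left_mono) auto
      finally show ?thesis using H_nonneg by (simp add: F_def indicator_def)
    qed
    show "?F' \<in> borel_measurable M" by measurable
    \<comment> \<open>Raising the level has an effect only when the inventory is below it. The tie,
      where no derivative need exist, has probability 0.\<close>
    show "AE \<omega> in M. ((\<lambda>z. F z \<omega>) has_real_derivative ?F' \<omega>) (at (\<theta> p))"
      using AE_inv_lvl_neq[OF t(1), of \<theta> "\<theta> p"] AE_space
    proof eventually_elim
      case (elim \<omega>)
      have "((\<lambda>z. q \<theta> n t (max z (inv_lvl \<theta> t \<omega>)) i) has_real_derivative
          (if inv_lvl \<theta> t \<omega> < \<theta> p then u \<theta> n t (\<theta> p) i else 0)) (at (\<theta> p))"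
        by (rule max_compose_deriv[where f = "\<lambda>x. q \<theta> n t x i", OF _ q_deriv]) (use elim in simp)
      then have "((\<lambda>z. indicator I \<omega> * q \<theta> n t (max (inv_lvl \<theta> t \<omega>) z) i) has_real_derivative
          indicator I \<omega> * (if inv_lvl \<theta> t \<omega> < \<theta> p then u \<theta> n t (\<theta> p) i else 0)) (at (\<theta> p))"
        by (intro DERIV_cmult) (simp add: max.commute)
      moreover have "indicator I \<omega> * (if inv_lvl \<theta> t \<omega> < \<theta> p then u \<theta> n t (\<theta> p) i else 0) = ?F' \<omega>"
        using elim by (simp add: I_def indicator_def)
      ultimately show ?case by (simp add: F_def)
    qed
  qed
  moreover have "(\<integral>\<omega>. ?F' \<omega> \<partial>M) = partial T \<theta> p"
    unfolding partial_def reach_def ti n_def by (simp add: mult.commute)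
  ultimately show ?thesis
    unfolding obj by (auto intro!: derivative_eq_intros)
qed

section \<open>Gradient domination\<close>

definition \<nu>min :: real where "\<nu>min = Min (pmf \<nu> ` set_pmf \<nu>)"

lemma \<nu>min_pos: "0 < \<nu>min"
  unfolding \<nu>min_def using set_pmf_not_empty[of \<nu>] by (subst Min_gr_iff) (auto simp: pmf_positive)

lemma \<nu>min_le: "i \<in> set_pmf \<nu> \<Longrightarrow> \<nu>min \<le> pmf \<nu> i"
  unfolding \<nu>min_def by (intro Min_le) auto

text \<open>Residuals of the objective become residuals of the marginal cost after division by the
  reach probability, at least \<open>\<alpha> * \<nu>min\<close> on the support of \<nu>. In each
  gap term \<open>threshold_gap_bound\<close> is applied with the residual of that period as
  \<open>G\<close> and the sum over later periods as \<open>d\<close>.\<close>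

lemma gradient_domination:
  assumes \<theta>: "\<And>s i. s \<in> {1..T} \<Longrightarrow> 0 \<le> \<theta> (s, i) \<and> \<theta> (s, i) \<le> B"
    and \<eta>: "\<And>s i. s \<in> {1..T} \<Longrightarrow> 0 \<le> \<eta> (s, i) \<and> \<eta> (s, i) \<le> B"
    and R0: "\<And>p. 0 \<le> R p"
    and lower: "\<And>p. fst p \<in> {1..T} \<Longrightarrow> \<theta> p < B \<Longrightarrow> - R p \<le> partial T \<theta> p"
    and upper: "\<And>p. fst p \<in> {1..T} \<Longrightarrow> 0 < \<theta> p \<Longrightarrow> partial T \<theta> p \<le> R p"
  shows "obj T \<theta> - obj T \<eta> \<le> real T * (((\<Sum>p\<in>{1..T} \<times> UNIV. R p) / (\<alpha> * \<nu>min))\<^sup>2 / (2 * (\<kappa> * \<mu>D)))"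
proof -
  define a where "a = \<alpha> * \<nu>min"
  have a: "0 < a" unfolding a_def using \<alpha>_pos \<nu>min_pos by simp
  define G where "G s = (\<Sum>i\<in>UNIV. R (s, i)) / a" for s
  define A where "A = (\<Sum>p\<in>{1..T} \<times> UNIV. R p) / a"
  have G0: "0 \<le> G s" for s unfolding G_def using R0 a by (auto intro!: divide_nonneg_pos sum_nonneg)
  have A: "A = (\<Sum>s\<in>{1..T}. G s)"
    unfolding A_def G_def by (simp add: sum.cartesian_product' sum_divide_distrib)
  have RG: "R (s, i) / a \<le> G s" for s i
    unfolding G_def using R0 a by (intro divide_right_mono member_le_sum) auto
  have reach: "a \<le> reach \<theta> s i" if "s \<in> {1..T}" "i \<in> set_pmf \<nu>" for s i
  proof -
    have "a \<le> \<alpha> * pmf \<nu> i" unfolding a_def using \<nu>min_le[OF that(2)] \<alpha>_pos by simp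
    also have "\<dots> \<le> reach \<theta> s i" by (rule reach_ge[where T = T]) (use that \<theta> in auto)
    finally show ?thesis .
  qed
  \<comment> \<open>If \<open>u\<close> were below \<open>- G s\<close>, multiplying by a reach
    probability of at least \<open>a\<close> would push the partial derivative below
    \<open>- R (s, i)\<close>.\<close>
  have lowerG: "- G s \<le> u \<theta> (Suc T - s) s (\<theta> (s, i)) i" if "s \<in> {1..T}" "i \<in> set_pmf \<nu>" "\<theta> (s, i) < B" for s i
  proof (rule ccontr)
    let ?u = "u \<theta> (Suc T - s) s (\<theta> (s, i)) i"
    assume "\<not> - G s \<le> ?u"
    then have "R (s, i) / a < - ?u" using RG[of s i] by linarith
    then have "R (s, i) < a * (- ?u)" and "0 < - ?u"
      using a R0[of "(s, i)"] by (simp add: pos_divide_less_eq mult.commute, smt (verit) divide_nonneg_pos)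
    have "a * (- ?u) \<le> reach \<theta> s i * (- ?u)"
      using reach[OF that(1,2)] \<open>0 < - ?u\<close> by (intro mult_right_mono) auto
    with \<open>R (s, i) < a * (- ?u)\<close> have "R (s, i) < reach \<theta> s i * (- ?u)" by linarith
    then have "partial T \<theta> (s, i) < - R (s, i)" unfolding partial_def by simp
    then show False using lower[of "(s, i)"] that by simp
  qed
  have upperG: "u \<theta> (Suc T - s) s (\<theta> (s, i)) i \<le> G s" if "s \<in> {1..T}" "i \<in> set_pmf \<nu>" "0 < \<theta> (s, i)" for s i
  proof (rule ccontr)
    let ?u = "u \<theta> (Suc T - s) s (\<theta> (s, i)) i"
    assume "\<not> ?u \<le> G s"
    then have "R (s, i) / a < ?u" using RG[of s i] by linarith
    then have "R (s, i) < a * ?u" and "0 < ?u"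
      using a R0[of "(s, i)"] by (simp add: pos_divide_less_eq mult.commute, smt (verit) divide_nonneg_pos)
    have "a * ?u \<le> reach \<theta> s i * ?u"
      using reach[OF that(1,2)] \<open>0 < ?u\<close> by (intro mult_right_mono) auto
    with \<open>R (s, i) < a * ?u\<close> have "R (s, i) < reach \<theta> s i * ?u" by linarith
    then have "R (s, i) < partial T \<theta> (s, i)" unfolding partial_def by simp
    then show False using upper[of "(s, i)"] that by simp
  qed
  obtain K1 where K1: "bounded_levels T K1 \<theta>" using exists_bounded_levels by blast
  obtain K2 where K2: "bounded_levels T K2 \<eta>" using exists_bounded_levels by blast
  define K where "K = max K1 K2"
  have K: "bounded_levels T K \<theta>" "bounded_levels T K \<eta>"
    using bounded_levels_mono[OF K1, of K] bounded_levels_mono[OF K2, of K] unfolding K_def by auto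
  have gap_bound: "gap_term \<theta> \<eta> (Suc T - s) s \<le> A\<^sup>2 / (2 * (\<kappa> * \<mu>D))" if s: "s \<in> {1..T}" for s
  proof -
    define n where "n = Suc T - s"
    have n: "s + n = Suc T" "0 < n" using s unfolding n_def by auto
    define d where "d = (\<Sum>r\<in>{s<..<s+n}. G r)"
    have d0: "0 \<le> d" unfolding d_def using G0 by (intro sum_nonneg) auto
    \<comment> \<open>The own residual and the later ones belong to different periods, so together
      they stay below the total.\<close>
    have "G s + d \<le> A"
    proof -
      have "G s + d = (\<Sum>r\<in>insert s {s<..<s+n}. G r)" unfolding d_def by simp
      also have "\<dots> \<le> (\<Sum>r\<in>{1..T}. G r)" using G0 s n by (intro sum_mono2) auto
      finally show ?thesis unfolding A .
    qed
    then have Gd: "(G s + d)\<^sup>2 / (2 * (\<kappa> * \<mu>D)) \<le> A\<^sup>2 / (2 * (\<kappa> * \<mu>D))"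
      using G0[of s] d0 \<kappa>_pos \<mu>D_pos by (intro divide_right_mono power_mono) auto
    have "gap_term \<theta> \<eta> n s \<le> (\<integral>\<omega>. A\<^sup>2 / (2 * (\<kappa> * \<mu>D)) \<partial>M)"
      unfolding gap_term_def
    proof (rule integral_mono_AE)
      show "integrable M (\<lambda>\<omega>. q \<theta> n s (max (inv_lvl \<eta> s \<omega>) (\<theta> (s, W s \<omega>))) (W s \<omega>) - q \<theta> n s (post \<eta> s \<omega>) (W s \<omega>))"
        using integrable_q_max[OF K s] integrable_q_max[OF K(2,2) s] by (rule Bochner_Integration.integrable_diff)
      have "AE \<omega> in M. inv_lvl \<eta> s \<omega> \<le> B"
        by (rule AE_inv_lvl_le[of B T]) (use \<eta> s in auto)
      moreover have "AE \<omega> in M. W s \<omega> \<in> set_pmf \<nu>" using AE_W_support s by simp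
      ultimately show "AE \<omega> in M. q \<theta> n s (max (inv_lvl \<eta> s \<omega>) (\<theta> (s, W s \<omega>))) (W s \<omega>) - q \<theta> n s (post \<eta> s \<omega>) (W s \<omega>)
          \<le> A\<^sup>2 / (2 * (\<kappa> * \<mu>D))"
      proof eventually_elim
        case (elim \<omega>)
        let ?i = "W s \<omega>"
        have "q \<theta> n s (max (inv_lvl \<eta> s \<omega>) (\<theta> (s, ?i))) ?i - q \<theta> n s (max (inv_lvl \<eta> s \<omega>) (\<eta> (s, ?i))) ?i
            \<le> (G s + d)\<^sup>2 / (2 * (\<kappa> * \<mu>D))"
        proof (rule threshold_gap_bound[where f = "\<lambda>y. q \<theta> n s y ?i" and f' = "\<lambda>y. u \<theta> n s y ?i" and B = B])
          show "((\<lambda>y. q \<theta> n s y ?i) has_real_derivative u \<theta> n s z ?i) (at z)" for z by (rule q_deriv)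
          show "\<kappa> * \<mu>D * (y - x) - d \<le> u \<theta> n s y ?i - u \<theta> n s x ?i" if "0 \<le> x" "x < y" "y \<le> B" for x y
          proof -
            have "(if 0 < n \<and> 0 \<le> x then \<kappa> * \<mu>D * (y - x) else 0) - (\<Sum>r\<in>{s<..<s+n}. G r) \<le> u \<theta> n s y ?i - u \<theta> n s x ?i"
            proof (rule u_almost_strongly_mono[OF G0])
              fix r j assume "j \<in> set_pmf \<nu>" "r \<in> {s<..<s + n}" "\<theta> (r, j) < B"
              then show "- G r \<le> u \<theta> (s + n - r) r (\<theta> (r, j)) j"
                using lowerG[of r j] s n(1) by auto
            qed (use elim that in auto)
            then show ?thesis using that n unfolding d_def by simp
          qed
          show "0 < \<kappa> * \<mu>D" using \<kappa>_pos \<mu>D_pos by simp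
          show "- G s \<le> u \<theta> n s (\<theta> (s, ?i)) ?i" if "\<theta> (s, ?i) < B"
            using lowerG[OF s elim(2) that] unfolding n_def .
          show "u \<theta> n s (\<theta> (s, ?i)) ?i \<le> G s" if "0 < \<theta> (s, ?i)"
            using upperG[OF s elim(2) that] unfolding n_def .
        qed (use \<theta> \<eta> s d0 elim in auto)
        then show ?case using Gd by linarith
      qed
    qed simp
    then show ?thesis unfolding n_def by (simp add: prob_space)
  qed
  have "obj T \<theta> - obj T \<eta> = (\<Sum>s\<in>{1..T}. gap_term \<theta> \<eta> (Suc T - s) s)"
    by (rule performance_difference[OF K])
  also have "\<dots> \<le> (\<Sum>s\<in>{1..T}. A\<^sup>2 / (2 * (\<kappa> * \<mu>D)))" by (intro sum_mono gap_bound)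
  also have "\<dots> = real T * (A\<^sup>2 / (2 * (\<kappa> * \<mu>D)))" by simp
  finally show ?thesis unfolding A_def a_def .
qed

text \<open>Joint measurability in levels and outcome; integrating out the outcome makes the
  objective a measurable function of a random iterate.\<close>

lemma measurable_inv_lvl_joint:
  assumes "1 \<le> t" "t \<le> Suc T"
  shows "(\<lambda>(\<theta>, \<omega>). inv_lvl \<theta> t \<omega>) \<in> borel_measurable (PiM (coords T) (\<lambda>_. borel) \<Otimes>\<^sub>M M)"
    (is "_ \<in> borel_measurable ?N")
  using assms
proof (induction t rule: dec_induct)
  case base
  show ?case by (simp add: split_beta')
next
  case (step t)
  then have IH [measurable]: "(\<lambda>z. inv_lvl (fst z) t (snd z)) \<in> borel_measurable ?N" by (simp add: split_beta')
  have [measurable]: "W t \<in> measurable M (count_space UNIV)" "D t \<in> borel_measurable M"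
    using W_measurable[OF step(1)] D_measurable[OF step(1)] by auto
  have [measurable]: "(\<lambda>z. (fst z :: nat \<times> 'b \<Rightarrow> real) (t, W t (snd z))) \<in> borel_measurable ?N"
  proof (rule measurable_compose_countable[where f = "\<lambda>i z. fst z (t, i)" and g = "\<lambda>z. W t (snd z)"])
    fix i :: 'b
    have "(t, i) \<in> coords T" using step by (simp add: coords_def)
    then show "(\<lambda>z. (fst z :: nat \<times> 'b \<Rightarrow> real) (t, i)) \<in> borel_measurable ?N"
      by (intro measurable_compose[OF measurable_fst measurable_component_singleton])
  qed measurable
  show ?case unfolding inv_lvl_Suc[OF step(1)] split_beta' by measurable
qed

lemma measurable_obj: "obj T \<in> borel_measurable (PiM (coords T) (\<lambda>_. borel))" (is "_ \<in> borel_measurable ?P")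
proof -
  let ?N = "?P \<Otimes>\<^sub>M M"
  have "(\<lambda>(\<theta>, \<omega>). realized_cost X1 W D PD h b T (base_stock \<theta>) \<omega>) \<in> borel_measurable ?N"
    unfolding realized_cost_def split_beta'
  proof (rule borel_measurable_sum)
    fix t assume t: "t \<in> {1..T}"
    then have t1: "1 \<le> t" by simp
    have [measurable]: "W t \<in> measurable M (count_space UNIV)" "D t \<in> borel_measurable M"
      using W_measurable[OF t1] D_measurable[OF t1] by auto
    have S: "(\<lambda>z. inv_lvl (fst z) (Suc t) (snd z)) \<in> borel_measurable ?N"
      using measurable_inv_lvl_joint[of "Suc t" T] t by (simp add: split_beta')
    \<comment> \<open>The stock after ordering is the next inventory plus the demand, so its
      measurability comes from the joint statement for \<open>Suc t\<close>.\<close>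
    have "(\<lambda>z. inv_lvl (fst z) (Suc t) (snd z) + D t (snd z)) \<in> borel_measurable ?N"
      using S by measurable
    then have post: "(\<lambda>z. base_stock (fst z) t (inv_lvl (fst z) t (snd z)) (W t (snd z))) \<in> borel_measurable ?N"
      unfolding inv_lvl_Suc[OF t1] by (simp add: base_stock_def)
    have pc: "(\<lambda>y. period_cost PD h b t y i) \<in> borel_measurable borel" for i
      unfolding period_cost_eq[of t _ i "\<lambda>_. 0"] by (rule measurable_q)
    show "(\<lambda>z. period_cost PD h b t (base_stock (fst z) t (inv_lvl (fst z) t (snd z)) (W t (snd z))) (W t (snd z))) \<in> borel_measurable ?N"
      by (rule measurable_kern_shift[where g = "\<lambda>i y. period_cost PD h b t y i", OF pc post]) measurable
  qed
  then show ?thesis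
    unfolding objective_def[abs_def] by (rule borel_measurable_lebesgue_integral)
qed

end

section \<open>Projected stochastic gradient descent on a box\<close>

text \<open>What the optimisation argument needs to know of the objective: partial derivatives, each
  Lipschitz in the Euclidean distance, and domination by any residual vector
  \<open>R\<close>.\<close>

locale box_gradient_dominated =
  fixes J :: "'j set" and B :: real and f :: "('j \<Rightarrow> real) \<Rightarrow> real" and g :: "('j \<Rightarrow> real) \<Rightarrow> 'j \<Rightarrow> real"
    and \<Lambda> Gb c :: real
  assumes finite_J: "finite J" and B_nonneg: "0 \<le> B" and \<Lambda>_nonneg: "0 \<le> \<Lambda>" and c_nonneg: "0 \<le> c"
    and deriv: "\<And>\<theta> j. \<theta> \<in> J \<rightarrow>\<^sub>E {0..B} \<Longrightarrow> j \<in> J \<Longrightarrow>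
      ((\<lambda>z. f (\<theta>(j := z))) has_real_derivative g \<theta> j) (at (\<theta> j))"
    and g_lipschitz: "\<And>\<theta> \<eta> j. \<theta> \<in> J \<rightarrow>\<^sub>E {0..B} \<Longrightarrow> \<eta> \<in> J \<rightarrow>\<^sub>E {0..B} \<Longrightarrow> j \<in> J \<Longrightarrow>
      \<bar>g \<theta> j - g \<eta> j\<bar> \<le> \<Lambda> * L2_set (\<lambda>j. \<theta> j - \<eta> j) J"
    and g_bound: "\<And>\<theta> j. \<theta> \<in> J \<rightarrow>\<^sub>E {0..B} \<Longrightarrow> j \<in> J \<Longrightarrow> \<bar>g \<theta> j\<bar> \<le> Gb"
    and dominated: "\<And>\<theta> \<eta> R. \<theta> \<in> J \<rightarrow>\<^sub>E {0..B} \<Longrightarrow> \<eta> \<in> J \<rightarrow>\<^sub>E {0..B} \<Longrightarrow> (\<And>j. 0 \<le> R j) \<Longrightarrow>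
      (\<And>j. j \<in> J \<Longrightarrow> \<theta> j < B \<Longrightarrow> - R j \<le> g \<theta> j) \<Longrightarrow> (\<And>j. j \<in> J \<Longrightarrow> 0 < \<theta> j \<Longrightarrow> g \<theta> j \<le> R j) \<Longrightarrow>
      f \<theta> - f \<eta> \<le> c * (\<Sum>j\<in>J. R j)\<^sup>2"
    and f_measurable: "f \<in> borel_measurable (PiM J (\<lambda>_. borel))"
begin

definition \<Theta> :: "('j \<Rightarrow> real) set" where "\<Theta> = J \<rightarrow>\<^sub>E {0..B}"

section \<open>Descent and projection, coordinate by coordinate\<close>

lemma \<Theta>_bounds: "\<theta> \<in> \<Theta> \<Longrightarrow> j \<in> J \<Longrightarrow> 0 \<le> \<theta> j \<and> \<theta> j \<le> B"
  by (auto simp: \<Theta>_def PiE_def Pi_def)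

lemma grad_eq: "\<theta> \<in> \<Theta> \<Longrightarrow> j \<in> J \<Longrightarrow> grad J f \<theta> j = g \<theta> j"
  using deriv by (simp add: grad_def \<Theta>_def DERIV_imp_deriv)

lemma segment_MVT:
  fixes \<phi> :: "real \<Rightarrow> real"
  assumes "\<And>z. min x y \<le> z \<Longrightarrow> z \<le> max x y \<Longrightarrow> (\<phi> has_real_derivative \<phi>' z) (at z)"
  shows "\<exists>z. min x y \<le> z \<and> z \<le> max x y \<and> \<phi> y - \<phi> x = (y - x) * \<phi>' z"
proof -
  consider "x = y" | "x < y" | "y < x" by linarith
  then show ?thesis
  proof cases
    case 2
    then obtain z where "x < z" "z < y" "\<phi> y - \<phi> x = (y - x) * \<phi>' z"
      using MVT2[of x y \<phi> \<phi>'] assms by auto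
    then show ?thesis by (intro exI[of _ z]) auto
  next
    case 3
    then obtain z where "y < z" "z < x" "\<phi> x - \<phi> y = (x - y) * \<phi>' z"
      using MVT2[of y x \<phi> \<phi>'] assms by auto
    then show ?thesis by (intro exI[of _ z]) (auto simp: algebra_simps)
  qed auto
qed

text \<open>Coordinates are changed one at a time, so the mean value theorem in one variable
  suffices. All intermediate points stay in the box and, in each coordinate, no further from
  \<theta> than \<eta> is.\<close>

lemma coordinate_path:
  assumes \<theta>: "\<theta> \<in> \<Theta>" and \<eta>: "\<eta> \<in> \<Theta>" and A: "A \<subseteq> J"
    and bnd: "\<And>\<xi> j. \<xi> \<in> \<Theta> \<Longrightarrow> (\<And>i. i \<in> J \<Longrightarrow> \<bar>\<xi> i - \<theta> i\<bar> \<le> \<bar>\<eta> i - \<theta> i\<bar>) \<Longrightarrow> j \<in> J \<Longrightarrow>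
      (\<eta> j - \<theta> j) * g \<xi> j \<le> K j"
  shows "f (\<lambda>j. if j \<in> A then \<eta> j else \<theta> j) - f \<theta> \<le> (\<Sum>j\<in>A. K j)"
  using finite_subset[OF A finite_J] A
proof (induction A rule: finite_induct)
  case (insert a A)
  let ?m = "\<lambda>j. if j \<in> A then \<eta> j else \<theta> j"
  let ?\<phi> = "\<lambda>z. f (?m(a := z))"
  have a: "a \<in> J" using insert by simp
  have m_upd: "?m(a := z) \<in> \<Theta>" if "min (\<theta> a) (\<eta> a) \<le> z" "z \<le> max (\<theta> a) (\<eta> a)" for z
  proof -
    have "0 \<le> z" "z \<le> B" using that \<Theta>_bounds[OF \<theta> a] \<Theta>_bounds[OF \<eta> a] by auto
    then show ?thesis using \<theta> \<eta> a unfolding \<Theta>_def by (auto simp: PiE_def Pi_def extensional_def)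
  qed
  have "(?\<phi> has_real_derivative g (?m(a := z)) a) (at z)"
    if "min (\<theta> a) (\<eta> a) \<le> z" "z \<le> max (\<theta> a) (\<eta> a)" for z
    using deriv[OF m_upd[OF that, unfolded \<Theta>_def] a] by simp
  then obtain z where z: "min (\<theta> a) (\<eta> a) \<le> z" "z \<le> max (\<theta> a) (\<eta> a)"
    and eq: "?\<phi> (\<eta> a) - ?\<phi> (\<theta> a) = (\<eta> a - \<theta> a) * g (?m(a := z)) a"
    using segment_MVT[of "\<theta> a" "\<eta> a" ?\<phi> "\<lambda>z. g (?m(a := z)) a"] by blast
  have "(\<eta> a - \<theta> a) * g (?m(a := z)) a \<le> K a"
    by (rule bnd[OF m_upd[OF z] _ a]) (use z in auto)
  moreover have "?m(a := \<eta> a) = (\<lambda>j. if j \<in> insert a A then \<eta> j else \<theta> j)" by auto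
  moreover have "?m(a := \<theta> a) = ?m" using insert by auto
  ultimately show ?case using insert eq by simp
qed simp

lemma mix_all: "\<theta> \<in> \<Theta> \<Longrightarrow> \<eta> \<in> \<Theta> \<Longrightarrow> (\<lambda>j. if j \<in> J then \<eta> j else \<theta> j) = \<eta>"
  by (auto simp: \<Theta>_def PiE_def extensional_def)

lemma L2_set_mono_abs:
  "(\<And>i. i \<in> J \<Longrightarrow> \<bar>a i\<bar> \<le> \<bar>b i\<bar>) \<Longrightarrow> L2_set a J \<le> L2_set b J"
  unfolding L2_set_def by (intro real_sqrt_le_mono sum_mono) (simp add: abs_le_square_iff)

text \<open>Along the coordinate path each partial derivative deviates from its value at \<theta> by
  at most \<Lambda> times the whole distance; summing over the coordinates produces the factor
  \<open>card J\<close>.\<close>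

lemma descent:
  assumes \<theta>: "\<theta> \<in> \<Theta>" and \<eta>: "\<eta> \<in> \<Theta>"
  shows "f \<eta> - f \<theta> \<le> (\<Sum>j\<in>J. g \<theta> j * (\<eta> j - \<theta> j)) + \<Lambda> * real (card J) * (\<Sum>j\<in>J. (\<eta> j - \<theta> j)\<^sup>2)"
proof -
  let ?n = "L2_set (\<lambda>j. \<eta> j - \<theta> j) J"
  have "f (\<lambda>j. if j \<in> J then \<eta> j else \<theta> j) - f \<theta> \<le> (\<Sum>j\<in>J. g \<theta> j * (\<eta> j - \<theta> j) + \<Lambda> * ?n * ?n)"
  proof (rule coordinate_path[OF \<theta> \<eta> subset_refl])
    fix \<xi> j assume \<xi>: "\<xi> \<in> \<Theta>" "\<And>i. i \<in> J \<Longrightarrow> \<bar>\<xi> i - \<theta> i\<bar> \<le> \<bar>\<eta> i - \<theta> i\<bar>" and j: "j \<in> J"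
    have "\<bar>g \<xi> j - g \<theta> j\<bar> \<le> \<Lambda> * L2_set (\<lambda>j. \<xi> j - \<theta> j) J"
      using g_lipschitz \<xi>(1) \<theta> j unfolding \<Theta>_def by blast
    also have "\<dots> \<le> \<Lambda> * ?n" using \<Lambda>_nonneg \<xi>(2) by (intro mult_left_mono L2_set_mono_abs) auto
    finally have 1: "\<bar>g \<xi> j - g \<theta> j\<bar> \<le> \<Lambda> * ?n" .
    have 2: "\<bar>\<eta> j - \<theta> j\<bar> \<le> ?n"
      using member_le_L2_set[OF finite_J j, of "\<lambda>j. \<bar>\<eta> j - \<theta> j\<bar>"] by (simp add: L2_set_def)
    have "(\<eta> j - \<theta> j) * (g \<xi> j - g \<theta> j) \<le> \<bar>g \<xi> j - g \<theta> j\<bar> * \<bar>\<eta> j - \<theta> j\<bar>"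
      by (metis abs_ge_self abs_mult mult.commute)
    also have "\<dots> \<le> (\<Lambda> * ?n) * ?n" using 1 2 by (intro mult_mono) (auto intro!: mult_nonneg_nonneg \<Lambda>_nonneg)
    finally show "(\<eta> j - \<theta> j) * g \<xi> j \<le> g \<theta> j * (\<eta> j - \<theta> j) + \<Lambda> * ?n * ?n" by (simp add: algebra_simps)
  qed
  moreover have "?n * ?n = (\<Sum>j\<in>J. (\<eta> j - \<theta> j)\<^sup>2)"
    unfolding L2_set_def by (simp add: sum_nonneg)
  then have "(\<Sum>j\<in>J. g \<theta> j * (\<eta> j - \<theta> j) + \<Lambda> * ?n * ?n)
    = (\<Sum>j\<in>J. g \<theta> j * (\<eta> j - \<theta> j)) + \<Lambda> * real (card J) * (\<Sum>j\<in>J. (\<eta> j - \<theta> j)\<^sup>2)"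
    by (simp add: sum.distrib mult.assoc)
  ultimately show ?thesis unfolding mix_all[OF \<theta> \<eta>] by linarith
qed

text \<open>Bounds the initial gap, and makes the objective bounded on the box and hence integrable
  along the iterates.\<close>

lemma variation_bound:
  assumes \<theta>: "\<theta> \<in> \<Theta>" and \<eta>: "\<eta> \<in> \<Theta>"
  shows "f \<eta> - f \<theta> \<le> real (card J) * (B * Gb)"
proof -
  have "f (\<lambda>j. if j \<in> J then \<eta> j else \<theta> j) - f \<theta> \<le> (\<Sum>j\<in>J. B * Gb)"
  proof (rule coordinate_path[OF \<theta> \<eta> subset_refl])
    fix \<xi> j assume \<xi>: "\<xi> \<in> \<Theta>" and j: "j \<in> J"
    have "(\<eta> j - \<theta> j) * g \<xi> j \<le> \<bar>\<eta> j - \<theta> j\<bar> * \<bar>g \<xi> j\<bar>" by (metis abs_ge_self abs_mult)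
    also have "\<dots> \<le> B * Gb"
      using \<Theta>_bounds[OF \<theta> j] \<Theta>_bounds[OF \<eta> j] g_bound[of \<xi> j] \<xi> j B_nonneg unfolding \<Theta>_def
      by (intro mult_mono) auto
    finally show "(\<eta> j - \<theta> j) * g \<xi> j \<le> B * Gb" .
  qed
  then show ?thesis unfolding mix_all[OF \<theta> \<eta>] by simp
qed

definition clip :: "('j \<Rightarrow> real) \<Rightarrow> 'j \<Rightarrow> real" where
  "clip v = (\<lambda>j\<in>J. max 0 (min B (v j)))"

lemma clip_in: "clip v \<in> \<Theta>"
  using B_nonneg by (auto simp: clip_def \<Theta>_def)

text \<open>\<open>proj\<close> picks some minimiser, so uniqueness matters: clipping minimises
  every coordinate separately, and a point that misses the minimum in one coordinate has a strictly
  larger sum.\<close>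

lemma proj_eq_clip: "proj J (J \<rightarrow>\<^sub>E {0..B}) v = clip v"
  unfolding proj_def arg_min_on_def
proof (rule arg_minI[of _ "clip v"])
  let ?d = "\<lambda>w. L2_set (\<lambda>j. v j - w j) J"
  have le: "(v j - clip v j)\<^sup>2 \<le> (v j - w j)\<^sup>2" and eq: "(v j - clip v j)\<^sup>2 = (v j - w j)\<^sup>2 \<Longrightarrow> w j = clip v j"
    if "w \<in> \<Theta>" "j \<in> J" for w j
  proof -
    have w: "0 \<le> w j" "w j \<le> B" using \<Theta>_bounds[OF that] by auto
    show "(v j - clip v j)\<^sup>2 \<le> (v j - w j)\<^sup>2"
      using w that by (auto simp: clip_def abs_le_square_iff[symmetric])
    assume "(v j - clip v j)\<^sup>2 = (v j - w j)\<^sup>2"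
    then have "\<bar>v j - clip v j\<bar> = \<bar>v j - w j\<bar>" by (metis abs_le_square_iff antisym order_refl)
    then show "w j = clip v j" using w that B_nonneg by (auto simp: clip_def max_def min_def split: if_splits)
  qed
  show c: "clip v \<in> J \<rightarrow>\<^sub>E {0..B}" using clip_in unfolding \<Theta>_def .
  show "\<not> ?d w < ?d (clip v)" if "w \<in> J \<rightarrow>\<^sub>E {0..B}" for w
    using le[of w] that unfolding \<Theta>_def[symmetric] not_less L2_set_def
    by (intro real_sqrt_le_mono sum_mono) auto
  fix w assume w: "w \<in> J \<rightarrow>\<^sub>E {0..B}" and min: "\<forall>y. y \<in> J \<rightarrow>\<^sub>E {0..B} \<longrightarrow> \<not> ?d y < ?d w"
  have "?d w \<le> ?d (clip v)" using min c by force
  then have "(\<Sum>j\<in>J. (v j - w j)\<^sup>2) \<le> (\<Sum>j\<in>J. (v j - clip v j)\<^sup>2)" by (simp add: L2_set_def)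
  have "w j = clip v j" if j: "j \<in> J" for j
  proof (rule eq[OF w[folded \<Theta>_def] j], rule ccontr)
    assume "(v j - clip v j)\<^sup>2 \<noteq> (v j - w j)\<^sup>2"
    then have "(v j - clip v j)\<^sup>2 < (v j - w j)\<^sup>2" using le[OF w[folded \<Theta>_def] j] by simp
    then have "(\<Sum>j\<in>J. (v j - clip v j)\<^sup>2) < (\<Sum>j\<in>J. (v j - w j)\<^sup>2)"
      using le[OF w[folded \<Theta>_def]] j finite_J by (intro sum_strict_mono_ex1) auto
    then show False using \<open>(\<Sum>j\<in>J. (v j - w j)\<^sup>2) \<le> (\<Sum>j\<in>J. (v j - clip v j)\<^sup>2)\<close> by simp
  qed
  then show "w = clip v" using w c by (intro PiE_ext[OF w c])
qed

section \<open>One noisy projected step\<close>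

definition N :: real where "N = real (card J)"
text \<open>Chosen so that the quadratic term of \<open>descent\<close> is at most half of what the
  projection step gains; the added 1 keeps the stepsize defined when \<Lambda> or \<open>N\<close>
  is 0.\<close>

definition S :: real where "S = 2 * \<Lambda> * N + 1"
text \<open>The contraction factor of a step will be \<open>Q / (1 + Q)\<close>. The 24 is 3 from
  squaring a sum of three residuals times 8 from expressing the squared step length through the
  decrease.\<close>

definition Q :: real where "Q = 24 * c * N * S + 1"

lemma N_nonneg: "0 \<le> N" by (simp add: N_def)
lemma S_ge: "1 \<le> S" "0 < S" "2 * \<Lambda> * N \<le> S" "\<Lambda> * N \<le> S"
  using \<Lambda>_nonneg N_nonneg by (auto simp: S_def add_nonneg_pos)
lemma Q_ge: "1 \<le> Q" using S_ge c_nonneg N_nonneg by (simp add: Q_def)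

lemma sum_squared_le: "(\<Sum>j\<in>J. a j)\<^sup>2 \<le> N * (\<Sum>j\<in>J. (a j)\<^sup>2)"
  using Cauchy_Schwarz_ineq_sum[of "\<lambda>_. 1" a J] by (simp add: N_def)

text \<open>The gradient-domination inequality is applied at the new iterate: there the projection step
  itself exhibits a normal vector of the box, so the projected gradient mapping never has to be
  compared with the distance of the gradient to the normal cone at the old iterate.\<close>

lemma noisy_step:
  fixes G :: "'j \<Rightarrow> real"
  assumes \<theta>: "\<theta> \<in> \<Theta>" and \<eta>: "\<eta> \<in> \<Theta>"
  defines "\<theta>' \<equiv> clip (\<lambda>j. \<theta> j - G j / S)"
  shows "(1 + Q) * (f \<theta>' - f \<eta>) \<le> Q * (f \<theta> - f \<eta>) + (27 * c * N + 1) * (\<Sum>j\<in>J. (G j - g \<theta> j)\<^sup>2)"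
proof -
  have \<theta>': "\<theta>' \<in> \<Theta>" unfolding \<theta>'_def by (rule clip_in)
  define \<delta> where "\<delta> j = \<theta>' j - \<theta> j" for j
  define e where "e j = G j - g \<theta> j" for j
  define D2 where "D2 = (\<Sum>j\<in>J. (\<delta> j)\<^sup>2)"
  define E2 where "E2 = (\<Sum>j\<in>J. (e j)\<^sup>2)"
  have D2: "0 \<le> D2" and E2: "0 \<le> E2" unfolding D2_def E2_def by (auto intro: sum_nonneg)
  note S = S_ge
  have \<theta>'j: "\<theta>' j = max 0 (min B (\<theta> j - G j / S))" if "j \<in> J" for j
    using that by (simp add: \<theta>'_def clip_def)
  \<comment> \<open>The variational inequality of the projection, tested against the old iterate, in
    one coordinate.\<close>
  have Gd: "G j * \<delta> j \<le> - S * (\<delta> j)\<^sup>2" if j: "j \<in> J" for j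
  proof -
    have b: "0 \<le> \<theta> j" "\<theta> j \<le> B" using \<Theta>_bounds[OF \<theta> j] by auto
    have "(G j / S + \<delta> j) * \<delta> j \<le> 0"
    proof -
      consider "0 \<le> \<theta> j - G j / S" "\<theta> j - G j / S \<le> B" | "\<theta> j - G j / S < 0" | "B < \<theta> j - G j / S" by linarith
      then show ?thesis
      proof cases
        case 1 then show ?thesis using \<theta>'j[OF j] by (simp add: \<delta>_def)
      next
        case 2
        then have "\<delta> j = - \<theta> j" using \<theta>'j[OF j] b by (simp add: \<delta>_def)
        then show ?thesis using 2 b by (intro mult_nonneg_nonpos) auto
      next
        case 3
        then have "\<delta> j = B - \<theta> j" using \<theta>'j[OF j] b B_nonneg by (simp add: \<delta>_def)
        then show ?thesis using 3 b by (intro mult_nonpos_nonneg) auto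
      qed
    qed
    then have "S * ((G j / S + \<delta> j) * \<delta> j) \<le> 0" using S by (simp add: mult_le_0_iff)
    moreover have "S * ((G j / S + \<delta> j) * \<delta> j) = G j * \<delta> j + S * (\<delta> j)\<^sup>2"
      using S by (simp add: field_simps power2_eq_square)
    ultimately show ?thesis by simp
  qed
  \<comment> \<open>Completing a square absorbs the noise at the cost of a quarter of
    \<open>S\<close>, leaving three quarters.\<close>
  have gd: "g \<theta> j * \<delta> j \<le> - (3 / 4 * S) * (\<delta> j)\<^sup>2 + (e j)\<^sup>2 / S" if j: "j \<in> J" for j
  proof -
    have "0 \<le> (e j + S / 2 * \<delta> j)\<^sup>2 / S" using S by simp
    also have "\<dots> = (e j)\<^sup>2 / S + e j * \<delta> j + S / 4 * (\<delta> j)\<^sup>2"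
      using S by (simp add: power2_eq_square field_simps)
    finally have "- (e j * \<delta> j) \<le> (e j)\<^sup>2 / S + S / 4 * (\<delta> j)\<^sup>2" by simp
    moreover have "g \<theta> j * \<delta> j = G j * \<delta> j - e j * \<delta> j" by (simp add: e_def algebra_simps)
    ultimately show ?thesis using Gd[OF j] by simp
  qed
  have "f \<theta>' - f \<theta> \<le> (\<Sum>j\<in>J. g \<theta> j * \<delta> j) + \<Lambda> * N * D2"
    using descent[OF \<theta> \<theta>'] unfolding \<delta>_def D2_def N_def .
  also have "\<dots> \<le> (\<Sum>j\<in>J. - (3 / 4 * S) * (\<delta> j)\<^sup>2 + (e j)\<^sup>2 / S) + S / 2 * D2"
    using gd D2 S by (intro add_mono sum_mono mult_right_mono) auto
  also have "\<dots> = - (3 / 4 * S) * D2 + E2 / S + S / 2 * D2"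
    unfolding D2_def E2_def by (simp only: sum.distrib sum_distrib_left sum_divide_distrib)
  \<comment> \<open>Of the remaining three quarters of \<open>S\<close>, \<open>descent\<close> uses
    one half.\<close>
  finally have dec: "S / 4 * D2 \<le> f \<theta> - f \<theta>' + E2 / S" by (simp add: algebra_simps)
  define nrm where "nrm = L2_set (\<lambda>j. \<theta>' j - \<theta> j) J"
  have nrm: "nrm\<^sup>2 = D2" "0 \<le> nrm"
    unfolding nrm_def D2_def \<delta>_def L2_set_def by (simp_all add: sum_nonneg)
  \<comment> \<open>The gradient at the new iterate is the sampled gradient, minus the noise, plus
    the change of the gradient along the step; the three terms bound these in order.\<close>
  define R where "R j = S * \<bar>\<delta> j\<bar> + \<bar>e j\<bar> + \<Lambda> * nrm" for j
  have gl: "\<bar>g \<theta>' j - g \<theta> j\<bar> \<le> \<Lambda> * nrm" if "j \<in> J" for j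
    unfolding nrm_def using g_lipschitz \<theta> \<theta>' that unfolding \<Theta>_def by blast
  have "f \<theta>' - f \<eta> \<le> c * (\<Sum>j\<in>J. R j)\<^sup>2"
  proof (rule dominated[OF \<theta>'[unfolded \<Theta>_def] \<eta>[unfolded \<Theta>_def]])
    show "0 \<le> R j" for j unfolding R_def using S \<Lambda>_nonneg nrm by simp
    show "- R j \<le> g \<theta>' j" if j: "j \<in> J" and "\<theta>' j < B" for j
    proof -
      \<comment> \<open>Away from the upper face clipping can only have raised the coordinate, so
        the sampled gradient is bounded below by the step.\<close>
      have "\<theta> j - G j / S \<le> \<theta>' j" using \<theta>'j[OF j] that by linarith
      then have "- (S * \<delta> j) \<le> G j" using S by (simp add: \<delta>_def field_simps)
      moreover have "S * \<delta> j \<le> S * \<bar>\<delta> j\<bar>" using S by simp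
      ultimately show ?thesis using gl[OF j] unfolding R_def e_def by linarith
    qed
    show "g \<theta>' j \<le> R j" if j: "j \<in> J" and "0 < \<theta>' j" for j
    proof -
      have "\<theta>' j \<le> \<theta> j - G j / S" using \<theta>'j[OF j] that by linarith
      then have "G j \<le> - (S * \<delta> j)" using S by (simp add: \<delta>_def field_simps)
      moreover have "- (S * \<delta> j) \<le> S * \<bar>\<delta> j\<bar>" using S by (simp add: abs_if)
      ultimately show ?thesis using gl[OF j] unfolding R_def e_def by linarith
    qed
  qed
  also have "(\<Sum>j\<in>J. R j)\<^sup>2 \<le> 3 * N * (2 * S\<^sup>2 * D2 + E2)"
  proof -
    have "(R j)\<^sup>2 \<le> 3 * (S\<^sup>2 * (\<delta> j)\<^sup>2 + (e j)\<^sup>2 + \<Lambda>\<^sup>2 * D2)" for j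
    proof -
      have "(x + y + z)\<^sup>2 \<le> 3 * (x\<^sup>2 + y\<^sup>2 + z\<^sup>2)" for x y z :: real
        using sum_squares_ge_zero[of "x - y" "y - z"] zero_le_square[of "x - z"]
        by (simp add: power2_eq_square algebra_simps)
      from this[of "S * \<bar>\<delta> j\<bar>" "\<bar>e j\<bar>" "\<Lambda> * nrm"] show ?thesis
        unfolding R_def by (simp add: power_mult_distrib nrm)
    qed
    then have "(\<Sum>j\<in>J. (R j)\<^sup>2) \<le> (\<Sum>j\<in>J. 3 * (S\<^sup>2 * (\<delta> j)\<^sup>2 + (e j)\<^sup>2 + \<Lambda>\<^sup>2 * D2))" by (intro sum_mono)
    also have "\<dots> = 3 * ((\<Sum>j\<in>J. S\<^sup>2 * (\<delta> j)\<^sup>2) + (\<Sum>j\<in>J. (e j)\<^sup>2) + (\<Sum>j\<in>J. \<Lambda>\<^sup>2 * D2))"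
      by (simp only: sum.distrib sum_distrib_left[symmetric])
    also have "\<dots> = 3 * (S\<^sup>2 * D2 + E2 + N * \<Lambda>\<^sup>2 * D2)"
      unfolding E2_def[symmetric] by (simp add: N_def D2_def[symmetric] sum_distrib_left[symmetric])
    finally have 1: "(\<Sum>j\<in>J. (R j)\<^sup>2) \<le> 3 * (S\<^sup>2 * D2 + E2 + N * \<Lambda>\<^sup>2 * D2)" .
    \<comment> \<open>\<open>N\<close> counts coordinates, so it is 0 or at least 1, and in the
      latter case at most its square.\<close>
    have 2: "N * \<Lambda>\<^sup>2 \<le> S\<^sup>2"
    proof (cases "card J = 0")
      case True then show ?thesis by (simp add: N_def)
    next
      case False
      then have "1 \<le> N" by (simp add: N_def)
      then have "N * \<Lambda>\<^sup>2 \<le> N * (N * \<Lambda>\<^sup>2)" using N_nonneg mult_right_mono[of 1 N "N * \<Lambda>\<^sup>2"] by simp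
      also have "\<dots> = (\<Lambda> * N)\<^sup>2" by (simp add: power2_eq_square algebra_simps)
      also have "\<dots> \<le> S\<^sup>2" using S \<Lambda>_nonneg N_nonneg by (intro power_mono) auto
      finally show ?thesis .
    qed
    have "(\<Sum>j\<in>J. (R j)\<^sup>2) \<le> 3 * (2 * S\<^sup>2 * D2 + E2)"
      using 1 mult_right_mono[OF 2 D2] by simp
    then have "N * (\<Sum>j\<in>J. (R j)\<^sup>2) \<le> N * (3 * (2 * S\<^sup>2 * D2 + E2))" using N_nonneg by (rule mult_left_mono)
    then show ?thesis using sum_squared_le[of R] by (simp add: algebra_simps)
  qed
  finally have dom: "f \<theta>' - f \<eta> \<le> c * (3 * N * (2 * S\<^sup>2 * D2 + E2))"
    using c_nonneg by (simp add: mult_left_mono)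
  let ?dec = "f \<theta> - f \<theta>' + E2 / S"
  have dec0: "0 \<le> ?dec" using dec D2 S by (smt (verit) mult_nonneg_nonneg divide_nonneg_pos)
  have "2 * S\<^sup>2 * D2 = 8 * S * (S / 4 * D2)" by (simp add: power2_eq_square)
  also have "\<dots> \<le> 8 * S * ?dec" using dec S by (intro mult_left_mono) auto
  finally have "2 * S\<^sup>2 * D2 + E2 \<le> 8 * S * ?dec + E2" by simp
  then have "c * (3 * N * (2 * S\<^sup>2 * D2 + E2)) \<le> c * (3 * N * (8 * S * ?dec + E2))"
    using c_nonneg N_nonneg by (intro mult_left_mono) auto
  also have "\<dots> = (24 * c * N * S) * ?dec + 3 * c * N * E2" by (simp add: algebra_simps)
  also have "\<dots> \<le> Q * ?dec + 3 * c * N * E2" using dec0 by (simp only: Q_def distrib_right mult_1)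
  finally have "f \<theta>' - f \<eta> \<le> Q * ?dec + 3 * c * N * E2" using dom by linarith
  moreover have "Q * ?dec = Q * (f \<theta> - f \<eta>) - Q * (f \<theta>' - f \<eta>) + Q / S * E2"
    by (simp add: algebra_simps)
  \<comment> \<open>This noise term contributes 24 and the noise part of the residuals 3, together
    the 27 of the claim.\<close>
  moreover have "Q / S * E2 \<le> (24 * c * N + 1) * E2"
  proof -
    have "Q / S = 24 * c * N + 1 / S" using S by (simp add: Q_def add_divide_distrib)
    also have "\<dots> \<le> 24 * c * N + 1" using S by simp
    finally show ?thesis using E2 by (rule mult_right_mono)
  qed
  ultimately have "(1 + Q) * (f \<theta>' - f \<eta>) \<le> Q * (f \<theta> - f \<eta>) + (27 * c * N + 1) * E2"
    by (simp add: algebra_simps)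
  then show ?thesis unfolding E2_def e_def .
qed

text \<open>Certifies \<open>1 / S\<close> as a stepsize of the required form: the coordinatewise
  constants add up to at most \<open>\<Lambda> * N\<close>.\<close>

lemma grad_lipschitz_S: "grad_lipschitz J (J \<rightarrow>\<^sub>E {0..B}) f S"
  unfolding grad_lipschitz_def
proof (intro conjI ballI)
  show "0 < S" by (rule S_ge)
  fix \<theta> assume \<theta>: "\<theta> \<in> J \<rightarrow>\<^sub>E {0..B}"
  show "(\<lambda>z. f (\<theta>(j := z))) differentiable at (\<theta> j)" if "j \<in> J" for j
    using deriv[OF \<theta> that] real_differentiable_def by blast
  fix \<eta> assume \<eta>: "\<eta> \<in> J \<rightarrow>\<^sub>E {0..B}"
  let ?n = "L2_set (\<lambda>j. \<theta> j - \<eta> j) J"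
  have "L2_set (\<lambda>j. grad J f \<theta> j - grad J f \<eta> j) J \<le> (\<Sum>j\<in>J. \<bar>grad J f \<theta> j - grad J f \<eta> j\<bar>)"
    by (rule L2_set_le_sum_abs)
  also have "\<dots> \<le> (\<Sum>j\<in>J. \<Lambda> * ?n)"
    using grad_eq g_lipschitz \<theta> \<eta> unfolding \<Theta>_def by (intro sum_mono) simp
  also have "\<dots> = (\<Lambda> * N) * ?n" by (simp add: N_def)
  also have "\<dots> \<le> S * ?n" using S_ge by (intro mult_right_mono) auto
  finally show "L2_set (\<lambda>j. grad J f \<theta> j - grad J f \<eta> j) J \<le> S * ?n" .
qed

end

text \<open>Redrawing one entry of an i.i.d. family does not change its law. This expresses that a
  sample is fresh relative to all others, without conditional expectations.\<close>

lemma nn_integral_PiM_resample: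
  fixes N :: "'n measure" and p :: 'i
  assumes N: "prob_space N" and \<Phi> [measurable]: "\<Phi> \<in> borel_measurable (PiM UNIV (\<lambda>_. N))"
  shows "(\<integral>\<^sup>+x. \<Phi> x \<partial>PiM UNIV (\<lambda>_. N)) = (\<integral>\<^sup>+x. \<integral>\<^sup>+\<xi>. \<Phi> (x(p := \<xi>)) \<partial>N \<partial>PiM UNIV (\<lambda>_. N))"
proof -
  let ?P = "PiM UNIV (\<lambda>_ :: 'i. N)"
  interpret N: prob_space N by fact
  interpret P: prob_space ?P by (rule prob_space_PiM) (rule N)
  interpret pair_sigma_finite N ?P by unfold_locales
  have up: "(\<lambda>(\<xi>, x). x(p := \<xi>)) \<in> measurable (N \<Otimes>\<^sub>M ?P) ?P"
    unfolding split_beta' by (rule measurable_fun_upd[where J = UNIV]) auto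
  have "?P = distr (N \<Otimes>\<^sub>M ?P) ?P (\<lambda>(\<xi>, x). x(p := \<xi>))"
    using distr_pair_PiM_eq_PiM[of UNIV "\<lambda>_. N" p] N by simp
  then have "(\<integral>\<^sup>+x. \<Phi> x \<partial>?P) = (\<integral>\<^sup>+x. \<Phi> x \<partial>distr (N \<Otimes>\<^sub>M ?P) ?P (\<lambda>(\<xi>, x). x(p := \<xi>)))" by simp
  also have "\<dots> = (\<integral>\<^sup>+z. \<Phi> (case z of (\<xi>, x) \<Rightarrow> x(p := \<xi>)) \<partial>(N \<Otimes>\<^sub>M ?P))"
    by (subst nn_integral_distr[OF up]) simp_all
  also have "\<dots> = (\<integral>\<^sup>+x. \<integral>\<^sup>+\<xi>. \<Phi> (x(p := \<xi>)) \<partial>N \<partial>?P)"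
    using measurable_compose[OF up \<Phi>] by (subst nn_integral_snd[symmetric]) auto
  finally show ?thesis .
qed

lemma psgd_cong:
  assumes "\<And>k' r. k' < k \<Longrightarrow> x (k', r) = y (k', r)"
  shows "psgd J \<Theta> G \<gamma> m \<theta>0 x k = psgd J \<Theta> G \<gamma> m \<theta>0 y k"
  using assms
proof (induction k)
  case (Suc k)
  then have "psgd J \<Theta> G \<gamma> m \<theta>0 x k = psgd J \<Theta> G \<gamma> m \<theta>0 y k" by simp
  moreover have "x (k, r) = y (k, r)" for r using Suc.prems by simp
  ultimately show ?case by simp
qed simp

section \<open>Mini-batch noise and the expected gap\<close>

locale box_psgd = box_gradient_dominated J B f g \<Lambda> Gb c
  for J :: "'j set" and B f g \<Lambda> Gb c +
  fixes \<sigma> :: real and \<D> :: "'n measure" and G :: "('j \<Rightarrow> real) \<Rightarrow> 'n \<Rightarrow> 'j \<Rightarrow> real"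
    and m :: nat and \<theta>0 :: "'j \<Rightarrow> real"
  assumes sg: "stochastic_gradient J (J \<rightarrow>\<^sub>E {0..B}) f \<sigma> \<D> G"
    and m_pos: "0 < m" and \<theta>0: "\<theta>0 \<in> J \<rightarrow>\<^sub>E {0..B}"
begin

abbreviation \<Omega> :: "(nat \<times> nat \<Rightarrow> 'n) measure" where "\<Omega> \<equiv> PiM UNIV (\<lambda>_. \<D>)"

abbreviation iter :: "nat \<Rightarrow> (nat \<times> nat \<Rightarrow> 'n) \<Rightarrow> 'j \<Rightarrow> real" where
  "iter k x \<equiv> psgd J (J \<rightarrow>\<^sub>E {0..B}) G (1 / S) m \<theta>0 x k"

definition batch :: "nat \<Rightarrow> (nat \<times> nat \<Rightarrow> 'n) \<Rightarrow> 'j \<Rightarrow> real" where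
  "batch k x j = (\<Sum>r<m. G (iter k x) (x (k, r)) j) / real m"

lemma prob_\<D>: "prob_space \<D>" using sg by (simp add: stochastic_gradient_def)

lemma prob_\<Omega>: "prob_space \<Omega>" by (rule prob_space_PiM) (rule prob_\<D>)

lemma iter_Suc: "iter (Suc k) x = clip (\<lambda>j. iter k x j - batch k x j / S)"
  unfolding psgd.simps proj_eq_clip by (simp add: clip_def batch_def fun_eq_iff mult.commute)

declare psgd.simps(2) [simp del]

lemma iter_in: "iter k x \<in> \<Theta>"
  by (cases k) (use \<theta>0 clip_in iter_Suc in \<open>auto simp: \<Theta>_def\<close>)

lemma G_measurable: "(\<lambda>(\<theta>, \<xi>). G \<theta> \<xi>) \<in> measurable (PiM J (\<lambda>_. borel) \<Otimes>\<^sub>M \<D>) (PiM J (\<lambda>_. borel))"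
  using sg by (simp add: stochastic_gradient_def)

lemma G_component_measurable:
  "j \<in> J \<Longrightarrow> (\<lambda>(\<theta>, \<xi>). G \<theta> \<xi> j) \<in> borel_measurable (PiM J (\<lambda>_. borel) \<Otimes>\<^sub>M \<D>)"
  using measurable_compose[OF G_measurable measurable_component_singleton[of j J "\<lambda>_. borel"]]
  by (simp add: split_beta')

lemma measurable_sample: "(\<lambda>x. x p) \<in> measurable \<Omega> \<D>"
  by (rule measurable_component_singleton) simp

lemma measurable_G_iter:
  assumes "iter k \<in> measurable \<Omega> (PiM J (\<lambda>_. borel))" "j \<in> J"
  shows "(\<lambda>x. G (iter k x) (x p) j) \<in> borel_measurable \<Omega>"
  using measurable_compose[OF measurable_Pair[OF assms(1) measurable_sample[of p]] G_component_measurable[OF assms(2)]]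
  by simp

lemma measurable_iter: "iter k \<in> measurable \<Omega> (PiM J (\<lambda>_. borel))"
proof (induction k)
  case 0
  have "\<theta>0 \<in> space (PiM J (\<lambda>_. borel))" using \<theta>0 by (auto simp: space_PiM PiE_def)
  then show ?case by simp
next
  case (Suc k)
  show ?case
    unfolding iter_Suc clip_def batch_def
  proof (rule measurable_restrict)
    fix j assume j: "j \<in> J"
    have [measurable]: "(\<lambda>x. iter k x j) \<in> borel_measurable \<Omega>"
      by (rule measurable_compose[OF Suc measurable_component_singleton[OF j]])
    have [measurable]: "(\<lambda>x. G (iter k x) (x (k, r)) j) \<in> borel_measurable \<Omega>" for r
      by (rule measurable_G_iter[OF Suc j])
    show "(\<lambda>x. max 0 (min B (iter k x j - (\<Sum>r<m. G (iter k x) (x (k, r)) j) / real m / S))) \<in> borel_measurable \<Omega>"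
      by measurable
  qed
qed

text \<open>Agrees with \<open>g\<close> on the box, and as a parameter integral it is measurable on
  the whole product space, so it can be composed with the random iterate.\<close>

definition mean_grad :: "('j \<Rightarrow> real) \<Rightarrow> 'j \<Rightarrow> real" where
  "mean_grad \<theta> j = (\<integral>\<xi>. G \<theta> \<xi> j \<partial>\<D>)"

lemma mean_grad_eq: "\<theta> \<in> \<Theta> \<Longrightarrow> j \<in> J \<Longrightarrow> mean_grad \<theta> j = g \<theta> j"
  using sg grad_eq unfolding stochastic_gradient_def mean_grad_def \<Theta>_def by simp

lemma measurable_mean_grad:
  assumes j: "j \<in> J" shows "(\<lambda>\<theta>. mean_grad \<theta> j) \<in> borel_measurable (PiM J (\<lambda>_. borel))"
proof -
  interpret D: prob_space \<D> by (rule prob_\<D>)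
  show ?thesis unfolding mean_grad_def
    by (rule D.borel_measurable_lebesgue_integral) (rule G_component_measurable[OF j])
qed

text \<open>A fixed \<open>z\<close> is orthogonal to a centred sample: the cross term integrates to
  0 by unbiasedness.\<close>

lemma one_sample_second_moment:
  assumes \<theta>: "\<theta> \<in> \<Theta>"
  shows "(\<integral>\<^sup>+\<xi>. ennreal (\<Sum>j\<in>J. (z j + (G \<theta> \<xi> j - mean_grad \<theta> j))\<^sup>2) \<partial>\<D>) \<le> ennreal ((\<Sum>j\<in>J. (z j)\<^sup>2) + \<sigma>\<^sup>2)"
proof -
  interpret D: prob_space \<D> by (rule prob_\<D>)
  define e where "e j \<xi> = G \<theta> \<xi> j - mean_grad \<theta> j" for j \<xi>
  have th: "\<theta> \<in> space (PiM J (\<lambda>_. borel))" using \<theta> by (auto simp: space_PiM PiE_def \<Theta>_def)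
  have Gint: "integrable \<D> (\<lambda>\<xi>. G \<theta> \<xi> j)" if "j \<in> J" for j
    using sg \<theta> that unfolding stochastic_gradient_def \<Theta>_def by blast
  have eint: "integrable \<D> (e j)" "(\<integral>\<xi>. e j \<xi> \<partial>\<D>) = 0" if "j \<in> J" for j
    unfolding e_def using Gint[OF that] by (auto simp: mean_grad_def D.prob_space)
  have L2: "(L2_set (\<lambda>j. G \<theta> \<xi> j - grad J f \<theta> j) J)\<^sup>2 = (\<Sum>j\<in>J. (e j \<xi>)\<^sup>2)" for \<xi>
  proof -
    have "(\<Sum>j\<in>J. (G \<theta> \<xi> j - grad J f \<theta> j)\<^sup>2) = (\<Sum>j\<in>J. (e j \<xi>)\<^sup>2)"
      using \<theta> by (intro sum.cong) (simp_all add: e_def mean_grad_eq grad_eq)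
    then show ?thesis by (simp add: L2_set_def sum_nonneg)
  qed
  have V: "integrable \<D> (\<lambda>\<xi>. \<Sum>j\<in>J. (e j \<xi>)\<^sup>2)" "(\<integral>\<xi>. (\<Sum>j\<in>J. (e j \<xi>)\<^sup>2) \<partial>\<D>) \<le> \<sigma>\<^sup>2"
    using sg \<theta> unfolding stochastic_gradient_def \<Theta>_def by (auto simp: L2)
  have expand: "(\<Sum>j\<in>J. (z j + e j \<xi>)\<^sup>2) = (\<Sum>j\<in>J. (z j)\<^sup>2) + (\<Sum>j\<in>J. 2 * z j * e j \<xi>) + (\<Sum>j\<in>J. (e j \<xi>)\<^sup>2)" for \<xi>
    by (simp add: sum.distrib[symmetric] power2_sum algebra_simps)
  have i1: "integrable \<D> (\<lambda>\<xi>. \<Sum>j\<in>J. 2 * z j * e j \<xi>)"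
    using eint by (intro Bochner_Integration.integrable_sum integrable_mult_right) auto
  have int: "integrable \<D> (\<lambda>\<xi>. \<Sum>j\<in>J. (z j + e j \<xi>)\<^sup>2)"
    unfolding expand using i1 V(1) by (intro Bochner_Integration.integrable_add) auto
  have "(\<integral>\<^sup>+\<xi>. ennreal (\<Sum>j\<in>J. (z j + e j \<xi>)\<^sup>2) \<partial>\<D>) = ennreal (\<integral>\<xi>. (\<Sum>j\<in>J. (z j + e j \<xi>)\<^sup>2) \<partial>\<D>)"
    by (rule nn_integral_eq_integral[OF int]) (auto intro!: sum_nonneg)
  also have "(\<integral>\<xi>. (\<Sum>j\<in>J. (z j + e j \<xi>)\<^sup>2) \<partial>\<D>) = (\<Sum>j\<in>J. (z j)\<^sup>2) + (\<integral>\<xi>. (\<Sum>j\<in>J. 2 * z j * e j \<xi>) \<partial>\<D>) + (\<integral>\<xi>. (\<Sum>j\<in>J. (e j \<xi>)\<^sup>2) \<partial>\<D>)"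
    unfolding expand using i1 V(1) by (simp add: D.prob_space)
  also have "(\<integral>\<xi>. (\<Sum>j\<in>J. 2 * z j * e j \<xi>) \<partial>\<D>) = 0"
    using eint by (subst Bochner_Integration.integral_sum) auto
  finally show ?thesis using V(2) unfolding e_def by (simp add: ennreal_leI)
qed

lemma measurable_deviation:
  "(\<lambda>x. \<Sum>j\<in>J. (\<Sum>r<n. G (iter k x) (x (k, r)) j - mean_grad (iter k x) j)\<^sup>2) \<in> borel_measurable \<Omega>"
  by (intro borel_measurable_sum borel_measurable_power borel_measurable_diff
      measurable_G_iter[OF measurable_iter] measurable_compose[OF measurable_iter measurable_mean_grad])

text \<open>Samples are added one by one. Redrawing entry \<open>(k, n)\<close> affects neither the
  iterate, which uses samples of earlier iterations only, nor the preceding part of the batch, so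
  each sample adds at most \<open>\<sigma>^2\<close>.\<close>

lemma batch_second_moment:
  "(\<integral>\<^sup>+x. ennreal (\<Sum>j\<in>J. (\<Sum>r<n. G (iter k x) (x (k, r)) j - mean_grad (iter k x) j)\<^sup>2) \<partial>\<Omega>) \<le> ennreal (real n * \<sigma>\<^sup>2)"
proof (induction n)
  case (Suc n)
  interpret \<Omega>: prob_space \<Omega> by (rule prob_\<Omega>)
  let ?Z = "\<lambda>n x j. \<Sum>r<n. G (iter k x) (x (k, r)) j - mean_grad (iter k x) j"
  have Z2: "(\<lambda>x. ennreal (\<Sum>j\<in>J. (?Z n x j)\<^sup>2)) \<in> borel_measurable \<Omega>" for n
    by (rule measurable_compose[OF measurable_deviation measurable_ennreal])
  have "(\<integral>\<^sup>+x. ennreal (\<Sum>j\<in>J. (?Z (Suc n) x j)\<^sup>2) \<partial>\<Omega>)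
     = (\<integral>\<^sup>+x. \<integral>\<^sup>+\<xi>. ennreal (\<Sum>j\<in>J. (?Z (Suc n) (x((k, n) := \<xi>)) j)\<^sup>2) \<partial>\<D> \<partial>\<Omega>)"
    by (rule nn_integral_PiM_resample[OF prob_\<D> Z2])
  also have "\<dots> \<le> (\<integral>\<^sup>+x. ennreal (\<Sum>j\<in>J. (?Z n x j)\<^sup>2) + ennreal (\<sigma>\<^sup>2) \<partial>\<Omega>)"
  proof (rule nn_integral_mono)
    fix x
    have it: "iter k (x((k, n) := \<xi>)) = iter k x" for \<xi> by (rule psgd_cong) simp
    have "?Z (Suc n) (x((k, n) := \<xi>)) j = ?Z n x j + (G (iter k x) \<xi> j - mean_grad (iter k x) j)" for \<xi> j
      unfolding it by simp
    then have "(\<integral>\<^sup>+\<xi>. ennreal (\<Sum>j\<in>J. (?Z (Suc n) (x((k, n) := \<xi>)) j)\<^sup>2) \<partial>\<D>)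
       = (\<integral>\<^sup>+\<xi>. ennreal (\<Sum>j\<in>J. (?Z n x j + (G (iter k x) \<xi> j - mean_grad (iter k x) j))\<^sup>2) \<partial>\<D>)" by simp
    also have "\<dots> \<le> ennreal ((\<Sum>j\<in>J. (?Z n x j)\<^sup>2) + \<sigma>\<^sup>2)" by (rule one_sample_second_moment[OF iter_in])
    also have "\<dots> = ennreal (\<Sum>j\<in>J. (?Z n x j)\<^sup>2) + ennreal (\<sigma>\<^sup>2)" by (simp add: sum_nonneg)
    finally show "(\<integral>\<^sup>+\<xi>. ennreal (\<Sum>j\<in>J. (?Z (Suc n) (x((k, n) := \<xi>)) j)\<^sup>2) \<partial>\<D>)
      \<le> ennreal (\<Sum>j\<in>J. (?Z n x j)\<^sup>2) + ennreal (\<sigma>\<^sup>2)" .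
  qed
  also have "\<dots> = (\<integral>\<^sup>+x. ennreal (\<Sum>j\<in>J. (?Z n x j)\<^sup>2) \<partial>\<Omega>) + ennreal (\<sigma>\<^sup>2)"
    using Z2 by (subst nn_integral_add) (auto simp: \<Omega>.emeasure_space_1)
  also have "\<dots> \<le> ennreal (real n * \<sigma>\<^sup>2) + ennreal (\<sigma>\<^sup>2)" using Suc.IH by (rule add_right_mono)
  also have "\<dots> = ennreal (real (Suc n) * \<sigma>\<^sup>2)" by (simp add: algebra_simps flip: ennreal_plus)
  finally show ?case .
qed simp

lemma batch_variance:
  "integrable \<Omega> (\<lambda>x. \<Sum>j\<in>J. (batch k x j - g (iter k x) j)\<^sup>2)"
  "(\<integral>x. (\<Sum>j\<in>J. (batch k x j - g (iter k x) j)\<^sup>2) \<partial>\<Omega>) \<le> \<sigma>\<^sup>2 / real m"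
proof -
  let ?Z = "\<lambda>x j. \<Sum>r<m. G (iter k x) (x (k, r)) j - mean_grad (iter k x) j"
  have eq: "(\<Sum>j\<in>J. (batch k x j - g (iter k x) j)\<^sup>2) = (\<Sum>j\<in>J. (?Z x j)\<^sup>2) / (real m)\<^sup>2" for x
  proof -
    have "batch k x j - g (iter k x) j = ?Z x j / real m" if "j \<in> J" for j
      using m_pos mean_grad_eq[OF iter_in that] by (simp add: batch_def sum_subtractf field_simps)
    then have "(\<Sum>j\<in>J. (batch k x j - g (iter k x) j)\<^sup>2) = (\<Sum>j\<in>J. (?Z x j / real m)\<^sup>2)"
      by (intro sum.cong refl) (simp only:)
    then show ?thesis by (simp only: power_divide sum_divide_distrib[symmetric])
  qed
  have nn: "(\<integral>\<^sup>+x. ennreal (\<Sum>j\<in>J. (?Z x j)\<^sup>2) \<partial>\<Omega>) \<le> ennreal (real m * \<sigma>\<^sup>2)" by (rule batch_second_moment)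
  have int: "integrable \<Omega> (\<lambda>x. \<Sum>j\<in>J. (?Z x j)\<^sup>2)"
  proof (rule integrableI_bounded[OF measurable_deviation])
    have "(\<integral>\<^sup>+x. ennreal (norm (\<Sum>j\<in>J. (?Z x j)\<^sup>2)) \<partial>\<Omega>) = (\<integral>\<^sup>+x. ennreal (\<Sum>j\<in>J. (?Z x j)\<^sup>2) \<partial>\<Omega>)"
      by (simp add: sum_nonneg)
    also have "\<dots> < \<infinity>" using nn by (rule le_less_trans) simp
    finally show "(\<integral>\<^sup>+x. ennreal (norm (\<Sum>j\<in>J. (?Z x j)\<^sup>2)) \<partial>\<Omega>) < \<infinity>" .
  qed
  have "ennreal (\<integral>x. (\<Sum>j\<in>J. (?Z x j)\<^sup>2) \<partial>\<Omega>) \<le> ennreal (real m * \<sigma>\<^sup>2)"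
  proof -
    have "(\<integral>\<^sup>+x. ennreal (\<Sum>j\<in>J. (?Z x j)\<^sup>2) \<partial>\<Omega>) = ennreal (\<integral>x. (\<Sum>j\<in>J. (?Z x j)\<^sup>2) \<partial>\<Omega>)"
      by (rule nn_integral_eq_integral[OF int]) (simp add: sum_nonneg)
    then show ?thesis using nn by (simp only:)
  qed
  then have le: "(\<integral>x. (\<Sum>j\<in>J. (?Z x j)\<^sup>2) \<partial>\<Omega>) \<le> real m * \<sigma>\<^sup>2" by (simp add: ennreal_le_iff)
  show "integrable \<Omega> (\<lambda>x. \<Sum>j\<in>J. (batch k x j - g (iter k x) j)\<^sup>2)"
    unfolding eq using int by simp
  have "(\<integral>x. (\<Sum>j\<in>J. (batch k x j - g (iter k x) j)\<^sup>2) \<partial>\<Omega>) \<le> real m * \<sigma>\<^sup>2 / (real m)\<^sup>2"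
    unfolding eq using le by (simp add: divide_right_mono)
  also have "\<dots> = \<sigma>\<^sup>2 / real m" using m_pos by (simp add: power2_eq_square)
  finally show "(\<integral>x. (\<Sum>j\<in>J. (batch k x j - g (iter k x) j)\<^sup>2) \<partial>\<Omega>) \<le> \<sigma>\<^sup>2 / real m" .
qed

definition fmin :: real where "fmin = (INF \<theta>\<in>J \<rightarrow>\<^sub>E {0..B}. f \<theta>)"

lemma fmin_le: "\<theta> \<in> \<Theta> \<Longrightarrow> f \<theta> - fmin \<le> real (card J) * (B * Gb)"
proof -
  assume \<theta>: "\<theta> \<in> \<Theta>"
  have "f \<theta> - real (card J) * (B * Gb) \<le> fmin"
    unfolding fmin_def using \<theta>0 variation_bound[OF _ \<theta>]
    by (intro cINF_greatest) (auto simp: \<Theta>_def, smt (verit))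
  then show ?thesis by simp
qed

lemma integrable_f_iter: "integrable \<Omega> (\<lambda>x. f (iter k x))"
proof -
  interpret \<Omega>: prob_space \<Omega> by (rule prob_\<Omega>)
  have "\<bar>f (iter k x)\<bar> \<le> \<bar>f \<theta>0\<bar> + real (card J) * (B * Gb)" for x
    using variation_bound[of \<theta>0 "iter k x"] variation_bound[of "iter k x" \<theta>0] iter_in[of x k] \<theta>0
    unfolding \<Theta>_def by (auto simp: abs_if)
  then show ?thesis
    by (intro \<Omega>.integrable_const_bound[of _ "\<bar>f \<theta>0\<bar> + real (card J) * (B * Gb)"] measurable_compose[OF measurable_iter f_measurable]) auto
qed

text \<open>The expectation of \<open>noisy_step\<close>, iterated: the gap contracts by
  \<open>Q / (1 + Q)\<close> per iteration while fresh noise enters.\<close>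

lemma expected_gap:
  "(\<integral>x. f (iter k x) \<partial>\<Omega>) - fmin \<le> (Q / (1 + Q)) ^ k * (N * (B * Gb)) + (27 * c * N + 1) * (\<sigma>\<^sup>2 / real m)"
proof (induction k)
  case 0
  interpret \<Omega>: prob_space \<Omega> by (rule prob_\<Omega>)
  have "0 \<le> (27 * c * N + 1) * (\<sigma>\<^sup>2 / real m)" using c_nonneg N_nonneg by simp
  moreover have "f \<theta>0 - fmin \<le> N * (B * Gb)" using fmin_le \<theta>0 by (simp add: \<Theta>_def N_def)
  ultimately show ?case by (simp add: \<Omega>.prob_space)
next
  case (Suc k)
  interpret \<Omega>: prob_space \<Omega> by (rule prob_\<Omega>)
  let ?E = "\<lambda>x. \<Sum>j\<in>J. (batch k x j - g (iter k x) j)\<^sup>2"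
  let ?b = "27 * c * N + 1" and ?a = "\<lambda>k. (\<integral>x. f (iter k x) \<partial>\<Omega>)"
  let ?V = "?b * (\<sigma>\<^sup>2 / real m)" and ?r = "Q / (1 + Q)"
  have b0: "0 \<le> ?b" using c_nonneg N_nonneg by simp
  have step: "(1 + Q) * f (iter (Suc k) x) \<le> Q * f (iter k x) + fmin + ?b * ?E x" for x
  proof -
    \<comment> \<open>The left-hand side does not involve \<eta>, so the infimum over \<eta> can be
      taken.\<close>
    have "(1 + Q) * f (iter (Suc k) x) - Q * f (iter k x) - ?b * ?E x \<le> f \<eta>" if "\<eta> \<in> \<Theta>" for \<eta>
      using noisy_step[OF iter_in[of x k] that, of "batch k x"] unfolding iter_Suc by (simp add: algebra_simps)
    then have "(1 + Q) * f (iter (Suc k) x) - Q * f (iter k x) - ?b * ?E x \<le> fmin"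
      unfolding fmin_def using \<theta>0 by (intro cINF_greatest) (auto simp: \<Theta>_def)
    then show ?thesis by simp
  qed
  have "(1 + Q) * ?a (Suc k) = (\<integral>x. (1 + Q) * f (iter (Suc k) x) \<partial>\<Omega>)" by simp
  also have "\<dots> \<le> (\<integral>x. Q * f (iter k x) + fmin + ?b * ?E x \<partial>\<Omega>)"
    using step integrable_f_iter batch_variance(1)[of k] by (intro integral_mono) auto
  also have "\<dots> = Q * ?a k + fmin + ?b * (\<integral>x. ?E x \<partial>\<Omega>)"
    using integrable_f_iter batch_variance(1)[of k] by (simp add: \<Omega>.prob_space)
  also have "\<dots> \<le> Q * ?a k + fmin + ?V"
    using batch_variance(2)[of k] b0 by (intro add_left_mono mult_left_mono) auto
  finally have "(1 + Q) * (?a (Suc k) - fmin) \<le> Q * (?a k - fmin) + ?V" by (simp add: algebra_simps)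
  also have "\<dots> \<le> Q * (?r ^ k * (N * (B * Gb)) + ?V) + ?V"
    using Suc.IH Q_ge by (intro add_right_mono mult_left_mono) auto
  also have "\<dots> = (1 + Q) * (?r ^ Suc k * (N * (B * Gb)) + ?V)"
  proof -
    \<comment> \<open>\<open>V\<close> is the fixed point of the noise recursion, so the noise term
      is the same after any number of iterations.\<close>
    have "Q * (X + V) + V = (1 + Q) * (Q / (1 + Q) * X + V)" for X V
      using Q_ge by (simp add: field_simps)
    from this[of "?r ^ k * (N * (B * Gb))" ?V] show ?thesis by (simp only: power_Suc mult.assoc)
  qed
  finally show ?case using Q_ge mult_le_cancel_left_pos[of "1 + Q"] by (simp only: diff_le_eq)
qed

end

section \<open>Number of iterations and batch size\<close>

context box_gradient_dominated begin

text \<open>The variation bound between a point and itself.\<close>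

lemma range_nonneg: "0 \<le> N * (B * Gb)"
  using variation_bound[OF clip_in[of undefined] clip_in[of undefined]] by (simp add: N_def)

lemma psgd_guarantee_bound:
  assumes m: "0 < m"
    and le: "(Q / (1 + Q)) ^ K * (N * (B * Gb)) + (27 * c * N + 1) * (\<sigma>\<^sup>2 / real m) \<le> \<epsilon>"
  shows "psgd_guarantee TYPE('n) J (J \<rightarrow>\<^sub>E {0..B}) f \<sigma> \<epsilon> S K m"
  unfolding psgd_guarantee_def
proof (intro allI ballI impI)
  fix D :: "'n measure" and G \<theta>0
  assume "\<theta>0 \<in> J \<rightarrow>\<^sub>E {0..B}" "stochastic_gradient J (J \<rightarrow>\<^sub>E {0..B}) f \<sigma> D G"
  then interpret box_psgd J B f g \<Lambda> Gb c \<sigma> D G m \<theta>0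
    using m by unfold_locales
  show "integrable (PiM UNIV (\<lambda>_. D)) (\<lambda>x. f (psgd J (J \<rightarrow>\<^sub>E {0..B}) G (1 / S) m \<theta>0 x K)) \<and>
        (\<integral>x. f (psgd J (J \<rightarrow>\<^sub>E {0..B}) G (1 / S) m \<theta>0 x K) \<partial>PiM UNIV (\<lambda>_. D)) - (INF \<theta>\<in>J \<rightarrow>\<^sub>E {0..B}. f \<theta>) \<le> \<epsilon>"
    using integrable_f_iter[of K] expected_gap[of K] le unfolding fmin_def by auto
qed

text \<open>Logarithmically many iterations make the contracted initial gap at most half of
  \<epsilon>, and a batch of order \<open>\<sigma>^2 / \<epsilon>\<close> does the same for the
  noise.\<close>

lemma sample_complexity_le:
  assumes \<epsilon>: "0 < \<epsilon>" "\<epsilon> \<le> 1"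
  shows "ereal_of_enat (sample_complexity TYPE('n) J (J \<rightarrow>\<^sub>E {0..B}) f \<sigma> \<epsilon>)
    \<le> ereal ((1 + Q) * (2 * (N * (B * Gb)) + 3) * (2 * (27 * c * N + 1) + 2) * ((1 + \<sigma>\<^sup>2) * (1 + ln (1 / \<epsilon>)) / \<epsilon>))"
proof -
  define A where "A = N * (B * Gb)"
  define b where "b = 27 * c * N + 1"
  define l where "l = ln (1 / \<epsilon>)"
  \<comment> \<open>From \<open>Q / (1 + Q) \<le> exp (- 1 / (1 + Q))\<close>. With
    \<open>A + 1\<close> in place of \<open>A\<close> the logarithm is defined and nonnegative even
    if the range bound is 0.\<close>
  define K where "K = nat \<lceil>(1 + Q) * ln (2 * (A + 1) / \<epsilon>)\<rceil>"
  \<comment> \<open>The added 1 keeps the batch nonempty when \<sigma> is 0.\<close>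
  define m where "m = nat \<lceil>2 * b * \<sigma>\<^sup>2 / \<epsilon>\<rceil> + 1"
  have A: "0 \<le> A" unfolding A_def by (rule range_nonneg)
  have b: "1 \<le> b" using c_nonneg N_nonneg by (simp add: b_def)
  have l: "0 \<le> l" using \<epsilon> by (simp add: l_def)
  have ln: "ln (2 * (A + 1) / \<epsilon>) = ln (2 * (A + 1)) + l" "0 \<le> ln (2 * (A + 1))" "ln (2 * (A + 1)) \<le> 2 * (A + 1)"
    using A \<epsilon> ln_le_minus_one[of "2 * (A + 1)"] by (auto simp: l_def ln_div ln_mult)
  have K_le: "real K \<le> (1 + Q) * (2 * A + 3) * (1 + l)"
  proof -
    have "real K \<le> (1 + Q) * ln (2 * (A + 1) / \<epsilon>) + 1"
    proof -
      have "0 \<le> (1 + Q) * ln (2 * (A + 1) / \<epsilon>)" using Q_ge ln l by (intro mult_nonneg_nonneg) auto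
      then show ?thesis unfolding K_def by linarith
    qed
    also have "\<dots> \<le> (1 + Q) * (2 * A + 2 + l) + (1 + Q)"
      using ln Q_ge by (intro add_mono mult_left_mono) auto
    also have "\<dots> = (1 + Q) * (2 * A + 3 + l)" by (simp add: algebra_simps)
    also have "\<dots> \<le> (1 + Q) * ((2 * A + 3) * (1 + l))"
    proof (intro mult_left_mono)
      have "0 \<le> (2 * A + 2) * l" using A l by simp
      then show "2 * A + 3 + l \<le> (2 * A + 3) * (1 + l)" by (simp add: algebra_simps)
    qed (use Q_ge in simp)
    finally show ?thesis by (simp add: mult.assoc)
  qed
  have m_le: "real m \<le> (2 * b + 2) * ((1 + \<sigma>\<^sup>2) / \<epsilon>)"
  proof -
    have "0 \<le> 2 * b * \<sigma>\<^sup>2 / \<epsilon>" using b \<epsilon> by simp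
    then have "real m \<le> 2 * b * \<sigma>\<^sup>2 / \<epsilon> + 2" unfolding m_def by linarith
    also have "\<dots> \<le> 2 * b * \<sigma>\<^sup>2 / \<epsilon> + 2 / \<epsilon>" using \<epsilon> by (simp add: le_divide_eq)
    also have "\<dots> \<le> 2 * b * \<sigma>\<^sup>2 / \<epsilon> + 2 / \<epsilon> + (2 * b / \<epsilon> + 2 * \<sigma>\<^sup>2 / \<epsilon>)" using \<epsilon> b by simp
    also have "\<dots> = (2 * b + 2) * ((1 + \<sigma>\<^sup>2) / \<epsilon>)" using \<epsilon> by (simp add: field_simps)
    finally show ?thesis .
  qed
  have geo: "(Q / (1 + Q)) ^ K * A \<le> \<epsilon> / 2"
  proof -
    have "Q / (1 + Q) = 1 + - (1 / (1 + Q))" using Q_ge by (simp add: field_simps)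
    also have "\<dots> \<le> exp (- (1 / (1 + Q)))" by (rule exp_ge_add_one_self)
    finally have "(Q / (1 + Q)) ^ K \<le> exp (- (1 / (1 + Q))) ^ K" using Q_ge by (intro power_mono) auto
    also have "\<dots> = exp (- (real K / (1 + Q)))" by (simp add: exp_of_nat_mult[symmetric])
    also have "\<dots> \<le> exp (- ln (2 * (A + 1) / \<epsilon>))"
    proof -
      have "(1 + Q) * ln (2 * (A + 1) / \<epsilon>) \<le> real K" unfolding K_def by linarith
      then show ?thesis using Q_ge by (simp add: field_simps)
    qed
    also have "\<dots> = \<epsilon> / (2 * (A + 1))" using A \<epsilon> by (simp add: exp_minus)
    finally have "(Q / (1 + Q)) ^ K * A \<le> \<epsilon> / (2 * (A + 1)) * A" using A by (rule mult_right_mono)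
    also have "\<dots> \<le> \<epsilon> / 2" using A \<epsilon> by (simp add: field_simps)
    finally show ?thesis .
  qed
  have noise: "b * (\<sigma>\<^sup>2 / real m) \<le> \<epsilon> / 2"
  proof -
    have "2 * b * \<sigma>\<^sup>2 / \<epsilon> \<le> real m" unfolding m_def by linarith
    then have "2 * b * \<sigma>\<^sup>2 \<le> real m * \<epsilon>" using \<epsilon> by (simp add: divide_le_eq)
    moreover have "0 < real m" unfolding m_def by simp
    ultimately show ?thesis by (simp add: field_simps)
  qed
  have "psgd_guarantee TYPE('n) J (J \<rightarrow>\<^sub>E {0..B}) f \<sigma> \<epsilon> S K m"
  proof (rule psgd_guarantee_bound)
    show "0 < m" by (simp add: m_def)
    show "(Q / (1 + Q)) ^ K * (N * (B * Gb)) + (27 * c * N + 1) * (\<sigma>\<^sup>2 / real m) \<le> \<epsilon>"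
      using geo noise unfolding A_def b_def by linarith
  qed
  then have "sample_complexity TYPE('n) J (J \<rightarrow>\<^sub>E {0..B}) f \<sigma> \<epsilon> \<le> enat (K * m)"
    unfolding sample_complexity_def using grad_lipschitz_S
    by (intro Inf_lower CollectI exI[of _ K] exI[of _ m] exI[of _ S]) (simp add: m_def)
  then have "ereal_of_enat (sample_complexity TYPE('n) J (J \<rightarrow>\<^sub>E {0..B}) f \<sigma> \<epsilon>) \<le> ereal_of_enat (enat (K * m))"
    by (simp only: ereal_of_enat_le_iff)
  also have "\<dots> = ereal (real K * real m)" by simp
  also have "real K * real m \<le> ((1 + Q) * (2 * A + 3) * (1 + l)) * ((2 * b + 2) * ((1 + \<sigma>\<^sup>2) / \<epsilon>))"
    using K_le m_le Q_ge A l by (intro mult_mono) auto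
  also have "\<dots> = (1 + Q) * (2 * A + 3) * (2 * b + 2) * ((1 + \<sigma>\<^sup>2) * (1 + l) / \<epsilon>)"
    by (simp only: times_divide_eq_right mult.assoc mult.commute mult.left_commute)
  finally show ?thesis unfolding A_def b_def l_def by simp
qed

end

context base_stock_model begin

section \<open>Sample complexity\<close>

definition dom_const :: "nat \<Rightarrow> real" where
  "dom_const T = real T / ((\<alpha> * \<nu>min)\<^sup>2 * (2 * (\<kappa> * \<mu>D)))"

lemma objective_box_gradient_dominated:
  "box_gradient_dominated (coords T) B (obj T) (partial T) (Lg T) (real T * H) (dom_const T)"
proof
  show "finite (coords T :: (nat \<times> 'b) set)" by (simp add: coords_def)
  show "0 \<le> B" by (rule B_nonneg)
  show "0 \<le> Lg T" using H_nonneg LX_ge by (simp add: Lg_def)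
  show "0 \<le> dom_const T" using \<kappa>_pos \<mu>D_pos by (simp add: dom_const_def)
  show "obj T \<in> borel_measurable (PiM (coords T) (\<lambda>_. borel))" by (rule measurable_obj)
next
  fix \<theta> and p :: "nat \<times> 'b" assume "p \<in> coords T"
  then have p: "fst p \<in> {1..T}" by (auto simp: coords_def)
  show "((\<lambda>z. obj T (\<theta>(p := z))) has_real_derivative partial T \<theta> p) (at (\<theta> p))"
    by (rule obj_partial_derivative[OF p])
  show "\<bar>partial T \<theta> p\<bar> \<le> real T * H" by (rule partial_bound[OF p])
next
  fix \<theta> \<eta> :: "nat \<times> 'b \<Rightarrow> real" and p :: "nat \<times> 'b"
  assume \<theta>: "\<theta> \<in> coords T \<rightarrow>\<^sub>E {0..B}" and \<eta>: "\<eta> \<in> coords T \<rightarrow>\<^sub>E {0..B}" and "p \<in> coords T"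
  then have p: "fst p \<in> {1..T}" by (auto simp: coords_def)
  show "\<bar>partial T \<theta> p - partial T \<eta> p\<bar> \<le> Lg T * L2_set (\<lambda>j. \<theta> j - \<eta> j) (coords T)"
  proof (rule partial_lipschitz[OF p])
    fix r :: "nat \<times> 'b"
    show "\<bar>\<theta> r - \<eta> r\<bar> \<le> L2_set (\<lambda>j. \<theta> j - \<eta> j) (coords T)"
    proof (cases "r \<in> coords T")
      case True
      then show ?thesis
        using member_le_L2_set[of "coords T" r "\<lambda>j. \<bar>\<theta> j - \<eta> j\<bar>"] by (simp add: coords_def L2_set_def)
    next
      case False
      \<comment> \<open>Extensional functions agree outside the coordinates, so the Euclidean
        distance also bounds the uniform distance that \<open>partial_lipschitz\<close> asks
        for.\<close>
      then show ?thesis using PiE_arb[OF \<theta>] PiE_arb[OF \<eta>] by simp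
    qed
  qed
next
  fix \<theta> \<eta> R :: "nat \<times> 'b \<Rightarrow> real"
  assume \<theta>: "\<theta> \<in> coords T \<rightarrow>\<^sub>E {0..B}" and \<eta>: "\<eta> \<in> coords T \<rightarrow>\<^sub>E {0..B}" and R: "\<And>j. 0 \<le> R j"
    and lower: "\<And>j. j \<in> coords T \<Longrightarrow> \<theta> j < B \<Longrightarrow> - R j \<le> partial T \<theta> j"
    and upper: "\<And>j. j \<in> coords T \<Longrightarrow> 0 < \<theta> j \<Longrightarrow> partial T \<theta> j \<le> R j"
  have c: "p \<in> coords T" if "fst p \<in> {1..T}" for p :: "nat \<times> 'b" using that by (cases p) (simp add: coords_def)
  have box: "0 \<le> \<zeta> (s, i) \<and> \<zeta> (s, i) \<le> B" if "\<zeta> \<in> coords T \<rightarrow>\<^sub>E {0..B}" "s \<in> {1..T}" for \<zeta> s and i :: 'b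
    using PiE_mem[OF that(1), of "(s, i)"] c[of "(s, i)"] that(2) by simp
  have "obj T \<theta> - obj T \<eta> \<le> real T * (((\<Sum>p\<in>{1..T} \<times> UNIV. R p) / (\<alpha> * \<nu>min))\<^sup>2 / (2 * (\<kappa> * \<mu>D)))"
    by (rule gradient_domination) (use box[OF \<theta>] box[OF \<eta>] R lower upper c in auto)
  then show "obj T \<theta> - obj T \<eta> \<le> dom_const T * (\<Sum>j\<in>coords T. R j)\<^sup>2"
    by (simp add: dom_const_def coords_def power_divide)
qed

text \<open>The three factors come from the iteration count, the initial gap and the batch size,
  each with its power of the horizon removed; 18 is twice the 9 in \<open>Lg\<close>.\<close>

definition rate_const :: real where
  "rate_const = (let n = real CARD('b); c0 = 1 / ((\<alpha> * \<nu>min)\<^sup>2 * (2 * (\<kappa> * \<mu>D))) in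
     (24 * c0 * n * (18 * H * LX * n + 1) + 2) * (2 * n * B * H + 3) * (54 * c0 * n + 4))"

text \<open>The exponent 9 is 5 + 2 + 2. The inverse stepsize grows like \<open>T ^ 3\<close>, the
  domination constant and the dimension like \<open>T\<close>, so \<open>Q\<close> is of order
  \<open>T ^ 5\<close>; range and batch constants are of order \<open>T ^ 2\<close> each.\<close>

lemma sample_complexity_poly:
  assumes T: "1 \<le> T" and \<epsilon>: "0 < \<epsilon>" "\<epsilon> \<le> 1"
  shows "ereal_of_enat (sample_complexity TYPE('n) (coords T) (levels T B) (obj T) \<sigma> \<epsilon>)
    \<le> ereal (rate_const * (1 + \<sigma>\<^sup>2) * real T ^ 9 * (1 + ln (1 / \<epsilon>)) ^ 1 / \<epsilon>)"
proof -
  interpret box: box_gradient_dominated "coords T" B "obj T" "partial T" "Lg T" "real T * H" "dom_const T"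
    by (rule objective_box_gradient_dominated)
  define n where "n = real CARD('b)"
  define c0 where "c0 = 1 / ((\<alpha> * \<nu>min)\<^sup>2 * (2 * (\<kappa> * \<mu>D)))"
  define s0 where "s0 = 18 * H * LX * n + 1"
  define x where "x = real T"
  have x: "1 \<le> x" "0 \<le> x" using T by (auto simp: x_def)
  have nn: "0 \<le> n" "0 \<le> c0" "0 \<le> H" "0 \<le> LX" "0 \<le> B"
    using \<kappa>_pos \<mu>D_pos H_nonneg LX_ge B_nonneg by (auto simp: n_def c0_def)
  have s0: "1 \<le> s0" using nn by (simp add: s0_def)
  have N: "box.N = x * n" unfolding box.N_def by (simp add: coords_def card_cartesian_product x_def n_def)
  have c: "dom_const T = c0 * x" by (simp add: dom_const_def c0_def x_def)
  have S: "box.S \<le> s0 * x ^ 3"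
  proof -
    have "box.S = 18 * H * LX * n * x ^ 3 + 1"
      unfolding box.S_def N by (simp add: Lg_def x_def power2_eq_square power3_eq_cube)
    also have "\<dots> \<le> 18 * H * LX * n * x ^ 3 + x ^ 3" using x by (simp add: one_le_power)
    finally show ?thesis by (simp add: s0_def algebra_simps)
  qed
  have Q: "1 + box.Q \<le> (24 * c0 * n * s0 + 2) * x ^ 5"
  proof -
    have "box.Q = 24 * (c0 * x) * (x * n) * box.S + 1"
      by (simp only: c[symmetric] N[symmetric] box.Q_def)
    then have "1 + box.Q = (24 * c0 * n * x\<^sup>2) * box.S + 2"
      by (simp only: power2_eq_square) (simp add: algebra_simps)
    also have "\<dots> \<le> (24 * c0 * n * x\<^sup>2) * (s0 * x ^ 3) + 2 * x ^ 5"
      using S nn x by (intro add_mono mult_left_mono) (auto simp: one_le_power)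
    also have "\<dots> = (24 * c0 * n * s0 + 2) * x ^ 5" by (simp add: algebra_simps eval_nat_numeral)
    finally show ?thesis .
  qed
  have sq: "1 \<le> x\<^sup>2" using x by (simp add: one_le_power)
  have A: "2 * (box.N * (B * (real T * H))) + 3 \<le> (2 * n * B * H + 3) * x\<^sup>2"
    unfolding N x_def[symmetric] using sq by (simp add: algebra_simps power2_eq_square)
  have b: "2 * (27 * dom_const T * box.N + 1) + 2 \<le> (54 * c0 * n + 4) * x\<^sup>2"
    unfolding N c using sq by (simp add: algebra_simps power2_eq_square)
  let ?w = "(1 + \<sigma>\<^sup>2) * (1 + ln (1 / \<epsilon>)) / \<epsilon>"
  have w: "0 \<le> ?w" using \<epsilon> by simp
  have A0: "0 \<le> 2 * (box.N * (B * (real T * H))) + 3" using box.range_nonneg by simp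
  have b0: "0 \<le> 2 * (27 * dom_const T * box.N + 1) + 2"
    using box.c_nonneg box.N_nonneg by (intro add_nonneg_nonneg mult_nonneg_nonneg) auto
  have "(1 + box.Q) * (2 * (box.N * (B * (real T * H))) + 3) * (2 * (27 * dom_const T * box.N + 1) + 2) * ?w
    \<le> ((24 * c0 * n * s0 + 2) * x ^ 5) * ((2 * n * B * H + 3) * x\<^sup>2) * ((54 * c0 * n + 4) * x\<^sup>2) * ?w"
    using Q A b w A0 b0 box.Q_ge nn s0 x by (intro mult_right_mono[OF _ w] mult_mono mult_nonneg_nonneg) auto
  also have "\<dots> = rate_const * (1 + \<sigma>\<^sup>2) * real T ^ 9 * (1 + ln (1 / \<epsilon>)) ^ 1 / \<epsilon>"
    unfolding rate_const_def Let_def n_def[symmetric] c0_def[symmetric] s0_def[symmetric] x_def[symmetric]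
    by (simp add: eval_nat_numeral mult_ac)
  finally show ?thesis
    using box.sample_complexity_le[OF \<epsilon>, where 'n = 'n and \<sigma> = \<sigma>] unfolding levels_def
    by (meson ereal_less_eq(3) order_trans)
qed

end

lemma objective_cong:
  assumes "\<And>t. t \<in> {1..T} \<Longrightarrow> h t = h' t \<and> b t = b' t"
  shows "objective M X1 W D PD h b T = objective M X1 W D PD h' b' T"
  unfolding objective_def realized_cost_def period_cost_def
  using assms by (intro ext Bochner_Integration.integral_cong sum.cong refl) auto

text \<open>The exponents are fixed before \<kappa> and \<open>H\<close>, and the constant before
  horizon, costs, variance and accuracy: \<open>rate_const\<close> depends only on the model and on
  the cost bounds.\<close>

theorem mainTheorem7:
  fixes M :: "'w measure"
    and X1 :: "'w \<Rightarrow> real"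
    and W :: "nat \<Rightarrow> 'w \<Rightarrow> 's::finite"
    and D :: "nat \<Rightarrow> 'w \<Rightarrow> real"
    and P :: "'s \<Rightarrow> 's pmf"
    and \<nu> :: "'s pmf"
    and PD :: "'s \<Rightarrow> real measure"
    and \<rho> :: "real \<Rightarrow> real"
    and B L\<rho> LD \<alpha> \<mu>D :: real
  assumes model: "markov_inventory M X1 W D P \<nu> PD \<rho> B"
    and A1: "prob_space.indep_set M
               (sets (vimage_algebra (space M) X1 borel))
               (sets (vimage_algebra (space M) (\<lambda>\<omega>. \<lambda>t\<in>{1..}. (W t \<omega>, D t \<omega>))
                 (PiM {1..} (\<lambda>_. count_space UNIV \<Otimes>\<^sub>M borel))))"
    and A2: "L\<rho>-lipschitz_on UNIV \<rho>" "\<And>i. LD-lipschitz_on UNIV (cdf (PD i))"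
    and A3: "0 < \<alpha>" "\<alpha> \<le> \<rho> 0" "\<And>i. cdf (PD i) B \<le> 1 - \<alpha>"
    and A4: "0 < \<mu>D"
      "\<And>i. \<exists>f\<in>borel_measurable borel. (\<forall>z. 0 \<le> f z) \<and>
             PD i = density lborel (\<lambda>z. ennreal (f z)) \<and> (\<forall>z\<in>{0..B}. \<mu>D \<le> f z)"
  shows "\<exists>p q :: nat. \<forall>\<kappa> H :: real. 0 < \<kappa> \<longrightarrow> (\<exists>C :: real. \<forall>(T :: nat) (h :: nat \<Rightarrow> real) (b :: nat \<Rightarrow> real).
           1 \<le> T \<longrightarrow>
           (\<forall>t\<in>{1..T}. 0 \<le> h t \<and> h t \<le> H \<and> 0 \<le> b t \<and> b t \<le> H \<and> \<kappa> \<le> h t + b t) \<longrightarrow>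
           contains_optimal_policy M X1 W D PD h b T B \<longrightarrow>
           (\<forall>\<sigma> \<epsilon> :: real. 0 \<le> \<sigma> \<longrightarrow> 0 < \<epsilon> \<longrightarrow> \<epsilon> \<le> 1 \<longrightarrow>
             ereal_of_enat (sample_complexity TYPE('n) (coords T) (levels T B)
                 (objective M X1 W D PD h b T) \<sigma> \<epsilon>)
               \<le> ereal (C * (1 + \<sigma>\<^sup>2) * real T ^ p * (1 + ln (1 / \<epsilon>)) ^ q / \<epsilon>)))"
proof (rule exI[of _ 9], rule exI[of _ 1], intro allI impI)
  fix \<kappa> H :: real assume \<kappa>: "0 < \<kappa>"
  show "\<exists>C :: real. \<forall>(T :: nat) (h :: nat \<Rightarrow> real) (b :: nat \<Rightarrow> real).
           1 \<le> T \<longrightarrow>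
           (\<forall>t\<in>{1..T}. 0 \<le> h t \<and> h t \<le> H \<and> 0 \<le> b t \<and> b t \<le> H \<and> \<kappa> \<le> h t + b t) \<longrightarrow>
           contains_optimal_policy M X1 W D PD h b T B \<longrightarrow>
           (\<forall>\<sigma> \<epsilon> :: real. 0 \<le> \<sigma> \<longrightarrow> 0 < \<epsilon> \<longrightarrow> \<epsilon> \<le> 1 \<longrightarrow>
             ereal_of_enat (sample_complexity TYPE('n) (coords T) (levels T B)
                 (objective M X1 W D PD h b T) \<sigma> \<epsilon>)
               \<le> ereal (C * (1 + \<sigma>\<^sup>2) * real T ^ 9 * (1 + ln (1 / \<epsilon>)) ^ 1 / \<epsilon>))"
  proof (intro exI allI impI)
    fix T :: nat and h b :: "nat \<Rightarrow> real" and \<sigma> \<epsilon> :: real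
    assume T: "1 \<le> T"
      and hb: "\<forall>t\<in>{1..T}. 0 \<le> h t \<and> h t \<le> H \<and> 0 \<le> b t \<and> b t \<le> H \<and> \<kappa> \<le> h t + b t"
      and \<epsilon>: "0 < \<epsilon>" "\<epsilon> \<le> 1"
    \<comment> \<open>The locale wants cost bounds in every period, so the costs of period 1 are
      used outside the horizon, where the objective does not see them.\<close>
    define h' where "h' t = (if t \<in> {1..T} then h t else h 1)" for t
    define b' where "b' t = (if t \<in> {1..T} then b t else b 1)" for t
    have bounds: "0 \<le> h' t" "h' t \<le> H" "0 \<le> b' t" "b' t \<le> H" "\<kappa> \<le> h' t + b' t" for t
      using hb T by (auto simp: h'_def b'_def)
    interpret markov_inventory M X1 W D P \<nu> PD \<rho> B by (rule model)
    interpret base_stock_model M X1 W D P \<nu> PD \<rho> B h' b' H \<kappa> L\<rho> LD \<alpha> \<mu>D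
      by unfold_locales (fact A1 bounds \<kappa> A2 A3 A4)+
    have "objective M X1 W D PD h b T = objective M X1 W D PD h' b' T"
      by (rule objective_cong) (simp add: h'_def b'_def)
    then show "ereal_of_enat (sample_complexity TYPE('n) (coords T) (levels T B)
                 (objective M X1 W D PD h b T) \<sigma> \<epsilon>)
               \<le> ereal (base_stock_model.rate_const \<nu> B H \<kappa> L\<rho> LD \<alpha> \<mu>D * (1 + \<sigma>\<^sup>2) * real T ^ 9 * (1 + ln (1 / \<epsilon>)) ^ 1 / \<epsilon>)"
      using sample_complexity_poly[OF T \<epsilon>, where 'n = 'n and \<sigma> = \<sigma>] by simp
  qed
qed

end
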